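(* Let $(u_{1,h},u_{2,h},\mathbf q_{L,1,h},\mathbf q_{R,1,h},\mathbf q_{L,2,h},\mathbf q_{R,2,h})$ and $(\tilde u_{1,h},\tilde u_{2,h},\tilde{\mathbf q}_{L,1,h},\tilde{\mathbf q}_{R,1,h},\tilde{\mathbf q}_{L,2,h},\tilde{\mathbf q}_{R,2,h})$ be two solutions of the central local discontinuous Galerkin (LDG) scheme described in the context, with the same source term $f$ and the same parameters (but possibly different initial values). Put $e_{u_{1,h}}=u_{1,h}-\tilde u_{1,h}$ and $e_{u_{2,h}}=u_{2,h}-\tilde u_{2,h}$. Then the scheme is $L^2$ stable, in the sense that $$\|e_{u_{1,h}}(T)\|^2_{L^2(\Omega)}+\|e_{u_{2,h}}(T)\|^2_{L^2(\Omega)}\le \|e_{u_{1,h}}(0)\|^2_{L^2(\Omega)}+\|e_{u_{2,h}}(0)\|^2_{L^2(\Omega)} .$$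
   Context: Let $\Omega=(0,1)\times(0,1)$, $T>0$, $1<\alpha,\beta<2$, $\tau_{max}>0$ (in the paper, an upper bound for the time step size due to the CFL restriction), $k$ the polynomial degree, and $f$ a given source term on $\Omega\times[0,T]$. Fractional derivatives. For $0<s<1$ and functions on $(0,1)$, ${}_0D_x^{s}w(x)=\frac{1}{\Gamma(1-s)}\frac{d}{dx}\int_0^x(x-\xi)^{-s}w(\xi)\,d\xi$ and ${}_xD_1^{s}w(x)=\frac{-1}{\Gamma(1-s)}\frac{d}{dx}\int_x^1(\xi-x)^{-s}w(\xi)\,d\xi$ (left and right Riemann-Liouville derivatives); for functions on $\Omega$ they act in the indicated variable with the other fixed. For $\mathbf q=(q^x,q^y)$ set $\mathbf D_L^{s,r}\mathbf q=({}_0D_x^{s}q^x,{}_0D_y^{r}q^y)$ and $\mathbf D_R^{s,r}\mathbf q=({}_xD_1^{s}q^x,{}_yD_1^{r}q^y)$. Write $a=(2-\alpha)/2$, $b=(2-\beta)/2$. Meshes. $h=1/N$, $N\in\mathbb N$; $x_j=y_j=jh$ for $0\le j\le N$; $x_{j+1/2}=\frac12(x_j+x_{j+1})$, $y_{j+1/2}=\frac12(y_j+y_{j+1})$ for $0\le j\le N-1$, and $x_{-1/2}=x_0$, $y_{-1/2}=y_0$, $x_{N+1/2}=x_N$, $y_{N+1/2}=y_N$. Cells: $I_{i,j}=(x_i,x_{i+1})\times(y_j,y_{j+1})$ for $0\le i,j\le N-1$, and $\bar I_{i,j}=(x_{i-1/2},x_{i+1/2})\times(y_{j-1/2},y_{j+1/2})$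 for $0\le i,j\le N$. $V_h$ (resp. $W_h$) is the space of functions on $\Omega$ that are polynomials in two variables of degree at most $k$ on each $I_{i,j}$ (resp. each $\bar I_{i,j}$), with no continuity across cell boundaries. $(f,g)_I=\int_I fg\,d\mathbf x$ and $(f,g)_{\partial I}=\int_{\partial I}fg\,ds$ (dot product for vector functions); $\mathbf n$ is the unit outer normal of the cell in question; $\nabla\boldsymbol\phi$ of a vector function $\boldsymbol\phi$ denotes its divergence. Bilinear forms. For families $\boldsymbol\phi_{L,2}=\{\boldsymbol\phi_{L,2}^{i,j}\}$, etc., define $$\begin{aligned}B_1(u_1,u_2,\mathbf q_{L,2},\mathbf q_{R,2},v_1,\boldsymbol\phi_{L,2},\boldsymbol\phi_{R,2})=&\sum_{i,j=0}^{N-1}\int_0^T\Big(\tfrac{\partial u_1}{\partial t},v_1\Big)_{I_{i,j}}+\tfrac1{\tau_{max}}(u_1-u_2,v_1)_{I_{i,j}}+(\mathbf q_{L,2}+\mathbf q_{R,2},\nabla v_1)_{I_{i,j}}-(\mathbf n\cdot(\mathbf q_{L,2}+\mathbf q_{R,2}),v_1)_{\partial I_{i,j}}\,dt\\&+\sum_{i,j=0}^{N}\int_0^T(\mathbf D_L^{a,b}\mathbf q_{L,2},\mathbf D_R^{a,b}\boldsymbol\phi_{L,2}^{i,j})_\Omega+(u_1,\nabla\boldsymbol\phi_{L,2}^{i,j})_{\bar I_{i,j}}-(u_1,\mathbf n\cdot\boldsymbol\phi_{L,2}^{i,j})_{\partial\bar I_{i,j}}\\&\qquad+(\mathbf D_R^{a,b}\mathbf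 q_{R,2},\mathbf D_L^{a,b}\boldsymbol\phi_{R,2}^{i,j})_\Omega+(u_1,\nabla\boldsymbol\phi_{R,2}^{i,j})_{\bar I_{i,j}}-(u_1,\mathbf n\cdot\boldsymbol\phi_{R,2}^{i,j})_{\partial\bar I_{i,j}}\,dt,\end{aligned}$$ $$\begin{aligned}B_2(u_2,u_1,\mathbf q_{L,1},\mathbf q_{R,1},v_2,\boldsymbol\phi_{L,1},\boldsymbol\phi_{R,1})=&\sum_{i,j=0}^{N}\int_0^T\Big(\tfrac{\partial u_2}{\partial t},v_2\Big)_{\bar I_{i,j}}+\tfrac1{\tau_{max}}(u_2-u_1,v_2)_{\bar I_{i,j}}+(\mathbf q_{L,1}+\mathbf q_{R,1},\nabla v_2)_{\bar I_{i,j}}-(\mathbf n\cdot(\mathbf q_{L,1}+\mathbf q_{R,1}),v_2)_{\partial\bar I_{i,j}}\,dt\\&+\sum_{i,j=0}^{N-1}\int_0^T(\mathbf D_L^{a,b}\mathbf q_{L,1},\mathbf D_R^{a,b}\boldsymbol\phi_{L,1}^{i,j})_\Omega+(u_2,\nabla\boldsymbol\phi_{L,1}^{i,j})_{I_{i,j}}-(u_2,\mathbf n\cdot\boldsymbol\phi_{L,1}^{i,j})_{\partial I_{i,j}}\\&\qquad+(\mathbf D_R^{a,b}\mathbf q_{R,1},\mathbf D_L^{a,b}\boldsymbol\phi_{R,1}^{i,j})_\Omega+(u_2,\nabla\boldsymbol\phi_{R,1}^{i,j})_{I_{i,j}}-(u_2,\mathbf n\cdot\boldsymbol\phi_{R,1}^{i,j})_{\partial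 I_{i,j}}\,dt.\end{aligned}$$ Scheme. A solution of the central LDG scheme consists of $u_{1,h}\in H^1(0,T;V_h)$, $u_{2,h}\in H^1(0,T;W_h)$, $\mathbf q_{L,1,h},\mathbf q_{R,1,h}\in(L^2(0,T;V_h))^2$, $\mathbf q_{L,2,h},\mathbf q_{R,2,h}\in(L^2(0,T;W_h))^2$, with $\mathbf q_{\cdot}=(q^x_\cdot,q^y_\cdot)$, such that $$B_1(u_{1,h},u_{2,h},\mathbf q_{L,2,h},\mathbf q_{R,2,h},v_1,\boldsymbol\phi_{L,2},\boldsymbol\phi_{R,2})=\int_0^T(f,v_1)_\Omega\,dt,\qquad B_2(u_{2,h},u_{1,h},\mathbf q_{L,1,h},\mathbf q_{R,1,h},v_2,\boldsymbol\phi_{L,1},\boldsymbol\phi_{R,1})=\int_0^T(f,v_2)_\Omega\,dt$$ for all $v_1\in H^1(0,T;V_h)$, $v_2\in H^1(0,T;W_h)$, $\boldsymbol\phi^{i,j}_{L,1},\boldsymbol\phi^{i,j}_{R,1}\in(L^2(0,T;V_h))^2$ vanishing outside the closure of $I_{i,j}$, and $\boldsymbol\phi^{i,j}_{L,2},\boldsymbol\phi^{i,j}_{R,2}\in(L^2(0,T;W_h))^2$ vanishing outside the closure of $\bar I_{i,j}$. In addition $u_{1,h}=u_{2,h}=0$ on $(\mathbb R^2\setminus\Omega)\times[0,T]$ (so on edges contained in $\partial\Omega$ the values of $u_1$ and $u_2$ in the boundary terms $(u_1,\mathbf n\cdot\boldsymbol\phi)_{\partial\bar I_{i,j}}$ and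 $(u_2,\mathbf n\cdot\boldsymbol\phi)_{\partial I_{i,j}}$ are $0$), and for $m=1,2$: $q^x_{L,m,h}(0,y,t)=q^x_{R,m,h}(1,y,t)=q^y_{L,m,h}(x,0,t)=q^y_{R,m,h}(x,1,t)=0$. In boundary terms, on an edge of the relevant cell the test function trace is taken from inside that cell. *)

theory Defs
  imports "HOL-Analysis.Analysis"
begin

text \<open>
  All integrals are taken with respect to the complete measure \<^const>\<open>lebesgue\<close>. Discrete
  functions are total functions on the plane, whose values on the grid lines and outside the
  domain carry no information unless stated otherwise.
\<close>

type_synonym scalar_field = "real \<times> real \<Rightarrow> real"
type_synonym vector_field = "real \<times> real \<Rightarrow> real \<times> real"

definition Omega :: "(real \<times> real) set" where
  "Omega = {0<..<1} \<times> {0<..<1}"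


section \<open>Riemann-Liouville derivatives\<close>

definition RL_left :: "real \<Rightarrow> (real \<Rightarrow> real) \<Rightarrow> real \<Rightarrow> real" where
  "RL_left s w x = 1 / Gamma (1 - s) *
     deriv (\<lambda>z. LINT \<xi>:{0<..<z}|lebesgue. (z - \<xi>) powr (- s) * w \<xi>) x"

definition RL_right :: "real \<Rightarrow> (real \<Rightarrow> real) \<Rightarrow> real \<Rightarrow> real" where
  "RL_right s w x = - 1 / Gamma (1 - s) *
     deriv (\<lambda>z. LINT \<xi>:{z<..<1}|lebesgue. (\<xi> - z) powr (- s) * w \<xi>) x"

definition D_left :: "real \<Rightarrow> real \<Rightarrow> vector_field \<Rightarrow> vector_field" where
  "D_left s r q = (\<lambda>(x, y). (RL_left s (\<lambda>\<xi>. fst (q (\<xi>, y))) x, RL_left r (\<lambda>\<eta>. snd (q (x, \<eta>))) y))"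

definition D_right :: "real \<Rightarrow> real \<Rightarrow> vector_field \<Rightarrow> vector_field" where
  "D_right s r q = (\<lambda>(x, y). (RL_right s (\<lambda>\<xi>. fst (q (\<xi>, y))) x, RL_right r (\<lambda>\<eta>. snd (q (x, \<eta>))) y))"


section \<open>Meshes and broken polynomial spaces\<close>

text \<open>
  A mesh is given by a number \<open>M\<close> of cells per direction and grid points \<open>g 0 < \<dots> < g M\<close>.
  The primal mesh has \<open>M = N\<close> and \<open>g = node N\<close>; the dual mesh has \<open>M = N + 1\<close> and
  \<open>g = dual_node N\<close>, where \<open>dual_node N m\<close> is the point with index \<open>m - 1/2\<close> (\<open>0 \<le> m \<le> N + 1\<close>),
  so that the dual cell around node \<open>i\<close> extends from \<open>dual_node N i\<close> to \<open>dual_node N (i + 1)\<close>.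
\<close>

definition node :: "nat \<Rightarrow> nat \<Rightarrow> real" where
  "node N j = real j / real N"

definition dual_node :: "nat \<Rightarrow> nat \<Rightarrow> real" where
  "dual_node N m =
     (if m = 0 then node N 0
      else if m = N + 1 then node N N
      else (node N (m - 1) + node N m) / 2)"

definition cell :: "(nat \<Rightarrow> real) \<Rightarrow> nat \<Rightarrow> nat \<Rightarrow> (real \<times> real) set" where
  "cell g i j = {g i<..<g (i + 1)} \<times> {g j<..<g (j + 1)}"

text \<open>The degree is the total degree.\<close>

definition broken_poly :: "nat \<Rightarrow> nat \<Rightarrow> (nat \<Rightarrow> real) \<Rightarrow> scalar_field set" where
  "broken_poly k M g =
     {w. \<forall>i<M. \<forall>j<M. \<exists>c :: nat \<Rightarrow> nat \<Rightarrow> real. \<forall>(x, y)\<in>cell g i j.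
           w (x, y) = (\<Sum>m\<le>k. \<Sum>n\<le>k - m. c m n * x ^ m * y ^ n)}"

definition V_h :: "nat \<Rightarrow> nat \<Rightarrow> scalar_field set" where
  "V_h k N = broken_poly k N (node N)"

definition W_h :: "nat \<Rightarrow> nat \<Rightarrow> scalar_field set" where
  "W_h k N = broken_poly k (N + 1) (dual_node N)"


section \<open>Inner products, traces and boundary integrals\<close>

definition ip :: "(real \<times> real) set \<Rightarrow> (real \<times> real \<Rightarrow> 'a::real_inner) \<Rightarrow> (real \<times> real \<Rightarrow> 'a) \<Rightarrow> real" where
  "ip C f g = (LINT p:C|lebesgue. f p \<bullet> g p)"

definition L2_norm :: "scalar_field \<Rightarrow> real" where
  "L2_norm w = sqrt (LINT p:Omega|lebesgue. (w p)\<^sup>2)"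

definition trace_from :: "(real \<times> real) set \<Rightarrow> (real \<times> real \<Rightarrow> 'a::t2_space) \<Rightarrow> real \<times> real \<Rightarrow> 'a" where
  "trace_from C w p = Lim (at p within C) w"

text \<open>
  The integral over the boundary of a cell with respect to arc length; the integrand depends on the
  outer unit normal and the point.
\<close>

definition bd_integral ::
  "(nat \<Rightarrow> real) \<Rightarrow> nat \<Rightarrow> nat \<Rightarrow> (real \<times> real \<Rightarrow> real \<times> real \<Rightarrow> real) \<Rightarrow> real" where
  "bd_integral g i j F =
     (LINT y:{g j<..<g (j + 1)}|lebesgue. F (1, 0) (g (i + 1), y)) +
     (LINT y:{g j<..<g (j + 1)}|lebesgue. F (- 1, 0) (g i, y)) +
     (LINT x:{g i<..<g (i + 1)}|lebesgue. F (0, 1) (x, g (j + 1))) +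
     (LINT x:{g i<..<g (i + 1)}|lebesgue. F (0, - 1) (x, g j))"

definition grad :: "scalar_field \<Rightarrow> vector_field" where
  "grad v = (\<lambda>(x, y). (deriv (\<lambda>\<xi>. v (\<xi>, y)) x, deriv (\<lambda>\<eta>. v (x, \<eta>)) y))"

definition divergence :: "vector_field \<Rightarrow> scalar_field" where
  "divergence q = (\<lambda>(x, y). deriv (\<lambda>\<xi>. fst (q (\<xi>, y))) x + deriv (\<lambda>\<eta>. snd (q (x, \<eta>))) y)"


section \<open>Function spaces in time\<close>

text \<open>
  Square integrable functions of time with values in a space \<open>X\<close> of square integrable functions
  on the domain, via the identification of \<open>L\<^sup>2(0,T;L\<^sup>2)\<close> with \<open>L\<^sup>2\<close> of the space-time cylinder.
\<close>

definition L2_time :: "real \<Rightarrow> scalar_field set \<Rightarrow> (real \<Rightarrow> scalar_field) set" where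
  "L2_time T X =
     {w. (AE t in lebesgue_on {0..T}. w t \<in> X) \<and>
         set_borel_measurable lebesgue ({0..T} \<times> Omega) (\<lambda>(t, p). w t p) \<and>
         set_integrable lebesgue ({0..T} \<times> Omega) (\<lambda>(t, p). (w t p)\<^sup>2)}"

definition L2_time_vec :: "real \<Rightarrow> scalar_field set \<Rightarrow> (real \<Rightarrow> vector_field) set" where
  "L2_time_vec T X =
     {q. (\<lambda>t p. fst (q t p)) \<in> L2_time T X \<and> (\<lambda>t p. snd (q t p)) \<in> L2_time T X}"

text \<open>
  \<open>g\<close> is the time derivative of \<open>u\<close>: the continuous representative \<open>u\<close> is the indefinite
  (Bochner) integral of the square integrable function \<open>g\<close>. Equality in \<open>L\<^sup>2\<close> of the domain is
  equality almost everywhere. Such a \<open>g\<close> is unique up to null sets, so the choice made in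
  \<open>time_deriv\<close> is immaterial.
\<close>

definition has_time_deriv :: "real \<Rightarrow> (real \<Rightarrow> scalar_field) \<Rightarrow> (real \<Rightarrow> scalar_field) \<Rightarrow> bool" where
  "has_time_deriv T u g \<longleftrightarrow>
     g \<in> L2_time T UNIV \<and>
     (\<forall>t\<in>{0..T}. AE p in lebesgue_on Omega. u t p = u 0 p + (LINT s:{0..t}|lebesgue. g s p))"

definition time_deriv :: "real \<Rightarrow> (real \<Rightarrow> scalar_field) \<Rightarrow> real \<Rightarrow> scalar_field" where
  "time_deriv T u = (SOME g. has_time_deriv T u g)"

definition H1_time :: "real \<Rightarrow> scalar_field set \<Rightarrow> (real \<Rightarrow> scalar_field) set" where
  "H1_time T X =
     {u. (\<forall>t\<in>{0..T}. u t \<in> X) \<and> u \<in> L2_time T X \<and> (\<exists>g\<in>L2_time T X. has_time_deriv T u g)}"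


section \<open>Bilinear forms and the central LDG scheme\<close>

text \<open>
  The two bilinear forms differ only in the roles of the meshes: \<open>u\<close> and \<open>v\<close> live on the mesh
  \<open>(M, g)\<close>, while \<open>w\<close>, \<open>qL\<close>, \<open>qR\<close>, \<open>\<phi>L\<close>, \<open>\<phi>R\<close> live on the mesh \<open>(M', g')\<close>.
  Traces of test functions are taken from inside the cell over whose boundary one integrates. Edges
  of one mesh meet the grid lines of the other in finitely many points or in the boundary of the
  domain. Inside the domain the remaining factors \<open>u\<close> and \<open>qL + qR\<close> are thus continuous at almost
  every point of these edges; on the boundary of the domain \<open>u\<close> enters with the value assigned to it
  there (which is \<open>0\<close> in the scheme) and \<open>qL + qR\<close> with its trace from inside the domain.
\<close>

definition LDG_form ::
  "real \<Rightarrow> real \<Rightarrow> real \<Rightarrow> real \<Rightarrow> nat \<Rightarrow> (nat \<Rightarrow> real) \<Rightarrow> nat \<Rightarrow> (nat \<Rightarrow> real) \<Rightarrow>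
   (real \<Rightarrow> scalar_field) \<Rightarrow> (real \<Rightarrow> scalar_field) \<Rightarrow>
   (real \<Rightarrow> vector_field) \<Rightarrow> (real \<Rightarrow> vector_field) \<Rightarrow>
   (real \<Rightarrow> scalar_field) \<Rightarrow>
   (nat \<Rightarrow> nat \<Rightarrow> real \<Rightarrow> vector_field) \<Rightarrow> (nat \<Rightarrow> nat \<Rightarrow> real \<Rightarrow> vector_field) \<Rightarrow> real" where
  "LDG_form \<alpha> \<beta> \<tau>max T M g M' g' u w qL qR v \<phi>L \<phi>R =
     (let a = (2 - \<alpha>) / 2; b = (2 - \<beta>) / 2 in
     (\<Sum>i<M. \<Sum>j<M. LINT t:{0..T}|lebesgue.
         ip (cell g i j) (time_deriv T u t) (v t)
       + 1 / \<tau>max * ip (cell g i j) (\<lambda>p. u t p - w t p) (v t)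
       + ip (cell g i j) (\<lambda>p. qL t p + qR t p) (grad (v t))
       - bd_integral g i j (\<lambda>n p.
           (n \<bullet> trace_from Omega (\<lambda>p'. qL t p' + qR t p') p) * trace_from (cell g i j) (v t) p))
   + (\<Sum>i<M'. \<Sum>j<M'. LINT t:{0..T}|lebesgue.
         ip Omega (D_left a b (qL t)) (D_right a b (\<phi>L i j t))
       + ip (cell g' i j) (u t) (divergence (\<phi>L i j t))
       - bd_integral g' i j (\<lambda>n p. u t p * (n \<bullet> trace_from (cell g' i j) (\<phi>L i j t) p))
       + ip Omega (D_right a b (qR t)) (D_left a b (\<phi>R i j t))
       + ip (cell g' i j) (u t) (divergence (\<phi>R i j t))
       - bd_integral g' i j (\<lambda>n p. u t p * (n \<bullet> trace_from (cell g' i j) (\<phi>R i j t) p))))"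

definition B1 where
  "B1 \<alpha> \<beta> \<tau>max T N = LDG_form \<alpha> \<beta> \<tau>max T N (node N) (N + 1) (dual_node N)"

definition B2 where
  "B2 \<alpha> \<beta> \<tau>max T N = LDG_form \<alpha> \<beta> \<tau>max T (N + 1) (dual_node N) N (node N)"

text \<open>Admissible families of vector test functions, the \<open>(i, j)\<close> member being supported in the \<open>(i, j)\<close> cell.\<close>

definition local_tests ::
  "real \<Rightarrow> scalar_field set \<Rightarrow> nat \<Rightarrow> (nat \<Rightarrow> real) \<Rightarrow> (nat \<Rightarrow> nat \<Rightarrow> real \<Rightarrow> vector_field) set" where
  "local_tests T X M g =
     {\<phi>. \<forall>i<M. \<forall>j<M. \<phi> i j \<in> L2_time_vec T X \<and>
          (AE t in lebesgue_on {0..T}. \<forall>p \<in> Omega - closure (cell g i j). \<phi> i j t p = 0)}"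

definition flux_bc :: "real \<Rightarrow> (real \<Rightarrow> vector_field) \<Rightarrow> (real \<Rightarrow> vector_field) \<Rightarrow> bool" where
  "flux_bc T qL qR \<longleftrightarrow>
     (AE t in lebesgue_on {0..T}. AE s in lebesgue_on {0<..<1}.
        trace_from Omega (\<lambda>p. fst (qL t p)) (0, s) = 0 \<and>
        trace_from Omega (\<lambda>p. fst (qR t p)) (1, s) = 0 \<and>
        trace_from Omega (\<lambda>p. snd (qL t p)) (s, 0) = 0 \<and>
        trace_from Omega (\<lambda>p. snd (qR t p)) (s, 1) = 0)"

definition LDG_solution ::
  "real \<Rightarrow> real \<Rightarrow> real \<Rightarrow> real \<Rightarrow> nat \<Rightarrow> nat \<Rightarrow> (real \<Rightarrow> scalar_field) \<Rightarrow>
   (real \<Rightarrow> scalar_field) \<Rightarrow> (real \<Rightarrow> scalar_field) \<Rightarrow>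
   (real \<Rightarrow> vector_field) \<Rightarrow> (real \<Rightarrow> vector_field) \<Rightarrow>
   (real \<Rightarrow> vector_field) \<Rightarrow> (real \<Rightarrow> vector_field) \<Rightarrow> bool" where
  "LDG_solution \<alpha> \<beta> \<tau>max T k N f u1 u2 qL1 qR1 qL2 qR2 \<longleftrightarrow>
     u1 \<in> H1_time T (V_h k N) \<and> u2 \<in> H1_time T (W_h k N) \<and>
     qL1 \<in> L2_time_vec T (V_h k N) \<and> qR1 \<in> L2_time_vec T (V_h k N) \<and>
     qL2 \<in> L2_time_vec T (W_h k N) \<and> qR2 \<in> L2_time_vec T (W_h k N) \<and>
     (\<forall>t\<in>{0..T}. \<forall>p. p \<notin> Omega \<longrightarrow> u1 t p = 0 \<and> u2 t p = 0) \<and>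
     flux_bc T qL1 qR1 \<and> flux_bc T qL2 qR2 \<and>
     (\<forall>v1 \<in> H1_time T (V_h k N).
        \<forall>\<phi>L2 \<in> local_tests T (W_h k N) (N + 1) (dual_node N).
        \<forall>\<phi>R2 \<in> local_tests T (W_h k N) (N + 1) (dual_node N).
          B1 \<alpha> \<beta> \<tau>max T N u1 u2 qL2 qR2 v1 \<phi>L2 \<phi>R2 = (LINT t:{0..T}|lebesgue. ip Omega (f t) (v1 t))) \<and>
     (\<forall>v2 \<in> H1_time T (W_h k N).
        \<forall>\<phi>L1 \<in> local_tests T (V_h k N) N (node N).
        \<forall>\<phi>R1 \<in> local_tests T (V_h k N) N (node N).
          B2 \<alpha> \<beta> \<tau>max T N u2 u1 qL1 qR1 v2 \<phi>L1 \<phi>R1 = (LINT t:{0..T}|lebesgue. ip Omega (f t) (v2 t)))"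

end

theory Submission
  imports Defs
begin

text \<open>
  The difference of two solutions solves the homogeneous scheme. Test it with itself, the fluxes
  being cut off to single cells. The gradient and divergence terms of each equation cancel by
  integration by parts: on interior edges every jump belongs to exactly one of the two meshes, and
  on the boundary of the domain the vanishing boundary values of \<open>u\<close> remove one of the two flux
  terms. The fractional pairings are nonnegative, and the relaxation terms add up to
  \<open>1 / \<tau>max\<close> times the squared norm of \<open>e1 - e2\<close>. What remains is the time derivative of the
  energy.

  In the basis of monomials on cells every term becomes a finite sum of products of coefficients
  with one-dimensional integrals. The coefficients are square integrable in time, so all time
  integrals converge and the equations of the two solutions can be subtracted.
\<close>

section \<open>Fractional derivatives of truncated powers\<close>

text \<open>Nonnegativity of the fractional pairing is the main analytic point. A left derivative of
  order \<open>a\<close> paired with a right derivative of order \<open>a\<close> equals a left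
  derivative of order \<open>2 * a\<close> paired with the function itself. As
  \<open>2 * a < 1\<close>, the kernel of that order, a negative power, is a Laplace mixture of the
  kernels \<open>exp (- l * z)\<close>. Each of these solves a first-order equation, for which
  positivity is an elementary energy identity on the unit interval, valid for piecewise polynomials
  with jumps.

  The other obstacle is totality: integrals, \<open>deriv\<close> and \<open>Lim\<close> have
  default values where they are undefined, so \<open>LDG_form\<close> cannot be treated as bilinear
  beforehand. Each solution is therefore evaluated separately against the same test functions, and
  only the resulting integrable functions of time are subtracted.\<close>

lemma borel_measurable_lebesgue_cong_AE:
  fixes f g :: "'a::euclidean_space \<Rightarrow> real"
  assumes f: "f \<in> borel_measurable lebesgue" and ae: "AE x in lebesgue. f x = g x"
  shows "g \<in> borel_measurable lebesgue"
proof (rule measurableI)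
  fix A :: "real set" assume A: "A \<in> sets borel"
  have "f -` A \<inter> space lebesgue \<in> sets lebesgue" using f A by (rule measurable_sets)
  moreover have "AE x in lebesgue. (x \<in> f -` A \<inter> space lebesgue) = (x \<in> g -` A \<inter> space lebesgue)"
    using ae by eventually_elim auto
  ultimately show "g -` A \<inter> space lebesgue \<in> sets lebesgue"
    using completion.in_sets_AE by blast
qed auto

lemma integral_lebesgue_cong_AE:
  fixes f g :: "'a::euclidean_space \<Rightarrow> real"
  assumes ae: "AE x in lebesgue. f x = g x"
  shows "integral\<^sup>L lebesgue f = integral\<^sup>L lebesgue g"
proof (cases "f \<in> borel_measurable lebesgue")
  case True
  then show ?thesis using borel_measurable_lebesgue_cong_AE[OF True ae] ae by (intro integral_cong_AE)
next
  case False
  then have "g \<notin> borel_measurable lebesgue"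
    using borel_measurable_lebesgue_cong_AE[of g f] ae by (auto simp: eq_commute)
  then show ?thesis using False
    by (metis borel_measurable_integrable not_integrable_integral_eq)
qed

lemma integrable_lebesgue_cong_AE:
  fixes f g :: "'a::euclidean_space \<Rightarrow> real"
  assumes f: "integrable lebesgue f" and ae: "AE x in lebesgue. f x = g x"
  shows "integrable lebesgue g"
  using f borel_measurable_lebesgue_cong_AE[OF _ ae] ae
  by (intro integrable_cong_AE_imp[OF f]) (auto simp: eq_commute)

lemma AE_lebesgue_notin_finite: "finite S \<Longrightarrow> AE x::real in lebesgue. x \<notin> S"
  by (intro AE_not_in) (auto intro: finite_imp_null_set_lborel null_sets_completionI)

section \<open>Truncated powers and Euler's Beta integral\<close>

text \<open>
  Truncated powers, normalised so that fractional integrals and derivatives just shift the exponent.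
\<close>

definition lpow :: "real \<Rightarrow> real \<Rightarrow> real \<Rightarrow> real" where
  "lpow c r x = (if c < x then (x - c) powr r / Gamma (r + 1) else 0)"

definition rpow :: "real \<Rightarrow> real \<Rightarrow> real \<Rightarrow> real" where
  "rpow d r x = (if x < d then (d - x) powr r / Gamma (r + 1) else 0)"

lemma lpow_measurable [measurable]: "lpow c r \<in> borel_measurable borel"
  unfolding lpow_def[abs_def] by measurable

lemma rpow_measurable [measurable]: "rpow d r \<in> borel_measurable borel"
  unfolding rpow_def[abs_def] by measurable

lemma Gamma_pos: "r > -1 \<Longrightarrow> Gamma (r + 1 :: real) > 0"
  by (intro Gamma_real_pos) simp

lemma lpow_nonneg: "r > -1 \<Longrightarrow> 0 \<le> lpow c r x"
  using Gamma_pos[of r] by (simp add: lpow_def)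

lemma rpow_nonneg: "r > -1 \<Longrightarrow> 0 \<le> rpow c r x"
  using Gamma_pos[of r] by (simp add: rpow_def)

lemma has_bochner_integral_Beta:
  assumes "p > -1" "q > -1"
  shows "has_bochner_integral lborel
    (\<lambda>t. indicator {0<..<1} t * (t powr p * (1 - t) powr q)) (Beta (p + 1) (q + 1 :: real))"
proof (rule has_bochner_integral_nn_integral)
  have *: "((\<lambda>t. t powr p * (1 - t) powr q) has_integral Beta (p + 1) (q + 1)) {0<..<1}"
    using has_integral_Beta_real[of "p + 1" "q + 1"] assms by (simp add: has_integral_Icc_iff_Ioo)
  show "(\<integral>\<^sup>+ t. ennreal (indicator {0<..<1} t * (t powr p * (1 - t) powr q)) \<partial>lborel) = ennreal (Beta (p + 1) (q + 1))"
    using nn_integral_has_integral_lebesgue[OF _ *] by simp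
  show "0 \<le> Beta (p + 1) (q + 1)"
    using assms unfolding Beta_def
    by (intro divide_nonneg_nonneg mult_nonneg_nonneg less_imp_le[OF Gamma_real_pos]) auto
qed auto

text \<open>The semigroup law of fractional integration, i.e. Euler's Beta integral.\<close>

lemma has_bochner_integral_lpow_rpow:
  assumes "p > -1" "q > -1"
  shows "has_bochner_integral lborel (\<lambda>x. lpow c p x * rpow d q x) (lpow c (p + q + 1) d)"
proof (cases "c < d")
  case True
  have G: "Gamma (p + 1) > 0" "Gamma (q + 1) > 0" using assms Gamma_pos by auto
  \<comment> \<open>The affine substitution \<open>t = (x - c) / (d - c)\<close> carries the Beta
    integral over the unit interval to \<open>c < x < d\<close>. The factor multiplied on below
    restores the powers of \<open>d - c\<close> and the normalisation by Gamma values.\<close>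
  have "has_bochner_integral lborel
     (\<lambda>x. indicator {0<..<1} (- c / (d - c) + (1 / (d - c)) * x) *
        ((- c / (d - c) + (1 / (d - c)) * x) powr p * (1 - (- c / (d - c) + (1 / (d - c)) * x)) powr q))
     (Beta (p + 1) (q + 1) /\<^sub>R \<bar>1 / (d - c)\<bar>)"
    using has_bochner_integral_Beta[OF assms] True
    by (subst lborel_has_bochner_integral_real_affine_iff[symmetric]) auto
  from has_bochner_integral_mult_right[OF this, of "(d - c) powr (p + q) / (Gamma (p + 1) * Gamma (q + 1))"]
  have 1: "has_bochner_integral lborel
     (\<lambda>x. (d - c) powr (p + q) / (Gamma (p + 1) * Gamma (q + 1)) * 
       (indicator {0<..<1} (- c / (d - c) + (1 / (d - c)) * x) *
        ((- c / (d - c) + (1 / (d - c)) * x) powr p * (1 - (- c / (d - c) + (1 / (d - c)) * x)) powr q)))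
     ((d - c) powr (p + q) / (Gamma (p + 1) * Gamma (q + 1)) * (Beta (p + 1) (q + 1) /\<^sub>R \<bar>1 / (d - c)\<bar>))"
    by simp
  have "(d - c) powr (p + q) / (Gamma (p + 1) * Gamma (q + 1)) * (Beta (p + 1) (q + 1) /\<^sub>R \<bar>1 / (d - c)\<bar>)
      = lpow c (p + q + 1) d"
  proof -
    have "(d - c) powr (p + q + 1) = (d - c) powr (p + q) * (d - c)"
      using True by (simp add: powr_add)
    moreover have "p + q + 1 + 1 = (p + 1) + (q + 1)" by simp
    ultimately have "(d - c) powr (p + q) / (Gamma (p + 1) * Gamma (q + 1)) * (Beta (p + 1) (q + 1) / (1 / (d - c)))
      = (d - c) powr (p + q + 1) / Gamma (p + q + 1 + 1)"
      using G unfolding Beta_def by simp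
    then show ?thesis
      using True unfolding lpow_def by (simp add: divide_inverse mult_ac)
  qed
  moreover have "(d - c) powr (p + q) / (Gamma (p + 1) * Gamma (q + 1)) * 
       (indicator {0<..<1} (- c / (d - c) + (1 / (d - c)) * x) *
        ((- c / (d - c) + (1 / (d - c)) * x) powr p * (1 - (- c / (d - c) + (1 / (d - c)) * x)) powr q))
      = lpow c p x * rpow d q x" for x
  proof -
    have e1: "- c / (d - c) + (1 / (d - c)) * x = (x - c) / (d - c)"
      by (simp add: diff_divide_distrib)
    have e2: "1 - (x - c) / (d - c) = (d - x) / (d - c)"
      using True by (simp add: field_simps)
    have e3: "(x - c) / (d - c) \<in> {0<..<1} \<longleftrightarrow> c < x \<and> x < d"
      using True by (auto simp: field_simps)
    show ?thesis
    proof (cases "c < x \<and> x < d")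
      case T: True
      have "(d - c) powr (p + q) * (((x - c) / (d - c)) powr p * ((d - x) / (d - c)) powr q)
         = (x - c) powr p * (d - x) powr q"
        using True T by (simp add: powr_divide powr_add)
      then show ?thesis unfolding e1 e2 lpow_def rpow_def using T e3 G
        by (simp add: field_simps)
    next
      case False
      then show ?thesis unfolding e1 e2 lpow_def rpow_def using e3 by (auto simp: indicator_def)
    qed
  qed
  ultimately show ?thesis using 1 by simp
next
  case False
  have "lpow c p x * rpow d q x = 0" for x using False by (auto simp: lpow_def rpow_def)
  then have "(\<lambda>x. lpow c p x * rpow d q x) = (\<lambda>_. 0)" by blast
  moreover have "lpow c (p + q + 1) d = 0" using False by (simp add: lpow_def)
  ultimately show ?thesis by (simp add: has_bochner_integral_zero)
qed

text \<open>The derivative as a relation, bundled with convergence of the fractional integrals.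
  Since the integral and \<open>deriv\<close> are total, sums could not be handled from the values
  of \<open>RL_left\<close> alone.\<close>

definition has_RL_left :: "real \<Rightarrow> (real \<Rightarrow> real) \<Rightarrow> real \<Rightarrow> real \<Rightarrow> bool" where
  "has_RL_left s f D x \<longleftrightarrow>
     (\<forall>z\<in>{0<..<1}. set_integrable lebesgue {0<..<z} (\<lambda>\<xi>. (z - \<xi>) powr (- s) * f \<xi>)) \<and>
     ((\<lambda>z. LINT \<xi>:{0<..<z}|lebesgue. (z - \<xi>) powr (- s) * f \<xi>) has_real_derivative Gamma (1 - s) * D) (at x)"

lemma has_RL_left_imp:
  assumes "has_RL_left s f D x" "0 < s" "s < 1"
  shows "RL_left s f x = D"
proof -
  have "Gamma (1 - s) \<noteq> 0" using Gamma_real_pos[of "1 - s"] assms by linarith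
  then show ?thesis using assms unfolding has_RL_left_def RL_left_def
    by (auto dest!: DERIV_imp_deriv)
qed


text \<open>Values at finitely many points do not enter the integrals. Discrete functions are
  unspecified on grid lines, so along a line across the mesh they can be replaced by combinations of
  truncated powers.\<close>

lemma has_RL_left_cong_finite:
  assumes "has_RL_left s f D x" "finite S" "\<And>\<xi>. \<xi> \<in> {0<..<1} - S \<Longrightarrow> f \<xi> = h \<xi>" "x \<in> {0<..<1}"
  shows "has_RL_left s h D x"
proof -
  have eq: "AE \<xi> in lebesgue. indicator {0<..<z} \<xi> *\<^sub>R ((z - \<xi>) powr (- s) * f \<xi>) =
      indicator {0<..<z} \<xi> *\<^sub>R ((z - \<xi>) powr (- s) * h \<xi>)" if "z \<in> {0<..<1}" for z
    using AE_lebesgue_notin_finite[OF assms(2)]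
    by eventually_elim (use assms(3) that in \<open>auto simp: indicator_def\<close>)
  have int: "(LINT \<xi>:{0<..<z}|lebesgue. (z - \<xi>) powr (- s) * f \<xi>) = (LINT \<xi>:{0<..<z}|lebesgue. (z - \<xi>) powr (- s) * h \<xi>)"
    if "z \<in> {0<..<1}" for z
    unfolding set_lebesgue_integral_def by (rule integral_lebesgue_cong_AE[OF eq[OF that]])
  have ev: "eventually (\<lambda>z. z \<in> {0<..<1::real}) (nhds x)"
    using assms(4) by (intro eventually_nhds_in_open) auto
  show ?thesis unfolding has_RL_left_def
  proof safe
    fix z :: real assume z: "z \<in> {0<..<1}"
    show "set_integrable lebesgue {0<..<z} (\<lambda>\<xi>. (z - \<xi>) powr (- s) * h \<xi>)"
      using assms(1) z unfolding set_integrable_def has_RL_left_def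
      by (intro integrable_lebesgue_cong_AE[OF _ eq]) auto
  next
    show "((\<lambda>z. LINT \<xi>:{0<..<z}|lebesgue. (z - \<xi>) powr - s * h \<xi>) has_real_derivative Gamma (1 - s) * D) (at x)"
    proof (rule DERIV_cong_ev[THEN iffD1, OF refl _ refl])
      show "((\<lambda>z. LINT \<xi>:{0<..<z}|lebesgue. (z - \<xi>) powr - s * f \<xi>) has_real_derivative Gamma (1 - s) * D) (at x)"
        using assms(1) by (simp add: has_RL_left_def)
      show "eventually (\<lambda>z. (LINT \<xi>:{0<..<z}|lebesgue. (z - \<xi>) powr - s * f \<xi>) = (LINT \<xi>:{0<..<z}|lebesgue. (z - \<xi>) powr - s * h \<xi>)) (nhds x)"
        using ev by eventually_elim (rule int)
    qed
  qed
qed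

lemma has_RL_left_cmult:
  assumes "has_RL_left s f D x"
  shows "has_RL_left s (\<lambda>\<xi>. c * f \<xi>) (c * D) x"
proof -
  have e: "(\<lambda>\<xi>. (z - \<xi>) powr (- s) * (c * f \<xi>)) = (\<lambda>\<xi>. c * ((z - \<xi>) powr (- s) * f \<xi>))" for z
    by (auto simp: algebra_simps)
  show ?thesis using assms DERIV_cmult[of _ "Gamma (1 - s) * D" x UNIV c] unfolding has_RL_left_def e
    by (auto simp: mult_ac)
qed

lemma has_RL_left_add:
  assumes "has_RL_left s f D x" "has_RL_left s f' D' x" and x: "x \<in> {0<..<1}"
  shows "has_RL_left s (\<lambda>\<xi>. f \<xi> + f' \<xi>) (D + D') x"
proof -
  have i: "set_integrable lebesgue {0<..<z} (\<lambda>\<xi>. (z - \<xi>) powr (- s) * f \<xi>)"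
      "set_integrable lebesgue {0<..<z} (\<lambda>\<xi>. (z - \<xi>) powr (- s) * f' \<xi>)" if "z \<in> {0<..<1}" for z
    using assms that by (auto simp: has_RL_left_def)
  have ev: "eventually (\<lambda>z. z \<in> {0<..<1::real}) (nhds x)"
    using x by (intro eventually_nhds_in_open) auto
  show ?thesis unfolding has_RL_left_def distrib_left
  proof safe
    show "((\<lambda>z. LINT \<xi>:{0<..<z}|lebesgue. (z - \<xi>) powr - s * f \<xi> + (z - \<xi>) powr - s * f' \<xi>) has_real_derivative
       Gamma (1 - s) * D + Gamma (1 - s) * D') (at x)"
    proof (rule DERIV_cong_ev[THEN iffD2, OF refl _ refl])
      show "((\<lambda>z. (LINT \<xi>:{0<..<z}|lebesgue. (z - \<xi>) powr - s * f \<xi>) + (LINT \<xi>:{0<..<z}|lebesgue. (z - \<xi>) powr - s * f' \<xi>)) has_real_derivative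
       Gamma (1 - s) * D + Gamma (1 - s) * D') (at x)"
        using assms by (intro DERIV_add) (auto simp: has_RL_left_def)
      show "\<forall>\<^sub>F z in nhds x. (LINT \<xi>:{0<..<z}|lebesgue. (z - \<xi>) powr - s * f \<xi> + (z - \<xi>) powr - s * f' \<xi>) =
           (LINT \<xi>:{0<..<z}|lebesgue. (z - \<xi>) powr - s * f \<xi>) + (LINT \<xi>:{0<..<z}|lebesgue. (z - \<xi>) powr - s * f' \<xi>)"
        using ev by eventually_elim (intro set_integral_add i)
    qed
  qed (intro set_integral_add i)
qed

lemma has_RL_left_zero: "has_RL_left s (\<lambda>_. 0) 0 x"
  by (simp add: has_RL_left_def set_integrable_def)

lemma has_RL_left_sum:
  assumes "\<And>e. e \<in> J \<Longrightarrow> has_RL_left s (f e) (D e) x" and "x \<in> {0<..<1}"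
  shows "has_RL_left s (\<lambda>\<xi>. \<Sum>e\<in>J. C e * f e \<xi>) (\<Sum>e\<in>J. C e * D e) x"
proof (cases "finite J")
  case True
  then show ?thesis using assms(1)
    by (induction J) (auto intro!: has_RL_left_zero has_RL_left_add has_RL_left_cmult assms(2))
qed (auto intro: has_RL_left_zero)

text \<open>The kernel \<open>(z - \<xi>) powr (- s)\<close> is \<open>Gamma (1 - s)\<close> times
  \<open>rpow z (- s)\<close>, so the semigroup law evaluates the integral, and differentiation then
  lowers the exponent by one. The point \<open>x = c\<close> is excluded because for
  \<open>r = 0\<close> the function \<open>lpow c (1 - s)\<close> has infinite slope there from the
  right.\<close>

lemma has_RL_left_lpow:
  assumes "0 < s" "s < 1" "0 \<le> c" "x \<noteq> c" "r \<ge> 0"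
  shows "has_RL_left s (lpow c r) (lpow c (r - s) x) x"
proof -
  have G: "Gamma (1 - s) > 0" using assms by (intro Gamma_real_pos) auto
  have hb: "has_bochner_integral lebesgue (\<lambda>\<xi>. indicator {0<..<z} \<xi> *\<^sub>R ((z - \<xi>) powr (- s) * lpow c r \<xi>))
      (Gamma (1 - s) * lpow c (r - s + 1) z)" for z
  proof -
    have "has_bochner_integral lborel (\<lambda>\<xi>. Gamma (1 - s) * (lpow c r \<xi> * rpow z (- s) \<xi>)) (Gamma (1 - s) * lpow c (r - s + 1) z)"
      using has_bochner_integral_lpow_rpow[of r "- s" c z] assms by (intro has_bochner_integral_mult_right) auto
    moreover have "Gamma (1 - s) * (lpow c r \<xi> * rpow z (- s) \<xi>) = indicator {0<..<z} \<xi> *\<^sub>R ((z - \<xi>) powr (- s) * lpow c r \<xi>)" for \<xi>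
      using assms less_imp_neq[OF G] by (auto simp: lpow_def rpow_def indicator_def)
    ultimately have "has_bochner_integral lborel (\<lambda>\<xi>. indicator {0<..<z} \<xi> *\<^sub>R ((z - \<xi>) powr (- s) * lpow c r \<xi>))
      (Gamma (1 - s) * lpow c (r - s + 1) z)" by simp
    then show ?thesis 
      by (auto simp: has_bochner_integral_iff integrable_completion integral_completion)
  qed
  have int: "(LINT \<xi>:{0<..<z}|lebesgue. (z - \<xi>) powr (- s) * lpow c r \<xi>) = Gamma (1 - s) * lpow c (r - s + 1) z" for z
    using hb[of z] by (simp add: set_lebesgue_integral_def has_bochner_integral_iff)
  have der: "(lpow c (r - s + 1) has_real_derivative lpow c (r - s) x) (at x)"
  proof (cases "c < x")
    case True
    have ev: "eventually (\<lambda>z. c < z) (nhds x)" using True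
      by (intro eventually_nhds_in_open[of "{c<..}" x, simplified]) auto
    have e: "Gamma (r - s + 1 + 1) = (r - s + 1) * Gamma (r - s + 1)"
      using assms by (intro Gamma_plus1) auto
    have g: "Gamma (r - s + 1) > 0" using assms by (intro Gamma_real_pos) auto
    have "((\<lambda>z. (z - c) powr (r - s + 1)) has_real_derivative (r - s + 1) * (x - c) powr (r - s)) (at x)"
      using True by (auto intro!: derivative_eq_intros)
    from DERIV_cdivide[OF this, of "Gamma (r - s + 1 + 1)"]
    have "((\<lambda>z. (z - c) powr (r - s + 1) / Gamma (r - s + 1 + 1)) has_real_derivative
        ((r - s + 1) * (x - c) powr (r - s)) / Gamma (r - s + 1 + 1)) (at x)" .
    also have "((r - s + 1) * (x - c) powr (r - s)) / Gamma (r - s + 1 + 1) = lpow c (r - s) x"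
    proof -
      have "r - s + 1 \<noteq> 0" using assms by linarith
      then have "((r - s + 1) * (x - c) powr (r - s)) / ((r - s + 1) * Gamma (r - s + 1)) = (x - c) powr (r - s) / Gamma (r - s + 1)"
        by (rule nonzero_mult_divide_mult_cancel_left)
      then show ?thesis using True by (simp only: lpow_def e if_True)
    qed
    finally have d: "((\<lambda>z. (z - c) powr (r - s + 1) / Gamma (r - s + 1 + 1)) has_real_derivative lpow c (r - s) x) (at x)" .
    have "eventually (\<lambda>z. lpow c (r - s + 1) z = (z - c) powr (r - s + 1) / Gamma (r - s + 1 + 1)) (nhds x)"
      using ev by eventually_elim (simp only: lpow_def if_True)
    from DERIV_cong_ev[THEN iffD2, OF refl this refl d] show ?thesis .
  next
    case False
    then have "x < c" using assms by auto
    then have ev: "eventually (\<lambda>z. z < c) (nhds x)"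
      by (intro eventually_nhds_in_open[of "{..<c}" x, simplified]) auto
    have "eventually (\<lambda>z. lpow c (r - s + 1) z = 0) (nhds x)"
      using ev by eventually_elim (auto simp: lpow_def)
    from DERIV_cong_ev[THEN iffD2, OF refl this refl, of 0]
    have "(lpow c (r - s + 1) has_real_derivative 0) (at x)" by simp
    moreover have "lpow c (r - s) x = 0" using False by (simp add: lpow_def)
    ultimately show ?thesis by simp
  qed
  show ?thesis
    unfolding has_RL_left_def int
    using hb DERIV_cmult[OF der, of "Gamma (1 - s)"] by (auto simp: set_integrable_def has_bochner_integral_iff)
qed

text \<open>Reflection of the unit interval exchanges the two derivatives: the sign in the
  definition of \<open>RL_right\<close> cancels the one produced by the chain rule.\<close>

lemma RL_right_eqI:
  assumes "has_RL_left s (\<lambda>\<xi>. w (1 - \<xi>)) D (1 - x)" "0 < s" "s < 1"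
  shows "RL_right s w x = D"
proof -
  define F where "F z = (LINT \<xi>:{0<..<z}|lebesgue. (z - \<xi>) powr (- s) * w (1 - \<xi>))" for z
  have eq: "(LINT \<xi>:{z<..<1}|lebesgue. (\<xi> - z) powr (- s) * w \<xi>) = F (1 - z)" for z
  proof -
    have "(LINT \<xi>:{z<..<1}|lebesgue. (\<xi> - z) powr (- s) * w \<xi>) = 
       \<bar>-1\<bar> *\<^sub>R integral\<^sup>L lebesgue (\<lambda>\<xi>. indicator {z<..<1} (1 + (-1) * \<xi>) *\<^sub>R (((1 + (-1) * \<xi>) - z) powr (- s) * w (1 + (-1) * \<xi>)))"
      unfolding set_lebesgue_integral_def
      by (rule lebesgue_integral_real_affine) auto
    also have "\<dots> = F (1 - z)" unfolding F_def set_lebesgue_integral_def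
      by (auto intro!: Bochner_Integration.integral_cong simp: indicator_def algebra_simps)
    finally show ?thesis .
  qed
  have "(F has_real_derivative Gamma (1 - s) * D) (at (1 - x))"
    using assms(1) by (simp add: has_RL_left_def F_def[abs_def])
  then have "((\<lambda>z. F (1 - z)) has_real_derivative (Gamma (1 - s) * D) * (-1)) (at x)"
    by (intro DERIV_chain2[where g = "\<lambda>z. 1 - z"]) (auto intro!: derivative_eq_intros)
  then have "deriv (\<lambda>z. F (1 - z)) x = - Gamma (1 - s) * D"
    by (simp add: DERIV_imp_deriv)
  moreover have "Gamma (1 - s) \<noteq> 0" using Gamma_real_pos[of "1 - s"] assms by linarith
  ultimately show ?thesis unfolding RL_right_def eq by simp
qed

lemma lpow_nat: "lpow c (real m) x = (if c < x then (x - c) ^ m / fact m else 0)"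
  using Gamma_fact[of m, where 'a = real] by (simp add: lpow_def powr_realpow add.commute)

section \<open>Coercivity of the fractional pairing\<close>

text \<open>
  For \<open>f = lpow c m\<close> this is \<open>f - l * w\<close>, where \<open>w' = f - l * w\<close> and \<open>w 0 = 0\<close>. Integrated against
  \<open>l powr (s - 1)\<close> it gives a multiple of the derivative of order \<open>s\<close>.
\<close>

fun hpow :: "real \<Rightarrow> real \<Rightarrow> nat \<Rightarrow> real \<Rightarrow> real" where
  "hpow l c 0 x = (if c < x then exp (- l * (x - c)) else 0)"
| "hpow l c (Suc n) x = (LINT \<xi>|lborel. indicator {c<..<x} \<xi> * (exp (- l * (x - \<xi>)) * lpow c (real n) \<xi>))"

lemma hpow_measurable: "(\<lambda>(l, x). hpow l c m x) \<in> borel_measurable (lborel \<Otimes>\<^sub>M lborel)"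
proof (cases m)
  case 0
  then show ?thesis by (simp add: case_prod_unfold)
next
  case (Suc n)
  \<comment> \<open>The interval depends on \<open>x\<close>. Written through
    \<open>x - \<xi>\<close>, its indicator is visibly a Borel function of both variables.\<close>
  have e: "indicator {c<..<x} \<xi> = (indicator {c<..} \<xi> * indicator {0<..} (x - \<xi>) :: real)" for x \<xi> :: real
    by (simp add: indicator_def)
  show ?thesis unfolding Suc hpow.simps case_prod_unfold
    by (subst e) measurable
qed

lemma exp_kernel_integrable:
  "integrable lborel (\<lambda>\<xi>. indicator {c<..<x} \<xi> * (exp (- l * (x - \<xi>)) * lpow c (real n) \<xi>))"
proof -
  have "integrable lborel (\<lambda>\<xi>. indicator {c<..<x} \<xi> * (exp (- l * (x - \<xi>)) * ((\<xi> - c) ^ n / fact n)))"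
  proof -
    have "set_integrable lborel {c..x} (\<lambda>\<xi>. exp (- l * (x - \<xi>)) * ((\<xi> - c) ^ n / fact n))"
      by (intro borel_integrable_atLeastAtMost' continuous_intros) auto
    then have "set_integrable lborel {c<..<x} (\<lambda>\<xi>. exp (- l * (x - \<xi>)) * ((\<xi> - c) ^ n / fact n))"
      by (rule set_integrable_subset) auto
    then show ?thesis by (simp add: set_integrable_def)
  qed
  also have "(\<lambda>\<xi>. indicator {c<..<x} \<xi> * (exp (- l * (x - \<xi>)) * ((\<xi> - c) ^ n / fact n))) =
    (\<lambda>\<xi>. indicator {c<..<x} \<xi> * (exp (- l * (x - \<xi>)) * lpow c (real n) \<xi>))"
    by (auto simp: lpow_nat indicator_def)
  finally show ?thesis .
qed

lemma hpow_nonneg: "0 \<le> hpow l c m x"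
  by (cases m) (auto intro!: integral_nonneg_AE AE_I2 mult_nonneg_nonneg lpow_nonneg)

text \<open>Euler's integral for \<open>Gamma s\<close>, rescaled by \<open>z\<close>. It is read as
  a formula for the singular kernel \<open>z powr (- s)\<close>: a positive mixture of exponential
  kernels with weight \<open>l powr (s - 1)\<close>.\<close>

lemma nn_integral_exp_powr:
  assumes "0 < s" "0 < z"
  shows "(\<integral>\<^sup>+ l. ennreal (indicator {0<..} l * (l powr (s - 1) * exp (- l * z))) \<partial>lborel)
     = ennreal (Gamma s * z powr (- s))"
proof -
  have "ennreal (Gamma s) = (\<integral>\<^sup>+ t. ennreal (indicator {0..} t * t powr (s - 1) / exp t) \<partial>lborel)"
    by (rule Gamma_conv_nn_integral_real) fact
  also have "\<dots> = \<bar>z\<bar> * (\<integral>\<^sup>+ l. ennreal (indicator {0..} (0 + z * l) * (0 + z * l) powr (s - 1) / exp (0 + z * l)) \<partial>lborel)"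
    using assms by (intro nn_integral_real_affine) auto
  also have "\<dots> = ennreal z * (\<integral>\<^sup>+ l. ennreal (z powr (s - 1)) * ennreal (indicator {0<..} l * (l powr (s - 1) * exp (- l * z))) \<partial>lborel)"
  proof -
    have "ennreal (indicator {0..} (0 + z * l) * (0 + z * l) powr (s - 1) / exp (0 + z * l)) =
      ennreal (z powr (s - 1)) * ennreal (indicator {0<..} l * (l powr (s - 1) * exp (- l * z)))" for l
      using assms
      by (cases "l = 0") (auto simp: ennreal_mult'[symmetric] indicator_def zero_le_mult_iff powr_mult exp_minus field_simps)
    then show ?thesis using assms by simp
  qed
  also have "\<dots> = ennreal (z * z powr (s - 1)) * (\<integral>\<^sup>+ l. ennreal (indicator {0<..} l * (l powr (s - 1) * exp (- l * z))) \<partial>lborel)"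
    using assms by (subst nn_integral_cmult) (auto simp: ennreal_mult' mult.assoc)
  also have "z * z powr (s - 1) = z powr s"
    using assms by (simp add: powr_diff)
  finally have *: "ennreal (Gamma s) = ennreal (z powr s) * (\<integral>\<^sup>+ l. ennreal (indicator {0<..} l * (l powr (s - 1) * exp (- l * z))) \<partial>lborel)" .
  have "ennreal (z powr (- s)) * ennreal (Gamma s) = 
     (ennreal (z powr (- s)) * ennreal (z powr s)) * (\<integral>\<^sup>+ l. ennreal (indicator {0<..} l * (l powr (s - 1) * exp (- l * z))) \<partial>lborel)"
    unfolding * by (simp add: mult.assoc)
  also have "ennreal (z powr (- s)) * ennreal (z powr s) = 1"
    using assms by (simp add: ennreal_mult'[symmetric] powr_add[symmetric])
  finally show ?thesis using assms by (simp add: ennreal_mult'[symmetric] mult.commute)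
qed

text \<open>Integrating over \<open>l\<close> first turns the exponential kernel into
  \<open>(x - \<xi>) powr (- s)\<close>, after which the semigroup law raises the exponent from
  \<open>n - s\<close> to \<open>n + 1 - s\<close>. For \<open>m = 0\<close> the derivative of the
  jump leaves the bare kernel. All integrands are nonnegative, so Tonelli applies without prior
  integrability.\<close>

lemma nn_integral_Laplace_hpow:
  assumes "0 < s" "s < 1"
  shows "(\<integral>\<^sup>+ l. ennreal (indicator {0<..} l * (l powr (s - 1) * hpow l c m x)) \<partial>lborel)
     = ennreal (Gamma s * Gamma (1 - s) * lpow c (real m - s) x)"
proof (cases m)
  case 0
  have "Gamma (1 - s) \<noteq> 0" using Gamma_real_pos[of "1 - s"] assms by linarith
  then show ?thesis using nn_integral_exp_powr[of s "x - c"] assms 0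
    by (auto simp: lpow_def indicator_def)
next
  case (Suc n)
  have G: "Gamma s > 0" "Gamma (1 - s) > 0" using assms by (auto intro: Gamma_real_pos)
  note hpow_measurable[unfolded case_prod_unfold, measurable]
  have eq: "ennreal (indicator {0<..} l * (l powr (s - 1) * hpow l c m x)) =
     (\<integral>\<^sup>+ \<xi>. ennreal (indicator {c<..<x} \<xi> * lpow c (real n) \<xi>) * ennreal (indicator {0<..} l * (l powr (s - 1) * exp (- l * (x - \<xi>)))) \<partial>lborel)" (is "?L = ?R") for l
  proof -
    have "?R = (\<integral>\<^sup>+ \<xi>. ennreal (indicator {0<..} l * l powr (s - 1)) * ennreal (indicator {c<..<x} \<xi> * (exp (- l * (x - \<xi>)) * lpow c (real n) \<xi>)) \<partial>lborel)"
      by (auto intro!: nn_integral_cong simp: ennreal_mult'[symmetric] lpow_nonneg mult_ac)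
    also have "\<dots> = ennreal (indicator {0<..} l * l powr (s - 1)) * (\<integral>\<^sup>+ \<xi>. ennreal (indicator {c<..<x} \<xi> * (exp (- l * (x - \<xi>)) * lpow c (real n) \<xi>)) \<partial>lborel)"
      by (rule nn_integral_cmult) measurable
    also have "(\<integral>\<^sup>+ \<xi>. ennreal (indicator {c<..<x} \<xi> * (exp (- l * (x - \<xi>)) * lpow c (real n) \<xi>)) \<partial>lborel) = ennreal (hpow l c m x)"
      unfolding Suc hpow.simps
      by (rule nn_integral_eq_integral[OF exp_kernel_integrable]) (auto intro!: AE_I2 mult_nonneg_nonneg lpow_nonneg)
    finally show ?thesis using hpow_nonneg[of l c m x] by (simp add: ennreal_mult'[symmetric] mult_ac)
  qed
  have "(\<integral>\<^sup>+ l. ennreal (indicator {0<..} l * (l powr (s - 1) * hpow l c m x)) \<partial>lborel) =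
     (\<integral>\<^sup>+ \<xi>. (\<integral>\<^sup>+ l. ennreal (indicator {c<..<x} \<xi> * lpow c (real n) \<xi>) * ennreal (indicator {0<..} l * (l powr (s - 1) * exp (- l * (x - \<xi>)))) \<partial>lborel) \<partial>lborel)"
    unfolding eq by (rule lborel_pair.Fubini') measurable
  also have "\<dots> = (\<integral>\<^sup>+ \<xi>. ennreal (Gamma s * Gamma (1 - s) * (lpow c (real n) \<xi> * rpow x (- s) \<xi>)) \<partial>lborel)"
  proof (rule nn_integral_cong)
    fix \<xi> :: real
    have "(\<integral>\<^sup>+ l. ennreal (indicator {c<..<x} \<xi> * lpow c (real n) \<xi>) * ennreal (indicator {0<..} l * (l powr (s - 1) * exp (- l * (x - \<xi>)))) \<partial>lborel)
      = ennreal (indicator {c<..<x} \<xi> * lpow c (real n) \<xi>) * (\<integral>\<^sup>+ l. ennreal (indicator {0<..} l * (l powr (s - 1) * exp (- l * (x - \<xi>)))) \<partial>lborel)"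
      by (rule nn_integral_cmult) measurable
    also have "\<dots> = ennreal (Gamma s * Gamma (1 - s) * (lpow c (real n) \<xi> * rpow x (- s) \<xi>))"
    proof (cases "c < \<xi> \<and> \<xi> < x")
      case True
      then show ?thesis using nn_integral_exp_powr[of s "x - \<xi>"] assms G less_imp_neq[OF G(2)]
        by (simp add: ennreal_mult'[symmetric] lpow_nonneg rpow_def mult_ac)
    next
      case False
      then show ?thesis by (auto simp: lpow_def rpow_def)
    qed
    finally show "(\<integral>\<^sup>+ l. ennreal (indicator {c<..<x} \<xi> * lpow c (real n) \<xi>) * ennreal (indicator {0<..} l * (l powr (s - 1) * exp (- l * (x - \<xi>)))) \<partial>lborel) = ennreal (Gamma s * Gamma (1 - s) * (lpow c (real n) \<xi> * rpow x (- s) \<xi>))" .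
  qed
  also have "\<dots> = ennreal (Gamma s * Gamma (1 - s) * lpow c (real n + - s + 1) x)"
  proof -
    have "has_bochner_integral lborel (\<lambda>\<xi>. Gamma s * Gamma (1 - s) * (lpow c (real n) \<xi> * rpow x (- s) \<xi>)) (Gamma s * Gamma (1 - s) * lpow c (real n + - s + 1) x)"
      using assms by (intro has_bochner_integral_mult_right has_bochner_integral_lpow_rpow) auto
    then show ?thesis using assms G
      by (subst nn_integral_eq_integral) (auto simp: has_bochner_integral_iff intro!: AE_I2 mult_nonneg_nonneg lpow_nonneg rpow_nonneg)
  qed
  finally show ?thesis using Suc by (simp add: add_ac algebra_simps)
qed

text \<open>Integration by parts in the exponential convolution: \<open>A\<close> gives the
  convolution term, while \<open>B\<close> differentiates the power. The boundary term at
  \<open>c\<close> carries the factor \<open>0 ^ m\<close>, so it survives only for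
  \<open>m = 0\<close>, where \<open>B\<close> vanishes and this term is all of
  \<open>hpow\<close>.\<close>

lemma hpow_resolvent:
  assumes "0 \<le> c" "0 < l"
  shows "hpow l c m x = lpow c (real m) x - l * (LINT \<xi>:{0..x}|lborel. exp (- l * (x - \<xi>)) * lpow c (real m) \<xi>)"
proof (cases "c < x")
  case False
  then have "indicator {0..x} \<xi> *\<^sub>R (exp (- l * (x - \<xi>)) * lpow c (real m) \<xi>) = 0" for \<xi>
    by (auto simp: lpow_def indicator_def)
  then have "(\<lambda>\<xi>. indicator {0..x} \<xi> *\<^sub>R (exp (- l * (x - \<xi>)) * lpow c (real m) \<xi>)) = (\<lambda>_. 0)" by blast
  then have "(LINT \<xi>:{0..x}|lborel. exp (- l * (x - \<xi>)) * lpow c (real m) \<xi>) = 0"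
    unfolding set_lebesgue_integral_def by (simp only: integral_zero)
  moreover have "hpow l c m x = 0" using False by (cases m) auto
  ultimately show ?thesis using False by (simp add: lpow_def)
next
  case True
  define e where "e \<xi> = exp (- l * (x - \<xi>))" for \<xi>
  define A where "A \<xi> = l * (e \<xi> * ((\<xi> - c) ^ m / fact m))" for \<xi>
  define B where "B \<xi> = e \<xi> * (real m * (\<xi> - c) ^ (m - 1) / fact m)" for \<xi>
  have cA: "continuous_on {c..x} A" and cB: "continuous_on {c..x} B"
    unfolding A_def[abs_def] B_def[abs_def] e_def by (auto intro!: continuous_intros)
  have iA: "integrable lborel (\<lambda>\<xi>. indicator {c..x} \<xi> *\<^sub>R A \<xi>)" and iB: "integrable lborel (\<lambda>\<xi>. indicator {c..x} \<xi> *\<^sub>R B \<xi>)"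
    using borel_integrable_atLeastAtMost'[OF cA] borel_integrable_atLeastAtMost'[OF cB]
    by (simp_all add: set_integrable_def)
  have "(LINT \<xi>:{c..x}|lborel. A \<xi> + B \<xi>) = e x * ((x - c) ^ m / fact m) - e c * ((c - c) ^ m / fact m)"
    unfolding set_lebesgue_integral_def
  proof (rule integral_FTC_Icc)
    show "continuous_on {c..x} (\<lambda>\<xi>. A \<xi> + B \<xi>)" by (intro continuous_on_add cA cB)
    show "((\<lambda>\<xi>. e \<xi> * ((\<xi> - c) ^ m / fact m)) has_vector_derivative A \<xi> + B \<xi>) (at \<xi> within {c..x})"
      for \<xi> unfolding A_def B_def e_def has_real_derivative_iff_has_vector_derivative[symmetric]
      by (auto intro!: derivative_eq_intros simp: field_simps)
  qed (use True in auto)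
  then have sum: "(LINT \<xi>:{c..x}|lborel. A \<xi>) + (LINT \<xi>:{c..x}|lborel. B \<xi>) = lpow c (real m) x - e c * (0 ^ m / fact m)"
    using iA iB True by (simp add: set_lebesgue_integral_def distrib_left lpow_nat e_def)
  have "AE \<xi> in lborel. \<xi> \<noteq> c" "AE \<xi> in lborel. \<xi> \<noteq> x"
    using AE_lborel_singleton by auto
  then have ae: "AE \<xi> in lborel. \<xi> \<noteq> c \<and> \<xi> \<noteq> x" by eventually_elim auto
  have "(LINT \<xi>:{c..x}|lborel. A \<xi>) = l * (LINT \<xi>:{0..x}|lborel. exp (- l * (x - \<xi>)) * lpow c (real m) \<xi>)"
    unfolding set_lebesgue_integral_def integral_mult_right_zero[symmetric]
  proof (rule integral_cong_AE)
    show "AE \<xi> in lborel. indicator {c..x} \<xi> *\<^sub>R A \<xi> = l * (indicator {0..x} \<xi> *\<^sub>R (exp (- l * (x - \<xi>)) * lpow c (real m) \<xi>))"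
      using ae by eventually_elim (use assms in \<open>auto simp: A_def e_def lpow_nat indicator_def\<close>)
    show "(\<lambda>\<xi>. indicator {c..x} \<xi> *\<^sub>R A \<xi>) \<in> borel_measurable lborel" using iA by auto
  qed measurable
  moreover have "(LINT \<xi>:{c..x}|lborel. B \<xi>) + e c * (0 ^ m / fact m) = hpow l c m x"
  proof (cases m)
    case 0
    then show ?thesis using True by (simp add: B_def e_def)
  next
    case (Suc n)
    have "(LINT \<xi>:{c..x}|lborel. B \<xi>) = (LINT \<xi>|lborel. indicator {c<..<x} \<xi> * (exp (- l * (x - \<xi>)) * lpow c (real n) \<xi>))"
      unfolding set_lebesgue_integral_def 
    proof (rule integral_cong_AE)
      show "AE \<xi> in lborel. indicator {c..x} \<xi> *\<^sub>R B \<xi> = indicator {c<..<x} \<xi> * (exp (- l * (x - \<xi>)) * lpow c (real n) \<xi>)"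
      proof -
        have f: "real (Suc n) * y / fact (Suc n) = y / fact n" for y :: real
          by (simp only: fact_Suc of_nat_mult of_nat_fact) (simp del: of_nat_Suc)
        show ?thesis
          using ae by eventually_elim (auto simp: B_def e_def lpow_nat indicator_def Suc f simp del: of_nat_Suc fact_Suc)
      qed
      show "(\<lambda>\<xi>. indicator {c..x} \<xi> *\<^sub>R B \<xi>) \<in> borel_measurable lborel" using iB by auto
    qed measurable
    then show ?thesis by (simp add: Suc)
  qed
  ultimately show ?thesis using sum by linarith
qed

section \<open>Positivity of the resolvent form\<close>

lemma resolvent_form_nonneg:
  fixes P :: "real \<Rightarrow> real"
  assumes meas [measurable]: "P \<in> borel_measurable borel" and "finite S"
    and bd: "\<And>x. x \<in> {0..1} \<Longrightarrow> \<bar>P x\<bar> \<le> K"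
    and cont: "\<And>x. x \<in> {0<..<1} - S \<Longrightarrow> isCont P x" and l: "0 < l"
  shows "0 \<le> (LINT x:{0..1}|lborel. (P x - l * (LINT \<xi>:{0..x}|lborel. exp (- l * (x - \<xi>)) * P \<xi>)) * P x)"
proof -
  \<comment> \<open>\<open>exp (l * \<xi>)\<close> is the integrating factor of the equation
    \<open>w' + l * w = P\<close> with \<open>w 0 = 0\<close>. Off the finitely many jumps of
    \<open>P\<close> its solution can be differentiated by the fundamental theorem.\<close>
  define g where "g \<xi> = exp (l * \<xi>) * P \<xi>" for \<xi>
  define w where "w x = exp (- l * x) * integral {0..x} g" for x
  have si: "set_integrable lborel {0..1} f" if "f \<in> borel_measurable borel" "\<And>x. x \<in> {0..1} \<Longrightarrow> \<bar>f x\<bar> \<le> C" for f :: "real \<Rightarrow> real" and C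
    unfolding set_integrable_def
  proof (rule Bochner_Integration.integrable_bound[of _ "\<lambda>x::real. indicator {0..1} x * C"])
    show "integrable lborel (\<lambda>x::real. indicator {0..1} x * C)"
      by (intro integrable_mult_left integrable_real_indicator) auto
    have "\<bar>f x\<bar> \<le> \<bar>C\<bar>" if "x \<in> {0..1}" for x
      using \<open>\<And>x. x \<in> {0..1} \<Longrightarrow> \<bar>f x\<bar> \<le> C\<close>[OF that] by linarith
    then show "AE x in lborel. norm (indicator {0..1} x *\<^sub>R f x) \<le> norm (indicator {0..1} x * C)"
      by (intro AE_I2) (auto simp: indicator_def)
    show "(\<lambda>x. indicator {0..1} x *\<^sub>R f x) \<in> borel_measurable lborel" using that(1) by measurable
  qed
  have [measurable]: "g \<in> borel_measurable borel" unfolding g_def[abs_def] by measurable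
  have K: "0 \<le> K" using bd[of 0] by auto
  have gint: "set_integrable lborel {0..1} g"
  proof (rule si)
    fix x :: real assume x: "x \<in> {0..1}"
    have "exp (l * x) \<le> exp l" using x l by (simp add: mult_left_le)
    then show "\<bar>g x\<bar> \<le> exp l * K" unfolding g_def abs_mult using bd[OF x] by (intro mult_mono) auto
  qed measurable
  have gHK: "g integrable_on {0..1}"
    using set_borel_integral_eq_integral(1)[OF gint] .
  have W: "integral {0..x} g = (LINT \<xi>:{0..x}|lborel. g \<xi>)" if "x \<in> {0..1}" for x
    using that by (intro set_borel_integral_eq_integral(2)[symmetric] set_integrable_subset[OF gint]) auto
  have wx: "w x = (LINT \<xi>:{0..x}|lborel. exp (- l * (x - \<xi>)) * P \<xi>)" if "x \<in> {0..1}" for x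
  proof -
    have e: "exp (- l * x) * (exp (l * \<xi>) * P \<xi>) = exp (- l * (x - \<xi>)) * P \<xi>" for \<xi>
      by (simp add: exp_add[symmetric] mult.assoc[symmetric] right_diff_distrib)
    have "w x = (LINT \<xi>:{0..x}|lborel. exp (- l * x) * (exp (l * \<xi>) * P \<xi>))"
      unfolding w_def W[OF that] g_def by (rule set_integral_mult_right[symmetric])
    then show ?thesis unfolding e .
  qed
  have cw: "continuous_on {0..1} w" unfolding w_def
    by (intro continuous_intros indefinite_integral_continuous_1[OF gHK])
  have dw: "(w has_real_derivative P x - l * w x) (at x)" if x: "x \<in> {0<..<1} - S" for x
  proof -
    have "continuous (at x within ({0..1} - S)) g" unfolding g_def
      using cont[OF x] by (intro continuous_intros) (auto simp: continuous_at_imp_continuous_within)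
    then have "((\<lambda>u. integral {0..u} g) has_vector_derivative g x) (at x within ({0..1} - S))"
      using x by (intro integral_has_vector_derivative_continuous_at[OF gHK]) (auto simp: assms(2))
    moreover have "at x within ({0..1} - S) = at x"
    proof (rule at_within_interior)
      have "open ({0<..<1} - S)" using assms(2) by (auto intro: finite_imp_closed)
      then show "x \<in> interior ({0..1} - S)" using x by (intro interiorI[of "{0<..<1} - S"]) auto
    qed
    ultimately have "((\<lambda>u. integral {0..u} g) has_real_derivative g x) (at x)"
      by (simp add: has_real_derivative_iff_has_vector_derivative)
    then show ?thesis unfolding w_def[abs_def] 
      by (auto intro!: derivative_eq_intros simp: g_def exp_minus field_simps)
  qed
  have "((\<lambda>x. l * w x * (P x - l * w x)) has_integral (l * (w 1)\<^sup>2 / 2 - l * (w 0)\<^sup>2 / 2)) {0..1}"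
  proof (rule fundamental_theorem_of_calculus_interior_strong[OF assms(2)])
    fix x assume x: "x \<in> {0<..<1} - S"
    show "((\<lambda>x. l * (w x)\<^sup>2 / 2) has_vector_derivative l * w x * (P x - l * w x)) (at x)"
      unfolding has_real_derivative_iff_has_vector_derivative[symmetric]
      by (auto intro!: derivative_eq_intros dw[OF x])
  qed (auto intro!: continuous_intros cw)
  moreover have "w 0 = 0" by (simp add: w_def)
  ultimately have i1: "((\<lambda>x. l * w x * (P x - l * w x)) has_integral (l * (w 1)\<^sup>2 / 2)) {0..1}" by simp
  obtain D where D: "\<And>x. x \<in> {0..1} \<Longrightarrow> \<bar>w x\<bar> \<le> D"
    using compact_imp_bounded[OF compact_continuous_image[OF cw]] by (force simp: bounded_iff)
  \<comment> \<open>Continuity of \<open>w\<close> is known only on the unit interval. The cut-off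
    version is Borel on the whole line.\<close>
  define w' where "w' x = indicator {0..1} x * w x" for x
  have w'meas [measurable]: "w' \<in> borel_measurable borel"
    using borel_measurable_continuous_on_indicator[OF _ cw] unfolding w'_def[abs_def] by simp
  have b: "\<bar>P x - l * w' x\<bar> \<le> K + l * D" "\<bar>P x\<bar> \<le> K" if "x \<in> {0..1}" for x
  proof -
    have "l * \<bar>w x\<bar> \<le> l * D" using D[OF that] l by (intro mult_left_mono) auto
    moreover have "\<bar>l * w x\<bar> = l * \<bar>w x\<bar>" using l by (simp add: abs_mult)
    ultimately show "\<bar>P x - l * w' x\<bar> \<le> K + l * D"
      using bd[OF that] that abs_triangle_ineq4[of "P x" "l * w x"] by (simp add: w'_def)
  qed (rule bd[OF that])
  have KD: "0 \<le> K + l * D" using b(1)[of 0] by auto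
  have i2: "set_integrable lborel {0..1} (\<lambda>x. (P x - l * w' x) * P x)"
    by (rule si[where C = "(K + l * D) * K"], measurable)
       (unfold abs_mult, intro mult_mono b KD abs_ge_zero)
  have i3: "set_integrable lborel {0..1} (\<lambda>x. (P x - l * w' x) * (P x - l * w' x))"
    by (rule si[where C = "(K + l * D) * (K + l * D)"], measurable)
       (unfold abs_mult, intro mult_mono b KD abs_ge_zero)
  have "(LINT x:{0..1}|lborel. (P x - l * (LINT \<xi>:{0..x}|lborel. exp (- l * (x - \<xi>)) * P \<xi>)) * P x)
      = (LINT x:{0..1}|lborel. (P x - l * w' x) * P x)"
    by (intro set_lebesgue_integral_cong) (auto simp: wx w'_def)
  also have "\<dots> = integral {0..1} (\<lambda>x. (P x - l * w' x) * P x)"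
    by (rule set_borel_integral_eq_integral(2)[OF i2])
  \<comment> \<open>Write the last factor \<open>P\<close> as \<open>(P - l * w) + l * w\<close>: a
    square plus the derivative of \<open>l * w\<^sup>2 / 2\<close>, and the latter integrates to its
    value at 1.\<close>
  also have "\<dots> = integral {0..1} (\<lambda>x. (P x - l * w' x) * (P x - l * w' x) + l * w x * (P x - l * w x))"
    by (intro Henstock_Kurzweil_Integration.integral_cong) (auto simp: w'_def algebra_simps)
  also have "\<dots> = integral {0..1} (\<lambda>x. (P x - l * w' x) * (P x - l * w' x)) + l * (w 1)\<^sup>2 / 2"
    using i1 set_borel_integral_eq_integral(1)[OF i3]
    by (subst Henstock_Kurzweil_Integration.integral_add) (auto simp: integral_unique has_integral_integrable)
  also have "\<dots> \<ge> 0"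
    using l by (intro add_nonneg_nonneg Henstock_Kurzweil_Integration.integral_nonneg set_borel_integral_eq_integral(1)[OF i3]) auto
  finally show ?thesis .
qed

lemma set_integral_lincomb:
  fixes f :: "'e \<Rightarrow> 'a \<Rightarrow> real"
  assumes "\<And>e. e \<in> J \<Longrightarrow> set_integrable M A (f e)"
  shows "(LINT x:A|M. (\<Sum>e\<in>J. C e * f e x)) = (\<Sum>e\<in>J. C e * (LINT x:A|M. f e x))"
proof -
  have "(\<lambda>x. indicator A x *\<^sub>R (\<Sum>e\<in>J. C e * f e x)) = (\<lambda>x. \<Sum>e\<in>J. C e * (indicator A x *\<^sub>R f e x))"
    by (auto simp: sum_distrib_left mult_ac)
  then show ?thesis
    using assms unfolding set_lebesgue_integral_def set_integrable_def
    by (simp add: Bochner_Integration.integral_sum)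
qed

text \<open>
  The pairing of the derivatives \<open>F\<close> and \<open>G\<close> of order \<open>a\<close> is a Laplace average, over the parameter
  \<open>l\<close>, of resolvent pairings. This form is bilinear and is checked on truncated powers.
\<close>

definition bridged :: "real \<Rightarrow> (real \<Rightarrow> real \<Rightarrow> real) \<Rightarrow> (real \<Rightarrow> real) \<Rightarrow> (real \<Rightarrow> real) \<Rightarrow> (real \<Rightarrow> real) \<Rightarrow> bool" where
  "bridged a H F r G \<longleftrightarrow>
     integrable lborel (\<lambda>x. F x * G x) \<and>
     has_bochner_integral (lborel \<Otimes>\<^sub>M lborel) (\<lambda>(l, x). indicator {0<..} l * l powr (2 * a - 1) * (H l x * r x))
       (Gamma (2 * a) * Gamma (1 - 2 * a) * (LINT x|lborel. F x * G x))"

text \<open>The semigroup law sees only the sum of the exponents. Lowering both factors by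
  \<open>a\<close>, or the left factor alone by \<open>2 * a\<close>, gives the same value
  \<open>lpow c (m + n + 1 - 2 * a) d\<close>; this is fractional integration by parts. The Laplace
  formula of order \<open>2 * a\<close>, admissible since \<open>a < 1 / 2\<close>, rewrites the
  second version as the double integral.\<close>

lemma bridged_lpow_rpow:
  assumes "0 < a" "a < 1 / 2"
  shows "bridged a (\<lambda>l. hpow l c m) (lpow c (real m - a)) (rpow d (real n)) (rpow d (real n - a))"
proof -
  let ?s = "2 * a"
  have G: "Gamma ?s > 0" "Gamma (1 - ?s) > 0" using assms by (auto intro: Gamma_real_pos)
  have 1: "has_bochner_integral lborel (\<lambda>x. lpow c (real m - a) x * rpow d (real n - a) x) (lpow c (real m + real n + 1 - 2 * a) d)"
    using has_bochner_integral_lpow_rpow[of "real m - a" "real n - a" c d] assms by (simp add: algebra_simps)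
  have 2: "has_bochner_integral lborel (\<lambda>x. lpow c (real m - 2 * a) x * rpow d (real n) x) (lpow c (real m + real n + 1 - 2 * a) d)"
    using has_bochner_integral_lpow_rpow[of "real m - 2 * a" "real n" c d] assms by (simp add: algebra_simps)
  let ?f = "\<lambda>(l, x). indicator {0<..} l * l powr (2 * a - 1) * (hpow l c m x * rpow d (real n) x)"
  note hpow_measurable[unfolded case_prod_unfold, measurable]
  have fm [measurable]: "?f \<in> borel_measurable (lborel \<Otimes>\<^sub>M lborel)" by (simp add: case_prod_unfold)
  have "(\<integral>\<^sup>+ p. ennreal (?f p) \<partial>(lborel \<Otimes>\<^sub>M lborel)) = 
     (\<integral>\<^sup>+ x. (\<integral>\<^sup>+ l. ennreal (?f (l, x)) \<partial>lborel) \<partial>lborel)"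
    by (rule lborel_pair.nn_integral_snd[symmetric]) (simp add: case_prod_unfold)
  also have "\<dots> = (\<integral>\<^sup>+ x. ennreal (Gamma ?s * Gamma (1 - ?s) * (lpow c (real m - 2 * a) x * rpow d (real n) x)) \<partial>lborel)"
  proof (rule nn_integral_cong)
    fix x :: real
    have "(\<integral>\<^sup>+ l. ennreal (?f (l, x)) \<partial>lborel) =
      (\<integral>\<^sup>+ l. ennreal (rpow d (real n) x) * ennreal (indicator {0<..} l * (l powr (?s - 1) * hpow l c m x)) \<partial>lborel)"
      by (auto intro!: nn_integral_cong simp: ennreal_mult'[symmetric] rpow_nonneg mult_ac)
    also have "\<dots> = ennreal (rpow d (real n) x) * ennreal (Gamma ?s * Gamma (1 - ?s) * lpow c (real m - ?s) x)"
    proof -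
      have "(\<lambda>l. (\<lambda>(l, x). hpow l c m x) (l, x)) \<in> borel_measurable lborel"
        using hpow_measurable by measurable
      then have [measurable]: "(\<lambda>l. hpow l c m x) \<in> borel_measurable borel" by simp
      show ?thesis
        using nn_integral_Laplace_hpow[of ?s c m x] assms by (subst nn_integral_cmult) auto
    qed
    finally show "(\<integral>\<^sup>+ l. ennreal (?f (l, x)) \<partial>lborel) = ennreal (Gamma ?s * Gamma (1 - ?s) * (lpow c (real m - 2 * a) x * rpow d (real n) x))"
      by (simp add: ennreal_mult'[symmetric] rpow_nonneg mult_ac)
  qed
  also have "\<dots> = ennreal (Gamma ?s * Gamma (1 - ?s) * lpow c (real m + real n + 1 - 2 * a) d)"
    using has_bochner_integral_mult_right[OF 2, of "Gamma ?s * Gamma (1 - ?s)"] assms G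
    by (subst nn_integral_eq_integral) (auto simp: has_bochner_integral_iff intro!: AE_I2 mult_nonneg_nonneg lpow_nonneg rpow_nonneg)
  finally have "has_bochner_integral (lborel \<Otimes>\<^sub>M lborel) ?f (Gamma ?s * Gamma (1 - ?s) * lpow c (real m + real n + 1 - 2 * a) d)"
    using G assms
    by (intro has_bochner_integral_nn_integral[OF fm])
       (auto intro!: AE_I2 mult_nonneg_nonneg lpow_nonneg rpow_nonneg hpow_nonneg)
  then show ?thesis using 1 unfolding bridged_def by (simp add: has_bochner_integral_iff)
qed

lemma bridged_sum_left:
  assumes "\<And>e. e \<in> J \<Longrightarrow> bridged a (H e) (F e) r G"
  shows "bridged a (\<lambda>l x. \<Sum>e\<in>J. C e * H e l x) (\<lambda>x. \<Sum>e\<in>J. C e * F e x) r G"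
proof -
  have e: "(\<Sum>e\<in>J. C e * F e x) * G x = (\<Sum>e\<in>J. C e * (F e x * G x))" for x
    by (simp add: sum_distrib_right mult.assoc)
  have e': "(\<lambda>(l, x). indicator {0<..} l * l powr (2 * a - 1) * ((\<Sum>e\<in>J. C e * H e l x) * r x)) =
     (\<lambda>p. \<Sum>e\<in>J. C e * (case p of (l, x) \<Rightarrow> indicator {0<..} l * l powr (2 * a - 1) * (H e l x * r x)))"
    by (auto simp: sum_distrib_right sum_distrib_left mult_ac)
  have i: "integrable lborel (\<lambda>x. C e * (F e x * G x))" if "e \<in> J" for e
    using assms[OF that] by (simp add: bridged_def)
  have "has_bochner_integral (lborel \<Otimes>\<^sub>M lborel)
    (\<lambda>p. \<Sum>e\<in>J. C e * (case p of (l, x) \<Rightarrow> indicator {0<..} l * l powr (2 * a - 1) * (H e l x * r x)))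
    (\<Sum>e\<in>J. C e * (Gamma (2 * a) * Gamma (1 - 2 * a) * (LINT x|lborel. F e x * G x)))"
    using assms by (intro has_bochner_integral_sum has_bochner_integral_mult_right) (auto simp: bridged_def)
  also have "(\<Sum>e\<in>J. C e * (Gamma (2 * a) * Gamma (1 - 2 * a) * (LINT x|lborel. F e x * G x)))
     = Gamma (2 * a) * Gamma (1 - 2 * a) * (LINT x|lborel. (\<Sum>e\<in>J. C e * (F e x * G x)))"
    using i by (simp add: Bochner_Integration.integral_sum sum_distrib_left mult_ac)
  finally show ?thesis unfolding bridged_def e e'
    using i by auto
qed

lemma bridged_sum_right:
  assumes "\<And>e. e \<in> J \<Longrightarrow> bridged a H F (r e) (G e)"
  shows "bridged a H F (\<lambda>x. \<Sum>e\<in>J. C e * r e x) (\<lambda>x. \<Sum>e\<in>J. C e * G e x)"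
proof -
  have e: "F x * (\<Sum>e\<in>J. C e * G e x) = (\<Sum>e\<in>J. C e * (F x * G e x))" for x
    by (simp add: sum_distrib_left mult_ac)
  have e': "(\<lambda>(l, x). indicator {0<..} l * l powr (2 * a - 1) * (H l x * (\<Sum>e\<in>J. C e * r e x))) =
     (\<lambda>p. \<Sum>e\<in>J. C e * (case p of (l, x) \<Rightarrow> indicator {0<..} l * l powr (2 * a - 1) * (H l x * r e x)))"
    by (auto simp: sum_distrib_right sum_distrib_left mult_ac)
  have i: "integrable lborel (\<lambda>x. C e * (F x * G e x))" if "e \<in> J" for e
    using assms[OF that] by (simp add: bridged_def)
  have "has_bochner_integral (lborel \<Otimes>\<^sub>M lborel)
    (\<lambda>p. \<Sum>e\<in>J. C e * (case p of (l, x) \<Rightarrow> indicator {0<..} l * l powr (2 * a - 1) * (H l x * r e x)))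
    (\<Sum>e\<in>J. C e * (Gamma (2 * a) * Gamma (1 - 2 * a) * (LINT x|lborel. F x * G e x)))"
    using assms by (intro has_bochner_integral_sum has_bochner_integral_mult_right) (auto simp: bridged_def)
  also have "(\<Sum>e\<in>J. C e * (Gamma (2 * a) * Gamma (1 - 2 * a) * (LINT x|lborel. F x * G e x)))
     = Gamma (2 * a) * Gamma (1 - 2 * a) * (LINT x|lborel. (\<Sum>e\<in>J. C e * (F x * G e x)))"
    using i by (simp add: Bochner_Integration.integral_sum sum_distrib_left mult_ac)
  finally show ?thesis unfolding bridged_def e e'
    using i by auto
qed

section \<open>Monomials on intervals\<close>

text \<open>Truncated monomials \<open>x ^ m\<close> on \<open>x > c\<close> resp. \<open>x < d\<close>, differentiated of order \<open>s\<close>.\<close>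

definition tmono :: "real \<Rightarrow> nat \<Rightarrow> real \<Rightarrow> real \<Rightarrow> real" where
  "tmono s m c x = (\<Sum>l\<le>m. real (m choose l) * c ^ (m - l) * fact l * lpow c (real l - s) x)"

definition rmono :: "real \<Rightarrow> nat \<Rightarrow> real \<Rightarrow> real \<Rightarrow> real" where
  "rmono s m d x = (\<Sum>l\<le>m. real (m choose l) * d ^ (m - l) * (- 1) ^ l * fact l * rpow d (real l - s) x)"

text \<open>The coefficients re-expand \<open>x ^ m\<close> about the truncation point, with
  \<open>fact j\<close> undoing the normalisation of the truncated powers. They are those of
  \<open>tmono\<close>, so that bridging passes from powers to monomials term by term.\<close>

definition hmono :: "real \<Rightarrow> nat \<Rightarrow> real \<Rightarrow> real \<Rightarrow> real" where
  "hmono l m c x = (\<Sum>j\<le>m. real (m choose j) * c ^ (m - j) * fact j * hpow l c j x)"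

lemma rpow_eq_lpow: "rpow d r x = lpow (1 - d) r (1 - x)"
  by (simp add: rpow_def lpow_def algebra_simps)

lemma rpow_nat: "rpow d (real m) x = (if x < d then (d - x) ^ m / fact m else 0)"
  by (simp add: rpow_eq_lpow lpow_nat)

lemma tmono_0: "tmono 0 m c x = (if c < x then x ^ m else 0)"
proof -
  have "x ^ m = (\<Sum>l\<le>m. real (m choose l) * c ^ (m - l) * (x - c) ^ l)"
    using binomial_ring[of "x - c" c m] by (simp add: mult_ac)
  then show ?thesis by (simp add: tmono_def lpow_nat mult.assoc)
qed

lemma rmono_0: "rmono 0 m d x = (if x < d then x ^ m else 0)"
proof -
  have "x ^ m = (\<Sum>l\<le>m. real (m choose l) * d ^ (m - l) * (- 1) ^ l * (d - x) ^ l)"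
    using binomial_ring[of "- (d - x)" d m] unfolding power_minus[of "d - x"] by (simp add: mult_ac)
  then show ?thesis by (simp add: rmono_def rpow_nat mult.assoc)
qed

lemma bridged_tmono_rmono:
  assumes "0 < a" "a < 1 / 2"
  shows "bridged a (\<lambda>l. hmono l m c) (tmono a m c) (rmono 0 n d) (rmono a n d)"
proof -
  have "bridged a (\<lambda>l x. hmono l m c x) (\<lambda>x. tmono a m c x) (\<lambda>x. rmono 0 n d x) (\<lambda>x. rmono a n d x)"
    unfolding hmono_def tmono_def rmono_def
    using bridged_lpow_rpow[OF assms] by (intro bridged_sum_left bridged_sum_right) simp
  then show ?thesis by simp
qed

text \<open>A monomial on one interval is a difference of two truncated monomials, so its derivative
  is the same difference. For \<open>0 < s\<close> it keeps a tail to the right of the interval, and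
  \<open>rbasis\<close> one to the left. For \<open>s = 0\<close> the result is
  \<open>basis\<close>, up to one end point of the interval.\<close>

definition lbasis :: "real \<Rightarrow> (nat \<Rightarrow> real) \<Rightarrow> nat \<times> nat \<Rightarrow> real \<Rightarrow> real" where
  "lbasis s g \<kappa> x = tmono s (snd \<kappa>) (g (fst \<kappa>)) x - tmono s (snd \<kappa>) (g (fst \<kappa> + 1)) x"

definition rbasis :: "real \<Rightarrow> (nat \<Rightarrow> real) \<Rightarrow> nat \<times> nat \<Rightarrow> real \<Rightarrow> real" where
  "rbasis s g \<kappa> x = rmono s (snd \<kappa>) (g (fst \<kappa> + 1)) x - rmono s (snd \<kappa>) (g (fst \<kappa>)) x"

definition hbasis :: "real \<Rightarrow> (nat \<Rightarrow> real) \<Rightarrow> nat \<times> nat \<Rightarrow> real \<Rightarrow> real" where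
  "hbasis l g \<kappa> x = hmono l (snd \<kappa>) (g (fst \<kappa>)) x - hmono l (snd \<kappa>) (g (fst \<kappa> + 1)) x"

definition basis :: "(nat \<Rightarrow> real) \<Rightarrow> nat \<times> nat \<Rightarrow> real \<Rightarrow> real" where
  "basis g \<kappa> x = (if g (fst \<kappa>) < x \<and> x < g (fst \<kappa> + 1) then x ^ snd \<kappa> else 0)"

lemma bridged_basis:
  assumes "0 < a" "a < 1 / 2"
  shows "bridged a (\<lambda>l. hbasis l g \<kappa>) (lbasis a g \<kappa>) (rbasis 0 g' \<mu>) (rbasis a g' \<mu>)"
proof -
  \<comment> \<open>Each difference is written as a signed sum over the two end points, so that
    bilinearity of \<open>bridged\<close> applies. The sign is reversed for \<open>rbasis\<close>,
    where the right end point comes first.\<close>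
  define S where "S b = (if b then 1 else -1 :: real)" for b
  define nd where "nd h \<nu> b = (if b then h (fst \<nu>) else h (fst \<nu> + 1))" for h :: "nat \<Rightarrow> real" and \<nu> :: "nat \<times> nat" and b
  have "bridged a (\<lambda>l x. \<Sum>b\<in>UNIV. S b * hmono l (snd \<kappa>) (nd g \<kappa> b) x) (\<lambda>x. \<Sum>b\<in>UNIV. S b * tmono a (snd \<kappa>) (nd g \<kappa> b) x)
     (\<lambda>x. \<Sum>b\<in>UNIV. S (\<not> b) * rmono 0 (snd \<mu>) (nd g' \<mu> b) x) (\<lambda>x. \<Sum>b\<in>UNIV. S (\<not> b) * rmono a (snd \<mu>) (nd g' \<mu> b) x)"
    using bridged_tmono_rmono[OF assms] by (intro bridged_sum_left bridged_sum_right) simp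
  then show ?thesis
    unfolding lbasis_def[abs_def] rbasis_def[abs_def] hbasis_def[abs_def]
    by (simp add: UNIV_bool S_def nd_def)
qed

lemma tmono_measurable [measurable]: "tmono s m c \<in> borel_measurable borel"
  unfolding tmono_def[abs_def] by measurable
lemma rmono_measurable [measurable]: "rmono s m c \<in> borel_measurable borel"
  unfolding rmono_def[abs_def] by measurable
lemma lbasis_measurable [measurable]: "lbasis s g \<kappa> \<in> borel_measurable borel"
  unfolding lbasis_def[abs_def] by measurable
lemma rbasis_measurable [measurable]: "rbasis s g \<kappa> \<in> borel_measurable borel"
  unfolding rbasis_def[abs_def] by measurable
lemma basis_measurable [measurable]: "basis g \<kappa> \<in> borel_measurable borel"
  unfolding basis_def[abs_def] by measurable

lemma tmono_resolvent:
  assumes "0 \<le> c" "0 < l"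
  shows "hmono l m c x = tmono 0 m c x - l * (LINT \<xi>:{0..x}|lborel. exp (- l * (x - \<xi>)) * tmono 0 m c \<xi>)"
proof -
  have i: "set_integrable lborel {0..x} (\<lambda>\<xi>. exp (- l * (x - \<xi>)) * lpow c (real j) \<xi>)" for j
  proof -
    have "integrable lborel (\<lambda>\<xi>. indicator {0..x} \<xi> *\<^sub>R (exp (- l * (x - \<xi>)) * lpow c (real j) \<xi>))"
    proof (rule integrable_cong_AE_imp[OF exp_kernel_integrable[of c x l j]])
      have "AE \<xi> in lborel. \<xi> \<noteq> x" using AE_lborel_singleton by auto
      then show "AE \<xi> in lborel. indicator {c<..<x} \<xi> * (exp (- l * (x - \<xi>)) * lpow c (real j) \<xi>) = indicator {0..x} \<xi> *\<^sub>R (exp (- l * (x - \<xi>)) * lpow c (real j) \<xi>)"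
        by eventually_elim (use assms in \<open>auto simp: indicator_def lpow_def\<close>)
    qed measurable
    then show ?thesis by (simp add: set_integrable_def)
  qed
  have "(LINT \<xi>:{0..x}|lborel. exp (- l * (x - \<xi>)) * tmono 0 m c \<xi>) =
    (LINT \<xi>:{0..x}|lborel. (\<Sum>j\<le>m. (real (m choose j) * c ^ (m - j) * fact j) * (exp (- l * (x - \<xi>)) * lpow c (real j) \<xi>)))"
    by (intro set_lebesgue_integral_cong) (auto simp: tmono_def sum_distrib_left mult_ac)
  also have "\<dots> = (\<Sum>j\<le>m. (real (m choose j) * c ^ (m - j) * fact j) * (LINT \<xi>:{0..x}|lborel. exp (- l * (x - \<xi>)) * lpow c (real j) \<xi>))"
    by (rule set_integral_lincomb[OF i])
  finally show ?thesis
    unfolding hmono_def hpow_resolvent[OF assms] by (simp add: tmono_def sum_subtractf sum_distrib_left algebra_simps)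
qed

text \<open>
  Coercivity of the fractional pairing: on the Laplace side \<open>h = P - l * w\<close> with \<open>w' = P - l * w\<close>,
  so that \<open>P * h = h\<^sup>2 + l * w * w'\<close> has a nonnegative integral.
\<close>

lemma fractional_form_nonneg:
  fixes C :: "nat \<times> nat \<Rightarrow> real"
  assumes a: "0 < a" "a < 1 / 2" and fin: "finite K"
    and g: "\<And>\<kappa>. \<kappa> \<in> K \<Longrightarrow> 0 \<le> g (fst \<kappa>) \<and> g (fst \<kappa>) < g (fst \<kappa> + 1) \<and> g (fst \<kappa> + 1) \<le> 1"
  shows "0 \<le> (LINT x|lborel. (\<Sum>\<kappa>\<in>K. C \<kappa> * lbasis a g \<kappa> x) * (\<Sum>\<kappa>\<in>K. C \<kappa> * rbasis a g \<kappa> x))"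
proof -
  define H where "H l x = (\<Sum>\<kappa>\<in>K. C \<kappa> * hbasis l g \<kappa> x)" for l x
  define P where "P x = (\<Sum>\<kappa>\<in>K. C \<kappa> * lbasis 0 g \<kappa> x)" for x
  define R where "R x = (\<Sum>\<kappa>\<in>K. C \<kappa> * rbasis 0 g \<kappa> x)" for x
  define S where "S = (\<Union>\<kappa>\<in>K. {g (fst \<kappa>), g (fst \<kappa> + 1)})"
  let ?I = "LINT x|lborel. (\<Sum>\<kappa>\<in>K. C \<kappa> * lbasis a g \<kappa> x) * (\<Sum>\<kappa>\<in>K. C \<kappa> * rbasis a g \<kappa> x)"
  have finS: "finite S" using fin by (auto simp: S_def)
  have [measurable]: "P \<in> borel_measurable borel" unfolding P_def[abs_def] by measurable
  have br: "bridged a H (\<lambda>x. \<Sum>\<kappa>\<in>K. C \<kappa> * lbasis a g \<kappa> x) R (\<lambda>x. \<Sum>\<kappa>\<in>K. C \<kappa> * rbasis a g \<kappa> x)"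
    unfolding H_def[abs_def] R_def[abs_def]
    using bridged_basis[OF a] by (intro bridged_sum_left bridged_sum_right) simp
  have G: "Gamma (2 * a) > 0" "Gamma (1 - 2 * a) > 0" using a by (auto intro: Gamma_real_pos)
  have hb: "has_bochner_integral (lborel \<Otimes>\<^sub>M lborel) (\<lambda>(l, x). indicator {0<..} l * l powr (2 * a - 1) * (H l x * R x))
       (Gamma (2 * a) * Gamma (1 - 2 * a) * ?I)"
    using br by (simp add: bridged_def)
  \<comment> \<open>\<open>P\<close> and \<open>R\<close> are the same broken polynomial, assembled
    from left and from right truncations. They can differ only at nodes.\<close>
  have PR: "P x = basis_sum \<and> R x = basis_sum" if "x \<notin> S" "basis_sum = (\<Sum>\<kappa>\<in>K. C \<kappa> * basis g \<kappa> x)" for x basis_sum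
    unfolding P_def R_def that(2)
  proof (intro conjI sum.cong refl)
    fix \<kappa> assume k: "\<kappa> \<in> K"
    have ne: "x \<noteq> g (fst \<kappa>)" "x \<noteq> g (fst \<kappa> + 1)" using that(1) k by (auto simp: S_def)
    show "C \<kappa> * lbasis 0 g \<kappa> x = C \<kappa> * basis g \<kappa> x" "C \<kappa> * rbasis 0 g \<kappa> x = C \<kappa> * basis g \<kappa> x"
      using ne g[OF k] by (auto simp: lbasis_def rbasis_def basis_def tmono_0 rmono_0)
  qed
  \<comment> \<open>\<open>H\<close> vanishes left of 0 and \<open>R\<close> right of 1, so their
    product lives on the unit interval, where the resolvent form is nonnegative.\<close>
  have H0: "H l x = 0" if "x \<le> 0" for l x
  proof -
    have "hpow l c j x = 0" if "0 \<le> c" for c j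
      using \<open>x \<le> 0\<close> that by (cases j) auto
    then show ?thesis using g unfolding H_def hbasis_def hmono_def
      by (intro sum.neutral) (force intro: order_trans less_imp_le)
  qed
  have R0: "R x = 0" if "1 \<le> x" for x
    unfolding R_def rbasis_def rmono_0 using g that
    by (intro sum.neutral) force
  have Pint: "set_integrable lborel {0..x} (\<lambda>\<xi>. exp (- l * (x - \<xi>)) * tmono 0 m c \<xi>)" for l x m c
    unfolding set_integrable_def
  proof (rule integrable_cong_AE_imp[of _ "\<lambda>\<xi>. indicator {max 0 c..x} \<xi> *\<^sub>R (exp (- l * (x - \<xi>)) * \<xi> ^ m)"])
    show "integrable lborel (\<lambda>\<xi>. indicator {max 0 c..x} \<xi> *\<^sub>R (exp (- l * (x - \<xi>)) * \<xi> ^ m))"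
      unfolding set_integrable_def[symmetric] by (intro borel_integrable_atLeastAtMost' continuous_intros)
    have "AE \<xi> in lborel. \<xi> \<noteq> c" using AE_lborel_singleton by auto
    then show "AE \<xi> in lborel. indicator {max 0 c..x} \<xi> *\<^sub>R (exp (- l * (x - \<xi>)) * \<xi> ^ m) =
       indicator {0..x} \<xi> *\<^sub>R (exp (- l * (x - \<xi>)) * tmono 0 m c \<xi>)"
      by eventually_elim (auto simp: indicator_def tmono_0)
  qed measurable
  have HP: "H l x = P x - l * (LINT \<xi>:{0..x}|lborel. exp (- l * (x - \<xi>)) * P \<xi>)" if l: "0 < l" for l x
  proof -
    have "hbasis l g \<kappa> x = lbasis 0 g \<kappa> x - l * (LINT \<xi>:{0..x}|lborel. exp (- l * (x - \<xi>)) * lbasis 0 g \<kappa> \<xi>)"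
      if "\<kappa> \<in> K" for \<kappa>
    proof -
      have c: "0 \<le> g (fst \<kappa>)" "0 \<le> g (fst \<kappa> + 1)" using g[OF that] by auto
      show ?thesis
        unfolding hbasis_def lbasis_def tmono_resolvent[OF c(1) l] tmono_resolvent[OF c(2) l] right_diff_distrib[of "exp _"]
        by (subst set_integral_diff(2)[OF Pint Pint]) (simp add: algebra_simps)
    qed
    moreover have "set_integrable lborel {0..x} (\<lambda>\<xi>. exp (- l * (x - \<xi>)) * lbasis 0 g \<kappa> \<xi>)" for \<kappa>
      unfolding lbasis_def right_diff_distrib[of "exp _"] by (intro set_integral_diff Pint)
    then have "(LINT \<xi>:{0..x}|lborel. exp (- l * (x - \<xi>)) * P \<xi>) =
        (\<Sum>\<kappa>\<in>K. C \<kappa> * (LINT \<xi>:{0..x}|lborel. exp (- l * (x - \<xi>)) * lbasis 0 g \<kappa> \<xi>))"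
    proof (intro trans[OF _ set_integral_lincomb] set_lebesgue_integral_cong)
      show "\<forall>\<xi>. \<xi> \<in> {0..x} \<longrightarrow> exp (- l * (x - \<xi>)) * P \<xi> = (\<Sum>\<kappa>\<in>K. C \<kappa> * (exp (- l * (x - \<xi>)) * lbasis 0 g \<kappa> \<xi>))"
        by (simp add: P_def sum_distrib_left mult.left_commute)
    qed auto
    ultimately show ?thesis
      by (simp add: H_def P_def sum_subtractf right_diff_distrib sum_distrib_left mult.left_commute)
  qed
  have bdP: "\<bar>P x\<bar> \<le> (\<Sum>\<kappa>\<in>K. \<bar>C \<kappa>\<bar> * 2)" if "x \<in> {0..1}" for x
  proof -
    have "\<bar>lbasis 0 g \<kappa> x\<bar> \<le> 2" for \<kappa>
      using that power_le_one[of x "snd \<kappa>"] by (auto simp: lbasis_def tmono_0)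
    then show ?thesis unfolding P_def
      by (intro order_trans[OF sum_abs] sum_mono) (auto simp: abs_mult mult_left_mono)
  qed
  have contP: "isCont P x" if "x \<in> {0<..<1} - S" for x
  proof -
    have t: "isCont (tmono 0 m c) x" if "x \<noteq> c" for m c
    proof (cases "c < x")
      case True
      have "eventually (\<lambda>z. c < z) (nhds x)" using True
        by (intro eventually_nhds_in_open[of "{c<..}" x, simplified]) auto
      then have "eventually (\<lambda>z. tmono 0 m c z = z ^ m) (nhds x)"
        by eventually_elim (simp add: tmono_0)
      then show ?thesis by (subst isCont_cong) (auto intro!: continuous_intros)
    next
      case False
      then have "x < c" using that by simp
      then have "eventually (\<lambda>z. z < c) (nhds x)"
        by (intro eventually_nhds_in_open[of "{..<c}" x, simplified]) auto
      then have "eventually (\<lambda>z. tmono 0 m c z = 0) (nhds x)"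
        by eventually_elim (simp add: tmono_0)
      then show ?thesis by (subst isCont_cong) (auto intro!: continuous_intros)
    qed
    show ?thesis unfolding P_def[abs_def] lbasis_def
      using that by (intro continuous_intros t) (auto simp: S_def)
  qed
  have inner: "0 \<le> (LINT x|lborel. indicator {0<..} l * l powr (2 * a - 1) * (H l x * R x))" for l
  proof (cases "0 < l")
    case True
    have "AE x in lborel. x \<notin> S \<union> {0, 1}"
      using finS by (intro AE_not_in finite_imp_null_set_lborel) auto
    then have ae: "AE x in lborel. H l x * R x = indicator {0..1} x *\<^sub>R ((P x - l * (LINT \<xi>:{0..x}|lborel. exp (- l * (x - \<xi>)) * P \<xi>)) * P x)"
    proof eventually_elim
      case (elim x)
      then show ?case using PR[OF _ refl, of x] H0[of x l] R0[of x] HP[OF True, of x]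
        by (cases "0 < x"; cases "x < 1") (auto simp: indicator_def)
    qed
    have mH: "(\<lambda>x. H l x) \<in> borel_measurable lborel"
    proof -
      have "(\<lambda>x. (\<lambda>(l, x). hpow l c m x) (l, x)) \<in> borel_measurable lborel" for c m
        using hpow_measurable by measurable
      then have [measurable]: "hpow l c m \<in> borel_measurable borel" for c m by simp
      show ?thesis unfolding H_def hbasis_def hmono_def by measurable
    qed
    have mR: "R \<in> borel_measurable lborel" unfolding R_def[abs_def] by measurable
    have HPm: "(\<lambda>x. (P x - l * (LINT \<xi>:{0..x}|lborel. exp (- l * (x - \<xi>)) * P \<xi>)) * P x) \<in> borel_measurable lborel"
      using mH unfolding HP[OF True, symmetric] by measurable
    have "(LINT x|lborel. H l x * R x) = (LINT x:{0..1}|lborel. (P x - l * (LINT \<xi>:{0..x}|lborel. exp (- l * (x - \<xi>)) * P \<xi>)) * P x)"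
    proof (unfold set_lebesgue_integral_def[of lborel "{0..1}"], rule integral_cong_AE[OF _ _ ae])
      show "(\<lambda>x. H l x * R x) \<in> borel_measurable lborel" using mH mR by measurable
      show "(\<lambda>x. indicator {0..1} x *\<^sub>R ((P x - l * (LINT \<xi>:{0..x}|lborel. exp (- l * (x - \<xi>)) * P \<xi>)) * P x)) \<in> borel_measurable lborel"
        by (intro borel_measurable_scaleR HPm borel_measurable_indicator) auto
    qed
    then show ?thesis
      using resolvent_form_nonneg[OF _ finS bdP contP True] by simp
  qed simp
  \<comment> \<open>Fubini with space inside: at each fixed \<open>l\<close> the inner integral is a
    nonnegative weight times a resolvent form.\<close>
  have "Gamma (2 * a) * Gamma (1 - 2 * a) * ?I = (LINT l|lborel. LINT x|lborel. indicator {0<..} l * l powr (2 * a - 1) * (H l x * R x))"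
    using hb lborel_pair.integral_fst'[of "\<lambda>(l, x). indicator {0<..} l * l powr (2 * a - 1) * (H l x * R x)"]
    by (simp add: has_bochner_integral_iff)
  also have "\<dots> \<ge> 0" by (intro integral_nonneg_AE AE_I2 inner)
  finally have "Gamma (2 * a) * Gamma (1 - 2 * a) * 0 \<le> Gamma (2 * a) * Gamma (1 - 2 * a) * ?I" by simp
  then show ?thesis by (rule mult_left_le_imp_le) (use mult_pos_pos[OF G] in simp)
qed

section \<open>Fractional derivatives of broken polynomials\<close>

lemma RL_left_basis_sum:
  assumes s: "0 < s" "s < 1" and fin: "finite K" "finite S"
    and g: "\<And>\<kappa>. \<kappa> \<in> K \<Longrightarrow> 0 \<le> g (fst \<kappa>) \<and> g (fst \<kappa>) < g (fst \<kappa> + 1) \<and> x \<noteq> g (fst \<kappa>) \<and> x \<noteq> g (fst \<kappa> + 1)"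
    and x: "x \<in> {0<..<1}"
    and w: "\<And>\<xi>. \<xi> \<in> {0<..<1} - S \<Longrightarrow> w \<xi> = (\<Sum>\<kappa>\<in>K. C \<kappa> * basis g \<kappa> \<xi>)"
  shows "RL_left s w x = (\<Sum>\<kappa>\<in>K. C \<kappa> * lbasis s g \<kappa> x)"
proof -
  have t: "has_RL_left s (tmono 0 m c) (tmono s m c x) x" if "0 \<le> c" "x \<noteq> c" for m c
    unfolding tmono_def[abs_def] using has_RL_left_lpow[OF s that] by (intro has_RL_left_sum x) auto
  have b: "has_RL_left s (lbasis 0 g \<kappa>) (lbasis s g \<kappa> x) x" if "\<kappa> \<in> K" for \<kappa>
  proof -
    have "0 \<le> g (fst \<kappa>)" "0 \<le> g (fst \<kappa> + 1)" "x \<noteq> g (fst \<kappa>)" "x \<noteq> g (fst \<kappa> + 1)" using g[OF that] by auto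
    then have "has_RL_left s (\<lambda>\<xi>. tmono 0 (snd \<kappa>) (g (fst \<kappa>)) \<xi> + (-1) * tmono 0 (snd \<kappa>) (g (fst \<kappa> + 1)) \<xi>)
       (tmono s (snd \<kappa>) (g (fst \<kappa>)) x + (-1) * tmono s (snd \<kappa>) (g (fst \<kappa> + 1)) x) x"
      by (intro has_RL_left_add has_RL_left_cmult t x)
    then show ?thesis by (simp add: lbasis_def[abs_def])
  qed
  have "has_RL_left s (\<lambda>\<xi>. \<Sum>\<kappa>\<in>K. C \<kappa> * lbasis 0 g \<kappa> \<xi>) (\<Sum>\<kappa>\<in>K. C \<kappa> * lbasis s g \<kappa> x) x"
    by (intro has_RL_left_sum b x)
  then have "has_RL_left s w (\<Sum>\<kappa>\<in>K. C \<kappa> * lbasis s g \<kappa> x) x"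
  proof (rule has_RL_left_cong_finite)
    \<comment> \<open>Right end points join the exceptional set because \<open>lbasis 0\<close>
      still equals the monomial there, whereas \<open>basis\<close> is zero.\<close>
    show "finite (S \<union> (\<lambda>\<kappa>. g (fst \<kappa> + 1)) ` K)" using fin by simp
    fix \<xi> assume xi: "\<xi> \<in> {0<..<1} - (S \<union> (\<lambda>\<kappa>. g (fst \<kappa> + 1)) ` K)"
    have "C \<kappa> * lbasis 0 g \<kappa> \<xi> = C \<kappa> * basis g \<kappa> \<xi>" if "\<kappa> \<in> K" for \<kappa>
      using g[OF that] that xi by (auto simp: lbasis_def basis_def tmono_0)
    then show "(\<Sum>\<kappa>\<in>K. C \<kappa> * lbasis 0 g \<kappa> \<xi>) = w \<xi>" using w[of \<xi>] xi by (auto intro: sum.cong)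
  qed (rule x)
  then show ?thesis using s by (rule has_RL_left_imp)
qed

lemma RL_right_basis_sum:
  assumes s: "0 < s" "s < 1" and fin: "finite K" "finite S"
    and g: "\<And>\<kappa>. \<kappa> \<in> K \<Longrightarrow> g (fst \<kappa> + 1) \<le> 1 \<and> g (fst \<kappa>) < g (fst \<kappa> + 1) \<and> x \<noteq> g (fst \<kappa>) \<and> x \<noteq> g (fst \<kappa> + 1)"
    and x: "x \<in> {0<..<1}"
    and w: "\<And>\<xi>. \<xi> \<in> {0<..<1} - S \<Longrightarrow> w \<xi> = (\<Sum>\<kappa>\<in>K. C \<kappa> * basis g \<kappa> \<xi>)"
  shows "RL_right s w x = (\<Sum>\<kappa>\<in>K. C \<kappa> * rbasis s g \<kappa> x)"
proof -
  have x': "1 - x \<in> {0<..<1}" using x by auto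
  have t: "has_RL_left s (\<lambda>\<xi>. rmono 0 m d (1 - \<xi>)) (rmono s m d x) (1 - x)" if "d \<le> 1" "x \<noteq> d" for m d
    unfolding rmono_def[abs_def] rpow_eq_lpow
    using has_RL_left_lpow[OF s, of "1 - d" "1 - x"] that by (intro has_RL_left_sum x') auto
  have b: "has_RL_left s (\<lambda>\<xi>. rbasis 0 g \<kappa> (1 - \<xi>)) (rbasis s g \<kappa> x) (1 - x)" if "\<kappa> \<in> K" for \<kappa>
  proof -
    have "g (fst \<kappa>) \<le> 1" "g (fst \<kappa> + 1) \<le> 1" "x \<noteq> g (fst \<kappa>)" "x \<noteq> g (fst \<kappa> + 1)" using g[OF that] by auto
    then have "has_RL_left s (\<lambda>\<xi>. rmono 0 (snd \<kappa>) (g (fst \<kappa> + 1)) (1 - \<xi>) + (-1) * rmono 0 (snd \<kappa>) (g (fst \<kappa>)) (1 - \<xi>))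
       (rmono s (snd \<kappa>) (g (fst \<kappa> + 1)) x + (-1) * rmono s (snd \<kappa>) (g (fst \<kappa>)) x) (1 - x)"
      by (intro has_RL_left_add has_RL_left_cmult t x')
    then show ?thesis by (simp add: rbasis_def[abs_def])
  qed
  have "has_RL_left s (\<lambda>\<xi>. \<Sum>\<kappa>\<in>K. C \<kappa> * rbasis 0 g \<kappa> (1 - \<xi>)) (\<Sum>\<kappa>\<in>K. C \<kappa> * rbasis s g \<kappa> x) (1 - x)"
    by (intro has_RL_left_sum b x')
  then have "has_RL_left s (\<lambda>\<xi>. w (1 - \<xi>)) (\<Sum>\<kappa>\<in>K. C \<kappa> * rbasis s g \<kappa> x) (1 - x)"
  proof (rule has_RL_left_cong_finite)
    \<comment> \<open>After reflection the exceptional set consists of the mirror images, and it is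
      now at the left end points that \<open>rbasis 0\<close> and \<open>basis\<close>
      disagree.\<close>
    show "finite ((\<lambda>x. 1 - x) ` (S \<union> (\<lambda>\<kappa>. g (fst \<kappa>)) ` K))" using fin by simp
    fix \<xi> assume xi: "\<xi> \<in> {0<..<1} - ((\<lambda>x. 1 - x) ` (S \<union> (\<lambda>\<kappa>. g (fst \<kappa>)) ` K))"
    have ni: "1 - \<xi> \<notin> S \<union> (\<lambda>\<kappa>. g (fst \<kappa>)) ` K"
    proof
      assume "1 - \<xi> \<in> S \<union> (\<lambda>\<kappa>. g (fst \<kappa>)) ` K"
      then have "1 - (1 - \<xi>) \<in> (\<lambda>x. 1 - x) ` (S \<union> (\<lambda>\<kappa>. g (fst \<kappa>)) ` K)" by (rule imageI)
      then show False using xi by simp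
    qed
    have "C \<kappa> * rbasis 0 g \<kappa> (1 - \<xi>) = C \<kappa> * basis g \<kappa> (1 - \<xi>)" if "\<kappa> \<in> K" for \<kappa>
    proof -
      have "1 - \<xi> \<noteq> g (fst \<kappa>)" using ni that by (metis UnI2 imageI)
      then show ?thesis using g[OF that] by (auto simp: rbasis_def basis_def rmono_0)
    qed
    then show "(\<Sum>\<kappa>\<in>K. C \<kappa> * rbasis 0 g \<kappa> (1 - \<xi>)) = w (1 - \<xi>)" using w[of "1 - \<xi>"] xi ni by (auto intro: sum.cong)
  qed (rule x')
  then show ?thesis using s by (rule RL_right_eqI)
qed

section \<open>Grids and one-dimensional integrals\<close>

definition grid :: "nat \<Rightarrow> (nat \<Rightarrow> real) \<Rightarrow> bool" where
  "grid M g \<longleftrightarrow> g 0 = 0 \<and> g M = 1 \<and> (\<forall>i<M. g i < g (i + 1))"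

text \<open>
  A one-dimensional index is a pair of an interval and a degree. Functions on the square are
  expanded in all products of degree at most \<open>k\<close> in each variable, which contains the total degree.
\<close>

definition idx1 :: "nat \<Rightarrow> nat \<Rightarrow> (nat \<times> nat) set" where
  "idx1 M k = {..<M} \<times> {..k}"

definition idx2 :: "nat \<Rightarrow> nat \<Rightarrow> ((nat \<times> nat) \<times> (nat \<times> nat)) set" where
  "idx2 M k = idx1 M k \<times> idx1 M k"

lemma finite_idx1 [simp]: "finite (idx1 M k)" and finite_idx2 [simp]: "finite (idx2 M k)"
  by (auto simp: idx1_def idx2_def)

lemma grid_mono:
  assumes "grid M g" "i \<le> j" "j \<le> M" shows "g i \<le> g j"
  using assms(2,3,1)
proof (induction j rule: dec_induct)
  case (step n)
  then have "g n < g (n + 1)" by (auto simp: grid_def)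
  then show ?case using step by simp
qed simp

lemma grid_strict_mono:
  assumes "grid M g" "i < j" "j \<le> M" shows "g i < g j"
proof -
  have "g i < g (i + 1)" using assms by (auto simp: grid_def)
  also have "g (i + 1) \<le> g j" using assms by (intro grid_mono) auto
  finally show ?thesis .
qed

lemma grid_bounds: "grid M g \<Longrightarrow> i \<le> M \<Longrightarrow> 0 \<le> g i \<and> g i \<le> 1"
  using grid_mono[of M g 0 i] grid_mono[of M g i M] by (auto simp: grid_def)

lemma grid_idx1:
  assumes "grid M g" "\<kappa> \<in> idx1 M k"
  shows "0 \<le> g (fst \<kappa>)" "g (fst \<kappa>) < g (fst \<kappa> + 1)" "g (fst \<kappa> + 1) \<le> 1"
proof -
  have "fst \<kappa> < M" using assms by (auto simp: idx1_def)
  then show "0 \<le> g (fst \<kappa>)" "g (fst \<kappa>) < g (fst \<kappa> + 1)" "g (fst \<kappa> + 1) \<le> 1"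
    using grid_bounds[OF assms(1), of "fst \<kappa>"] grid_bounds[OF assms(1), of "fst \<kappa> + 1"] assms(1)
    by (auto simp: grid_def)
qed

lemma grid_interval_unique:
  assumes "grid M g" "i < M" "j < M" "g i < x" "x < g (i + 1)" "g j < x" "x < g (j + 1)"
  shows "i = j"
proof (rule ccontr)
  assume "i \<noteq> j"
  then consider "i + 1 \<le> j" | "j + 1 \<le> i" by linarith
  then show False
    using grid_mono[OF assms(1), of "i + 1" j] grid_mono[OF assms(1), of "j + 1" i] assms by cases auto
qed

text \<open>The interval found is closed only where it meets 0 or 1. This matches
  \<open>tbasis\<close>: a boundary point takes its trace from the single interval next to
  it.\<close>

lemma grid_locate:
  assumes "grid M g" "x \<in> {0..1}" "x \<notin> g ` {1..<M}"
  obtains i where "i < M" "g i < x \<or> x = 0 \<and> g i = 0" "x < g (i + 1) \<or> x = 1 \<and> g (i + 1) = 1"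
proof (cases "x = 0")
  case True
  have "0 < M" using assms(1) by (cases M) (auto simp: grid_def)
  then show ?thesis using that[of 0] True assms(1) by (auto simp: grid_def)
next
  case False
  define i where "i = Max {i. i \<le> M \<and> g i < x}"
  have fin: "finite {i. i \<le> M \<and> g i < x}" by simp
  have ne: "0 \<in> {i. i \<le> M \<and> g i < x}" using False assms by (auto simp: grid_def)
  have "i \<in> {i. i \<le> M \<and> g i < x}" unfolding i_def using fin ne by (intro Max_in) blast+
  then have i: "i \<le> M" "g i < x" by auto
  have "i \<noteq> M" using i assms by (auto simp: grid_def)
  then have "i < M" using i by simp
  have "\<not> g (i + 1) < x"
  proof
    assume "g (i + 1) < x"
    then have "i + 1 \<le> i" using \<open>i < M\<close> by (subst (2) i_def, intro Max_ge[OF fin]) auto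
    then show False by simp
  qed
  moreover have "x = 1 \<and> g (i + 1) = 1" if "x = g (i + 1)"
  proof -
    have "i + 1 = M" using that assms(3) \<open>i < M\<close> by (cases "i + 1 = M") auto
    then show ?thesis using that assms by (auto simp: grid_def)
  qed
  ultimately show ?thesis using that[of i] i \<open>i < M\<close> by (cases "x = g (i + 1)") auto
qed

definition dbasis :: "(nat \<Rightarrow> real) \<Rightarrow> nat \<times> nat \<Rightarrow> real \<Rightarrow> real" where
  "dbasis g \<kappa> x = (if g (fst \<kappa>) < x \<and> x < g (fst \<kappa> + 1) then real (snd \<kappa>) * x ^ (snd \<kappa> - 1) else 0)"

text \<open>One-sided values of \<open>basis\<close> from inside the unit interval.\<close>

definition tbasis :: "(nat \<Rightarrow> real) \<Rightarrow> nat \<times> nat \<Rightarrow> real \<Rightarrow> real" where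
  "tbasis g \<kappa> x = (if (g (fst \<kappa>) < x \<or> x = 0 \<and> g (fst \<kappa>) = 0) \<and> (x < g (fst \<kappa> + 1) \<or> x = 1 \<and> g (fst \<kappa> + 1) = 1)
     then x ^ snd \<kappa> else 0)"

definition mass :: "(nat \<Rightarrow> real) \<Rightarrow> (nat \<Rightarrow> real) \<Rightarrow> nat \<times> nat \<Rightarrow> nat \<times> nat \<Rightarrow> real" where
  "mass h g \<kappa> \<mu> = (LINT x|lborel. basis h \<kappa> x * basis g \<mu> x)"

definition vol :: "(nat \<Rightarrow> real) \<Rightarrow> (nat \<Rightarrow> real) \<Rightarrow> nat \<times> nat \<Rightarrow> nat \<times> nat \<Rightarrow> real" where
  "vol h g \<kappa> \<mu> = (LINT x|lborel. basis h \<kappa> x * dbasis g \<mu> x)"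

text \<open>The boundary terms of one-dimensional integration by parts over the interval of
  \<open>\<mu>\<close>. The test monomial is evaluated by its formula, that is, from inside its
  interval. The one-sided values \<open>\<alpha>\<close> are \<open>tbasis\<close> for the fluxes,
  traced from inside the domain, and \<open>basis\<close> for \<open>u\<close>, which is zero on the
  boundary.\<close>

definition flux :: "(nat \<times> nat \<Rightarrow> real \<Rightarrow> real) \<Rightarrow> (nat \<Rightarrow> real) \<Rightarrow> nat \<times> nat \<Rightarrow> nat \<times> nat \<Rightarrow> real" where
  "flux \<alpha> g \<kappa> \<mu> = \<alpha> \<kappa> (g (fst \<mu> + 1)) * g (fst \<mu> + 1) ^ snd \<mu> - \<alpha> \<kappa> (g (fst \<mu>)) * g (fst \<mu>) ^ snd \<mu>"

definition frac :: "real \<Rightarrow> (nat \<Rightarrow> real) \<Rightarrow> nat \<times> nat \<Rightarrow> nat \<times> nat \<Rightarrow> real" where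
  "frac s g \<kappa> \<mu> = (LINT x|lborel. lbasis s g \<kappa> x * rbasis s g \<mu> x)"

lemma dbasis_measurable [measurable]: "dbasis g \<kappa> \<in> borel_measurable borel"
  unfolding dbasis_def[abs_def] by measurable

lemma integrable_Icc_eq:
  fixes f h :: "real \<Rightarrow> real"
  assumes "continuous_on {a..b} h" "\<And>x. x \<in> {a<..<b} \<Longrightarrow> f x = h x" "\<And>x. x \<notin> {a<..<b} \<Longrightarrow> f x = 0"
    and [measurable]: "f \<in> borel_measurable borel"
  shows "integrable lborel f" "integral\<^sup>L lborel f = (LINT x|lborel. indicator {a..b} x *\<^sub>R h x)"
proof -
  have i: "integrable lborel (\<lambda>x. indicator {a..b} x *\<^sub>R h x)"
    using borel_integrable_atLeastAtMost'[OF assms(1)] by (simp add: set_integrable_def)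
  have "AE x in lborel. x \<noteq> a" "AE x in lborel. x \<noteq> b" using AE_lborel_singleton by auto
  then have ae: "AE x in lborel. indicator {a..b} x *\<^sub>R h x = f x"
  proof eventually_elim
    case (elim x)
    then show ?case using assms(2)[of x] assms(3)[of x] by (cases "x \<in> {a<..<b}") (auto simp: indicator_def)
  qed
  show "integrable lborel f" by (rule integrable_cong_AE_imp[OF i _ ae]) simp
  show "integral\<^sup>L lborel f = (LINT x|lborel. indicator {a..b} x *\<^sub>R h x)"
    using ae i by (intro integral_cong_AE) (auto elim: eventually_mono)
qed

lemma integrable_basis_basis: "integrable lborel (\<lambda>x. basis h \<kappa> x * basis g \<mu> x)"
  by (rule integrable_Icc_eq(1)[of "max (h (fst \<kappa>)) (g (fst \<mu>))" "min (h (fst \<kappa> + 1)) (g (fst \<mu> + 1))" "\<lambda>x. x ^ snd \<kappa> * x ^ snd \<mu>"])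
     (auto intro!: continuous_intros simp: basis_def)

lemma integrable_basis_dbasis: "integrable lborel (\<lambda>x. basis h \<kappa> x * dbasis g \<mu> x)"
  by (rule integrable_Icc_eq(1)[of "max (h (fst \<kappa>)) (g (fst \<mu>))" "min (h (fst \<kappa> + 1)) (g (fst \<mu> + 1))" "\<lambda>x. x ^ snd \<kappa> * (real (snd \<mu>) * x ^ (snd \<mu> - 1))"])
     (auto intro!: continuous_intros simp: basis_def dbasis_def)

lemma integrable_lbasis_rbasis:
  "0 < s \<Longrightarrow> s < 1 / 2 \<Longrightarrow> integrable lborel (\<lambda>x. lbasis s g \<kappa> x * rbasis s g \<mu> x)"
  using bridged_basis[of s g \<kappa> g \<mu>] by (simp add: bridged_def)

lemma mass_commute: "mass h g \<kappa> \<mu> = mass g h \<mu> \<kappa>"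
  by (simp add: mass_def mult.commute)

text \<open>The staggering of the meshes: interior nodes of one grid fall strictly inside intervals
  of the other, where functions of the other mesh have unambiguous values.\<close>

definition disjoint_grids :: "nat \<Rightarrow> (nat \<Rightarrow> real) \<Rightarrow> nat \<Rightarrow> (nat \<Rightarrow> real) \<Rightarrow> bool" where
  "disjoint_grids M g M' g' \<longleftrightarrow> (\<forall>i\<le>M. \<forall>j\<le>M'. g i = g' j \<longrightarrow> g i = 0 \<or> g i = 1)"

lemma disjoint_grids_commute: "disjoint_grids M g M' g' = disjoint_grids M' g' M g"
  unfolding disjoint_grids_def by metis

text \<open>
  Integration by parts on the overlap of one interval of each grid. Interior end points contribute
  to exactly one flux because the grids share no interior node; at \<open>0\<close> and \<open>1\<close> only \<open>tbasis\<close> contributes.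
\<close>

lemma vol_flux_cancel:
  assumes g: "grid M g" and g': "grid M' g'" and dis: "disjoint_grids M g M' g'"
    and k: "\<kappa> \<in> idx1 M k" and k': "\<kappa>' \<in> idx1 M' k'"
  shows "vol g' g \<kappa>' \<kappa> - flux (tbasis g') g \<kappa>' \<kappa> + (vol g g' \<kappa> \<kappa>' - flux (basis g) g' \<kappa> \<kappa>') = 0"
proof -
  define a where "a = g (fst \<kappa>)"
  define b where "b = g (fst \<kappa> + 1)"
  define c where "c = g' (fst \<kappa>')"
  define d where "d = g' (fst \<kappa>' + 1)"
  define m where "m = snd \<kappa>"
  define n where "n = snd \<kappa>'"
  let ?e = "max a c" and ?f = "min b d"
  have ab: "0 \<le> a" "a < b" "b \<le> 1" using grid_idx1[OF g k] by (auto simp: a_def b_def)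
  have cd: "0 \<le> c" "c < d" "d \<le> 1" using grid_idx1[OF g' k'] by (auto simp: c_def d_def)
  have lt: "fst \<kappa> < M" "fst \<kappa>' < M'" using k k' by (auto simp: idx1_def)
  have dd: "g i = g' j \<Longrightarrow> g i = 0 \<or> g i = 1" if "i \<le> M" "j \<le> M'" for i j
    using dis that by (auto simp: disjoint_grids_def)
  have D: "a = c \<Longrightarrow> a = 0 \<or> a = 1" "a = d \<Longrightarrow> a = 0 \<or> a = 1" "b = c \<Longrightarrow> b = 0 \<or> b = 1" "b = d \<Longrightarrow> b = 0 \<or> b = 1"
    using dd[of "fst \<kappa>" "fst \<kappa>'"] dd[of "fst \<kappa>" "fst \<kappa>' + 1"] dd[of "fst \<kappa> + 1" "fst \<kappa>'"]
      dd[of "fst \<kappa> + 1" "fst \<kappa>' + 1"] lt unfolding a_def b_def c_def d_def by simp_all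
  have "vol g' g \<kappa>' \<kappa> + vol g g' \<kappa> \<kappa>' = (LINT x|lborel. basis g' \<kappa>' x * dbasis g \<kappa> x + basis g \<kappa> x * dbasis g' \<kappa>' x)"
    unfolding vol_def using integrable_basis_dbasis by simp
  also have "\<dots> = (LINT x|lborel. indicator {?e..?f} x *\<^sub>R (x ^ n * (real m * x ^ (m - 1)) + x ^ m * (real n * x ^ (n - 1))))"
    by (intro integrable_Icc_eq(2)) (auto intro!: continuous_intros simp: basis_def dbasis_def a_def b_def c_def d_def m_def n_def)
  also have "\<dots> = (if ?e < ?f then ?f ^ (m + n) - ?e ^ (m + n) else 0)"
  proof (cases "?e < ?f")
    case True
    have "(LINT x|lborel. indicator {?e..?f} x *\<^sub>R (x ^ n * (real m * x ^ (m - 1)) + x ^ m * (real n * x ^ (n - 1)))) = ?f ^ m * ?f ^ n - ?e ^ m * ?e ^ n"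
    proof (rule integral_FTC_Icc)
      show "((\<lambda>x. x ^ m * x ^ n) has_vector_derivative x ^ n * (real m * x ^ (m - 1)) + x ^ m * (real n * x ^ (n - 1))) (at x within {?e..?f})" for x
        unfolding has_real_derivative_iff_has_vector_derivative[symmetric]
        by (auto intro!: derivative_eq_intros)
    qed (use True in \<open>auto intro!: continuous_intros\<close>)
    then show ?thesis using True by (simp add: power_add)
  next
    case False
    have "AE x in lborel. x \<noteq> ?e" using AE_lborel_singleton by auto
    then have "AE x in lborel. indicator {?e..?f} x *\<^sub>R (x ^ n * (real m * x ^ (m - 1)) + x ^ m * (real n * x ^ (n - 1))) = 0"
      by eventually_elim (use False in \<open>auto simp: indicator_def\<close>)
    then show ?thesis unfolding if_not_P[OF False] by (rule integral_eq_zero_AE)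
  qed
  finally have V: "vol g' g \<kappa>' \<kappa> + vol g g' \<kappa> \<kappa>' = (if ?e < ?f then ?f ^ (m + n) - ?e ^ (m + n) else 0)" .
  have F1: "flux (tbasis g') g \<kappa>' \<kappa> = (if (c < b \<or> b = 0 \<and> c = 0) \<and> (b < d \<or> b = 1 \<and> d = 1) then b ^ (m + n) else 0)
      - (if (c < a \<or> a = 0 \<and> c = 0) \<and> (a < d \<or> a = 1 \<and> d = 1) then a ^ (m + n) else 0)"
    by (simp add: flux_def tbasis_def a_def b_def c_def d_def m_def n_def power_add mult.commute)
  have F2: "flux (basis g) g' \<kappa> \<kappa>' = (if a < d \<and> d < b then d ^ (m + n) else 0) - (if a < c \<and> c < b then c ^ (m + n) else 0)"
    by (simp add: flux_def basis_def a_def b_def c_def d_def m_def n_def power_add mult.commute)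
  have "(if ?e < ?f then ?f ^ (m + n) - ?e ^ (m + n) else 0) =
     ((if (c < b \<or> b = 0 \<and> c = 0) \<and> (b < d \<or> b = 1 \<and> d = 1) then b ^ (m + n) else 0)
      - (if (c < a \<or> a = 0 \<and> c = 0) \<and> (a < d \<or> a = 1 \<and> d = 1) then a ^ (m + n) else 0))
     + ((if a < d \<and> d < b then d ^ (m + n) else 0) - (if a < c \<and> c < b then c ^ (m + n) else 0))"
  proof (cases "?e < ?f")
    case True
    then have o: "a < d" "c < b" by auto
    \<comment> \<open>On an overlap, the condition for a flux at \<open>b\<close> just says that
      \<open>b\<close> is the upper end of the overlap. Equality \<open>b = d\<close> can occur only
      at 1, where \<open>tbasis\<close> counts it and \<open>basis\<close> does not; the lower end
      is symmetric.\<close>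
    have r: "((c < b \<or> b = 0 \<and> c = 0) \<and> (b < d \<or> b = 1 \<and> d = 1)) \<longleftrightarrow> b \<le> d"
      using o ab cd D by auto
    have l: "((c < a \<or> a = 0 \<and> c = 0) \<and> (a < d \<or> a = 1 \<and> d = 1)) \<longleftrightarrow> c \<le> a"
      using o ab cd D by auto
    show ?thesis unfolding r l using True o by (auto simp: max_def min_def)
  next
    case False
    \<comment> \<open>Intervals without overlap cannot even touch, since a shared node would be 0 or
      1; hence no flux term is active.\<close>
    then have "b \<le> c \<or> d \<le> a" using ab cd by auto
    then show ?thesis using False ab cd D by auto
  qed
  then show ?thesis using V F1 F2 by linarith
qed

section \<open>Integrals of separated functions\<close>

lemma integrable_separated:
  fixes A B :: "real \<Rightarrow> real"
  assumes "integrable lborel A" "integrable lborel B"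
  shows "integrable lborel (\<lambda>(x, y). A x * B y)"
    and "(LINT p|lborel. (case p of (x, y) \<Rightarrow> A x * B y)) = (LINT x|lborel. A x) * (LINT y|lborel. B y)"
proof -
  have [measurable]: "A \<in> borel_measurable borel" "B \<in> borel_measurable borel" using assms by auto
  have i: "integrable (lborel \<Otimes>\<^sub>M lborel) (\<lambda>(x, y). A x * B y)"
  proof (rule lborel_pair.Fubini_integrable)
    show "integrable lborel (\<lambda>x. LINT y|lborel. norm (case (x, y) of (x, y) \<Rightarrow> A x * B y))"
      using assms by (simp add: abs_mult)
  qed (use assms in \<open>auto simp: case_prod_unfold\<close>)
  then show "integrable lborel (\<lambda>(x, y). A x * B y)" by (simp add: lborel_prod)
  show "(LINT p|lborel. (case p of (x, y) \<Rightarrow> A x * B y)) = (LINT x|lborel. A x) * (LINT y|lborel. B y)"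
    using lborel_pair.integral_fst'[OF i] by (simp add: lborel_prod)
qed

lemma AE_lborel_pair_notin_finite:
  fixes S :: "real set"
  assumes "finite S"
  shows "AE p in lborel. fst p \<notin> S \<and> snd p \<notin> S"
proof -
  have [measurable]: "S \<in> sets borel" using assms by (intro borel_closed finite_imp_closed)
  have S: "AE x in lborel. x \<notin> S" using assms by (intro AE_not_in finite_imp_null_set_lborel) auto
  have "AE p in lborel \<Otimes>\<^sub>M lborel. fst p \<notin> S \<and> snd p \<notin> S"
  proof (rule lborel_pair.AE_pair_measure)
    show "{p \<in> space (lborel \<Otimes>\<^sub>M lborel). fst p \<notin> S \<and> snd p \<notin> S} \<in> sets (lborel \<Otimes>\<^sub>M lborel)"
      by measurable
    show "AE x in lborel. AE y in lborel. fst (x, y) \<notin> S \<and> snd (x, y) \<notin> S"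
      using S by eventually_elim (use S in simp)
  qed
  then show ?thesis by (simp only: lborel_prod)
qed

text \<open>Nothing is assumed about \<open>F\<close> off the good points: it agrees with a
  separated sum except on finitely many grid lines, and completeness of the measure transfers both
  integrability and the value.\<close>

lemma set_integral_separated:
  fixes F :: "real \<times> real \<Rightarrow> real"
  assumes "finite S" and A: "\<And>e. e \<in> J \<Longrightarrow> integrable lborel (A e)" and B: "\<And>e. e \<in> J \<Longrightarrow> integrable lborel (B e)"
    and eq: "\<And>x y. x \<notin> S \<Longrightarrow> y \<notin> S \<Longrightarrow> indicator C (x, y) * F (x, y) = (\<Sum>e\<in>J. A e x * B e y)"
  shows "set_integrable lebesgue C F"
    and "(LINT p:C|lebesgue. F p) = (\<Sum>e\<in>J. (LINT x|lborel. A e x) * (LINT y|lborel. B e y))"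
proof -
  let ?G = "\<lambda>p. \<Sum>e\<in>J. case p of (x, y) \<Rightarrow> A e x * B e y"
  have ae: "AE p in lebesgue. ?G p = indicator C p *\<^sub>R F p"
    using AE_completion[OF AE_lborel_pair_notin_finite[OF assms(1)]]
    by eventually_elim (auto simp: eq split: prod.split)
  have i: "integrable lborel ?G" using integrable_separated(1)[OF A B] by (intro Bochner_Integration.integrable_sum)
  then have il: "integrable lebesgue ?G" by (subst integrable_completion) auto
  show "set_integrable lebesgue C F" unfolding set_integrable_def
    by (rule integrable_lebesgue_cong_AE[OF il ae])
  have "(LINT p:C|lebesgue. F p) = integral\<^sup>L lebesgue ?G" unfolding set_lebesgue_integral_def
    by (rule integral_lebesgue_cong_AE[symmetric, OF ae])
  also have "\<dots> = integral\<^sup>L lborel ?G" using i by (intro integral_completion) auto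
  also have "\<dots> = (\<Sum>e\<in>J. (LINT x|lborel. A e x) * (LINT y|lborel. B e y))"
    using integrable_separated[OF A B] by (subst Bochner_Integration.integral_sum) auto
  finally show "(LINT p:C|lebesgue. F p) = (\<Sum>e\<in>J. (LINT x|lborel. A e x) * (LINT y|lborel. B e y))" .
qed

lemma set_integral_expansion:
  fixes F :: "real \<Rightarrow> real"
  assumes "finite S" and B: "\<And>e. e \<in> J \<Longrightarrow> integrable lborel (B e)"
    and eq: "\<And>y. y \<notin> S \<Longrightarrow> indicator C y * F y = (\<Sum>e\<in>J. k e * B e y)"
  shows "(LINT y:C|lebesgue. F y) = (\<Sum>e\<in>J. k e * (LINT y|lborel. B e y))"
proof -
  have "(LINT y:C|lebesgue. F y) = (LINT y|lebesgue. (\<Sum>e\<in>J. k e * B e y))"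
    unfolding set_lebesgue_integral_def
  proof (rule integral_lebesgue_cong_AE)
    show "AE y in lebesgue. indicator C y *\<^sub>R F y = (\<Sum>e\<in>J. k e * B e y)"
      using AE_lebesgue_notin_finite[OF assms(1)] by eventually_elim (simp add: eq)
  qed
  also have "\<dots> = (LINT y|lborel. (\<Sum>e\<in>J. k e * B e y))"
    using B by (intro integral_completion borel_measurable_sum) auto
  also have "\<dots> = (\<Sum>e\<in>J. k e * (LINT y|lborel. B e y))"
    using B by (simp add: Bochner_Integration.integral_sum)
  finally show ?thesis .
qed

lemma sum_idx2: "sum F (idx2 M k) = (\<Sum>\<kappa>\<in>idx1 M k. \<Sum>\<mu>\<in>idx1 M k. F (\<kappa>, \<mu>))"
  by (simp add: idx2_def sum.cartesian_product case_prod_unfold)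

text \<open>The bilinear form of the Kronecker product of the matrices \<open>P\<close> and
  \<open>S\<close>, acting on the first and the second coordinate. It allows cancellation and
  positivity to be taken over from one dimension.\<close>

definition bilin :: "((nat \<times> nat) \<times> (nat \<times> nat)) set \<Rightarrow> ((nat \<times> nat) \<times> (nat \<times> nat)) set \<Rightarrow>
    ((nat \<times> nat) \<times> (nat \<times> nat) \<Rightarrow> real) \<Rightarrow> ((nat \<times> nat) \<times> (nat \<times> nat) \<Rightarrow> real) \<Rightarrow>
    (nat \<times> nat \<Rightarrow> nat \<times> nat \<Rightarrow> real) \<Rightarrow> (nat \<times> nat \<Rightarrow> nat \<times> nat \<Rightarrow> real) \<Rightarrow> real" where
  "bilin I J c d P S = (\<Sum>a\<in>I. \<Sum>e\<in>J. c a * d e * (P (fst a) (fst e) * S (snd a) (snd e)))"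

lemma quadratic_expansion:
  fixes c :: "'a \<Rightarrow> real"
  shows "(\<Sum>\<kappa>\<in>K. c \<kappa> * f \<kappa>) * (\<Sum>\<kappa>\<in>L. d \<kappa> * h \<kappa>) = (\<Sum>\<kappa>\<in>K. \<Sum>\<mu>\<in>L. c \<kappa> * d \<mu> * (f \<kappa> * h \<mu>))"
  by (simp add: sum_product mult_ac)

lemma frac_form_nonneg:
  assumes "0 < s" "s < 1 / 2" "grid M g"
  shows "0 \<le> (\<Sum>\<kappa>\<in>idx1 M k. \<Sum>\<mu>\<in>idx1 M k. C \<kappa> * C \<mu> * frac s g \<kappa> \<mu>)"
proof -
  have "0 \<le> (LINT x|lborel. (\<Sum>\<kappa>\<in>idx1 M k. C \<kappa> * lbasis s g \<kappa> x) * (\<Sum>\<kappa>\<in>idx1 M k. C \<kappa> * rbasis s g \<kappa> x))"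
    using grid_idx1[OF assms(3)] by (intro fractional_form_nonneg assms) auto
  also have "\<dots> = (\<Sum>\<kappa>\<in>idx1 M k. \<Sum>\<mu>\<in>idx1 M k. C \<kappa> * C \<mu> * frac s g \<kappa> \<mu>)"
    unfolding quadratic_expansion frac_def
    using integrable_lbasis_rbasis[OF assms(1,2)]
    by (subst Bochner_Integration.integral_sum; simp add: Bochner_Integration.integral_sum)
  finally show ?thesis .
qed

text \<open>The Kronecker product of a nonnegative form with a Gram matrix is nonnegative:
  contracting the coefficients with the basis at a point \<open>y\<close> gives a vector to which
  the hypothesis on \<open>P\<close> applies, and integration over \<open>y\<close> produces the
  mass matrix.\<close>

lemma bilin_nonneg:
  assumes P: "\<And>C. 0 \<le> (\<Sum>\<kappa>\<in>idx1 M k. \<Sum>\<mu>\<in>idx1 M k. C \<kappa> * C \<mu> * P \<kappa> \<mu>)"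
  shows "0 \<le> bilin (idx2 M k) (idx2 M k) c c P (mass g g)" "0 \<le> bilin (idx2 M k) (idx2 M k) c c (mass g g) P"
proof -
  have main: "0 \<le> (\<Sum>\<kappa>\<in>idx1 M k. \<Sum>\<nu>\<in>idx1 M k. \<Sum>\<mu>\<in>idx1 M k. \<Sum>\<rho>\<in>idx1 M k. c \<kappa> \<nu> * c \<mu> \<rho> * (P \<kappa> \<mu> * mass g g \<nu> \<rho>))" for c
  proof -
    define D where "D \<kappa> y = (\<Sum>\<nu>\<in>idx1 M k. c \<kappa> \<nu> * basis g \<nu> y)" for \<kappa> y
    have DD: "D \<kappa> y * D \<mu> y = (\<Sum>\<nu>\<in>idx1 M k. \<Sum>\<rho>\<in>idx1 M k. c \<kappa> \<nu> * c \<mu> \<rho> * (basis g \<nu> y * basis g \<rho> y))" for \<kappa> \<mu> y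
      unfolding D_def by (rule quadratic_expansion)
    have iDD: "integrable lborel (\<lambda>y. D \<kappa> y * D \<mu> y)" for \<kappa> \<mu>
      unfolding DD using integrable_basis_basis by (intro Bochner_Integration.integrable_sum) auto
    have "0 \<le> (LINT y|lborel. (\<Sum>\<kappa>\<in>idx1 M k. \<Sum>\<mu>\<in>idx1 M k. D \<kappa> y * D \<mu> y * P \<kappa> \<mu>))"
      by (intro integral_nonneg_AE AE_I2 P)
    also have "\<dots> = (\<Sum>\<kappa>\<in>idx1 M k. \<Sum>\<mu>\<in>idx1 M k. (LINT y|lborel. D \<kappa> y * D \<mu> y) * P \<kappa> \<mu>)"
      using iDD by (subst Bochner_Integration.integral_sum; simp add: Bochner_Integration.integral_sum)
    also have "\<dots> = (\<Sum>\<kappa>\<in>idx1 M k. \<Sum>\<mu>\<in>idx1 M k. \<Sum>\<nu>\<in>idx1 M k. \<Sum>\<rho>\<in>idx1 M k. c \<kappa> \<nu> * c \<mu> \<rho> * (P \<kappa> \<mu> * mass g g \<nu> \<rho>))"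
    proof (intro sum.cong refl)
      fix \<kappa> \<mu>
      have "(LINT y|lborel. D \<kappa> y * D \<mu> y) = (\<Sum>\<nu>\<in>idx1 M k. \<Sum>\<rho>\<in>idx1 M k. c \<kappa> \<nu> * c \<mu> \<rho> * mass g g \<nu> \<rho>)"
        unfolding DD mass_def using integrable_basis_basis
        by (subst Bochner_Integration.integral_sum; simp add: Bochner_Integration.integral_sum)
      then show "(LINT y|lborel. D \<kappa> y * D \<mu> y) * P \<kappa> \<mu> = (\<Sum>\<nu>\<in>idx1 M k. \<Sum>\<rho>\<in>idx1 M k. c \<kappa> \<nu> * c \<mu> \<rho> * (P \<kappa> \<mu> * mass g g \<nu> \<rho>))"
        by (simp add: sum_distrib_right sum_distrib_left mult_ac)
    qed
    also have "\<dots> = (\<Sum>\<kappa>\<in>idx1 M k. \<Sum>\<nu>\<in>idx1 M k. \<Sum>\<mu>\<in>idx1 M k. \<Sum>\<rho>\<in>idx1 M k. c \<kappa> \<nu> * c \<mu> \<rho> * (P \<kappa> \<mu> * mass g g \<nu> \<rho>))"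
      by (intro sum.cong refl sum.swap)
    finally show ?thesis .
  qed
  show "0 \<le> bilin (idx2 M k) (idx2 M k) c c P (mass g g)"
    using main[of "curry c"] by (simp add: bilin_def sum_idx2)
  have "bilin (idx2 M k) (idx2 M k) c c (mass g g) P = 
      (\<Sum>\<nu>\<in>idx1 M k. \<Sum>\<kappa>\<in>idx1 M k. \<Sum>\<rho>\<in>idx1 M k. \<Sum>\<mu>\<in>idx1 M k. c (\<nu>, \<kappa>) * c (\<rho>, \<mu>) * (P \<kappa> \<mu> * mass g g \<nu> \<rho>))"
    by (simp add: bilin_def sum_idx2 mult_ac)
  also have "\<dots> = (\<Sum>\<kappa>\<in>idx1 M k. \<Sum>\<nu>\<in>idx1 M k. \<Sum>\<rho>\<in>idx1 M k. \<Sum>\<mu>\<in>idx1 M k. c (\<nu>, \<kappa>) * c (\<rho>, \<mu>) * (P \<kappa> \<mu> * mass g g \<nu> \<rho>))"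
    by (rule sum.swap)
  also have "\<dots> = (\<Sum>\<kappa>\<in>idx1 M k. \<Sum>\<nu>\<in>idx1 M k. \<Sum>\<mu>\<in>idx1 M k. \<Sum>\<rho>\<in>idx1 M k. c (\<nu>, \<kappa>) * c (\<rho>, \<mu>) * (P \<kappa> \<mu> * mass g g \<nu> \<rho>))"
    by (intro sum.cong refl sum.swap)
  also have "\<dots> \<ge> 0" using main[of "\<lambda>\<kappa> \<nu>. c (\<nu>, \<kappa>)"] .
  finally show "0 \<le> bilin (idx2 M k) (idx2 M k) c c (mass g g) P" .
qed

section \<open>The terms of the scheme at a fixed time\<close>

text \<open>The expansion is required only off the grid lines of the mesh itself. This determines
  all cell integrals and all traces, while values on the lines stay free.\<close>

definition rep :: "nat \<Rightarrow> nat \<Rightarrow> (nat \<Rightarrow> real) \<Rightarrow> ((nat \<times> nat) \<times> (nat \<times> nat) \<Rightarrow> real) \<Rightarrow> scalar_field \<Rightarrow> bool" where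
  "rep k M g c w \<longleftrightarrow> (\<forall>x\<in>{0<..<1} - g ` {..M}. \<forall>y\<in>{0<..<1} - g ` {..M}.
     w (x, y) = (\<Sum>a\<in>idx2 M k. c a * (basis g (fst a) x * basis g (snd a) y)))"

text \<open>Cutting a broken polynomial off to one cell amounts to deleting the other coefficients.
  Summing over the cells restores them, so a family of local tests acts like one global test
  function.\<close>

definition on_cell :: "nat \<Rightarrow> nat \<Rightarrow> ((nat \<times> nat) \<times> (nat \<times> nat) \<Rightarrow> real) \<Rightarrow> (nat \<times> nat) \<times> (nat \<times> nat) \<Rightarrow> real" where
  "on_cell i j c a = (if fst (fst a) = i \<and> fst (snd a) = j then c a else 0)"

lemma sum_on_cell: "(\<Sum>i<M. \<Sum>j<M. \<Sum>a\<in>idx2 M k. on_cell i j c a * F a) = (\<Sum>a\<in>idx2 M k. c a * F a)"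
proof -
  have "(\<Sum>i<M. \<Sum>j<M. \<Sum>a\<in>idx2 M k. on_cell i j c a * F a) = (\<Sum>a\<in>idx2 M k. \<Sum>i<M. \<Sum>j<M. on_cell i j c a * F a)"
    by (subst sum.swap[of _ "idx2 M k"], subst sum.swap[of _ "idx2 M k"]) simp
  also have "\<dots> = (\<Sum>a\<in>idx2 M k. c a * F a)"
  proof (rule sum.cong[OF refl])
    fix a assume a: "a \<in> idx2 M k"
    then have lt: "fst (fst a) < M" "fst (snd a) < M" by (auto simp: idx2_def idx1_def)
    have "(\<Sum>j<M. on_cell i j c a * F a) = (if i = fst (fst a) then c a * F a else 0)" for i
    proof -
      have "(\<Sum>j<M. on_cell i j c a * F a) = (\<Sum>j<M. if j = fst (snd a) then (if i = fst (fst a) then c a * F a else 0) else 0)"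
        by (rule sum.cong) (auto simp: on_cell_def)
      then show ?thesis using lt(2) by simp
    qed
    then have "(\<Sum>i<M. \<Sum>j<M. on_cell i j c a * F a) = (\<Sum>i<M. if i = fst (fst a) then c a * F a else 0)" by simp
    also have "\<dots> = c a * F a" using lt by simp
    finally show "(\<Sum>i<M. \<Sum>j<M. on_cell i j c a * F a) = c a * F a" .
  qed
  finally show ?thesis .
qed

lemma bilin_sum_on_cell_right:
  "(\<Sum>i<M. \<Sum>j<M. bilin I (idx2 M k) c (on_cell i j d) P S) = bilin I (idx2 M k) c d P S"
proof -
  have "(\<Sum>i<M. \<Sum>j<M. bilin I (idx2 M k) c (on_cell i j d) P S) =
     (\<Sum>i<M. \<Sum>j<M. \<Sum>e\<in>idx2 M k. on_cell i j d e * (\<Sum>a\<in>I. c a * (P (fst a) (fst e) * S (snd a) (snd e))))"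
    unfolding bilin_def by (intro sum.cong refl trans[OF sum.swap]) (simp add: sum_distrib_left mult_ac)
  also have "\<dots> = (\<Sum>e\<in>idx2 M k. d e * (\<Sum>a\<in>I. c a * (P (fst a) (fst e) * S (snd a) (snd e))))"
    by (rule sum_on_cell)
  also have "\<dots> = bilin I (idx2 M k) c d P S"
    unfolding bilin_def by (rule trans[OF _ sum.swap]) (simp add: sum_distrib_left mult_ac)
  finally show ?thesis .
qed

lemma cell_iff: "(x, y) \<in> cell g i j \<longleftrightarrow> g i < x \<and> x < g (i + 1) \<and> g j < y \<and> y < g (j + 1)"
  by (auto simp: cell_def)

lemma basis_in_cell:
  assumes "grid M g" "i < M" "\<kappa> \<in> idx1 M k" "g i < x" "x < g (i + 1)"
  shows "basis g \<kappa> x = (if fst \<kappa> = i then x ^ snd \<kappa> else 0)"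
    "dbasis g \<kappa> x = (if fst \<kappa> = i then real (snd \<kappa>) * x ^ (snd \<kappa> - 1) else 0)"
proof -
  have "fst \<kappa> = i" if "g (fst \<kappa>) < x" "x < g (fst \<kappa> + 1)"
    using grid_interval_unique[OF assms(1) _ assms(2) that assms(4,5)] assms(3) by (auto simp: idx1_def)
  then have "g (fst \<kappa>) < x \<and> x < g (fst \<kappa> + 1) \<longleftrightarrow> fst \<kappa> = i" using assms(4,5) by blast
  then show "basis g \<kappa> x = (if fst \<kappa> = i then x ^ snd \<kappa> else 0)"
    "dbasis g \<kappa> x = (if fst \<kappa> = i then real (snd \<kappa>) * x ^ (snd \<kappa> - 1) else 0)"
    by (simp_all only: basis_def dbasis_def)
qed

lemma open_interval_off_grid:
  assumes "grid M g" "i < M" "g i < x" "x < g (i + 1)"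
  shows "x \<in> {0<..<1} - g ` {..M}"
proof -
  have "x \<noteq> g j" if "j \<le> M" for j
    using grid_mono[OF assms(1), of j i] grid_mono[OF assms(1), of "i + 1" j] assms that by (cases "j \<le> i") auto
  then show ?thesis using grid_bounds[OF assms(1), of i] grid_bounds[OF assms(1), of "i + 1"] assms by force
qed

definition cpoly :: "((nat \<times> nat) \<times> (nat \<times> nat)) set \<Rightarrow> ((nat \<times> nat) \<times> (nat \<times> nat) \<Rightarrow> real) \<Rightarrow> real \<Rightarrow> real \<Rightarrow> real" where
  "cpoly I c x y = (\<Sum>a\<in>I. c a * (x ^ snd (fst a) * y ^ snd (snd a)))"

lemma rep_cell:
  assumes "rep k M g c w" "grid M g" "i < M" "j < M" "(x, y) \<in> cell g i j"
  shows "w (x, y) = cpoly (idx2 M k) (on_cell i j c) x y"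
proof -
  have x: "g i < x" "x < g (i + 1)" and y: "g j < y" "y < g (j + 1)" using assms(5) by (auto simp: cell_iff)
  have "w (x, y) = (\<Sum>a\<in>idx2 M k. c a * (basis g (fst a) x * basis g (snd a) y))"
    using assms(1) open_interval_off_grid[OF assms(2,3) x] open_interval_off_grid[OF assms(2,4) y]
    unfolding rep_def by blast
  also have "\<dots> = cpoly (idx2 M k) (on_cell i j c) x y"
    unfolding cpoly_def
  proof (rule sum.cong[OF refl])
    fix a assume "a \<in> idx2 M k"
    then have "fst a \<in> idx1 M k" "snd a \<in> idx1 M k" by (auto simp: idx2_def)
    then show "c a * (basis g (fst a) x * basis g (snd a) y) = on_cell i j c a * (x ^ snd (fst a) * y ^ snd (snd a))"
      using basis_in_cell[OF assms(2,3) _ x] basis_in_cell[OF assms(2,4) _ y] by (auto simp: on_cell_def)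
  qed
  finally show ?thesis .
qed

section \<open>Volume terms\<close>

lemma deriv_cell_x:
  assumes "\<And>x y. (x, y) \<in> cell g i j \<Longrightarrow> w (x, y) = cpoly I c x y" "(x, y) \<in> cell g i j"
  shows "deriv (\<lambda>\<xi>. w (\<xi>, y)) x = (\<Sum>a\<in>I. c a * (real (snd (fst a)) * x ^ (snd (fst a) - 1) * y ^ snd (snd a)))"
proof (rule DERIV_imp_deriv)
  have d: "((\<lambda>\<xi>. cpoly I c \<xi> y) has_real_derivative (\<Sum>a\<in>I. c a * (real (snd (fst a)) * x ^ (snd (fst a) - 1) * y ^ snd (snd a)))) (at x)"
    unfolding cpoly_def by (auto intro!: derivative_eq_intros sum.cong simp: mult_ac)
  have "eventually (\<lambda>\<xi>. \<xi> \<in> {g i<..<g (i + 1)}) (nhds x)"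
    using assms(2) by (intro eventually_nhds_in_open) (auto simp: cell_iff)
  then have "eventually (\<lambda>\<xi>. w (\<xi>, y) = cpoly I c \<xi> y) (nhds x)"
    by eventually_elim (use assms in \<open>auto simp: cell_iff\<close>)
  from DERIV_cong_ev[THEN iffD2, OF refl this refl d]
  show "((\<lambda>\<xi>. w (\<xi>, y)) has_real_derivative (\<Sum>a\<in>I. c a * (real (snd (fst a)) * x ^ (snd (fst a) - 1) * y ^ snd (snd a)))) (at x)" .
qed

lemma deriv_cell_y:
  assumes "\<And>x y. (x, y) \<in> cell g i j \<Longrightarrow> w (x, y) = cpoly I c x y" "(x, y) \<in> cell g i j"
  shows "deriv (\<lambda>\<eta>. w (x, \<eta>)) y = (\<Sum>a\<in>I. c a * (x ^ snd (fst a) * (real (snd (snd a)) * y ^ (snd (snd a) - 1))))"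
proof (rule DERIV_imp_deriv)
  have d: "((\<lambda>\<eta>. cpoly I c x \<eta>) has_real_derivative (\<Sum>a\<in>I. c a * (x ^ snd (fst a) * (real (snd (snd a)) * y ^ (snd (snd a) - 1))))) (at y)"
    unfolding cpoly_def by (auto intro!: derivative_eq_intros sum.cong simp: mult_ac)
  have "eventually (\<lambda>\<eta>. \<eta> \<in> {g j<..<g (j + 1)}) (nhds y)"
    using assms(2) by (intro eventually_nhds_in_open) (auto simp: cell_iff)
  then have "eventually (\<lambda>\<eta>. w (x, \<eta>) = cpoly I c x \<eta>) (nhds y)"
    by eventually_elim (use assms in \<open>auto simp: cell_iff\<close>)
  from DERIV_cong_ev[THEN iffD2, OF refl this refl d]
  show "((\<lambda>\<eta>. w (x, \<eta>)) has_real_derivative (\<Sum>a\<in>I. c a * (x ^ snd (fst a) * (real (snd (snd a)) * y ^ (snd (snd a) - 1))))) (at y)" .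
qed

text \<open>The passage from functions to coefficient forms: once an integrand factors into two
  tensor expansions off the grid lines, integrability and value come together.\<close>

lemma bilin_separated:
  fixes A A' B B' :: "nat \<times> nat \<Rightarrow> real \<Rightarrow> real" and F :: "real \<times> real \<Rightarrow> real"
  assumes S: "finite S"
    and A: "\<And>a e. integrable lborel (\<lambda>x. A a x * A' e x)" and B: "\<And>a e. integrable lborel (\<lambda>y. B a y * B' e y)"
    and eq: "\<And>x y. x \<notin> S \<Longrightarrow> y \<notin> S \<Longrightarrow> indicator C (x, y) * F (x, y) =
        (\<Sum>a\<in>I. c a * (A (fst a) x * B (snd a) y)) * (\<Sum>e\<in>J. d e * (A' (fst e) x * B' (snd e) y))"
  shows "set_integrable lebesgue C F"
    "(LINT p:C|lebesgue. F p) = bilin I J c d (\<lambda>\<kappa> \<mu>. LINT x|lborel. A \<kappa> x * A' \<mu> x) (\<lambda>\<kappa> \<mu>. LINT y|lborel. B \<kappa> y * B' \<mu> y)"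
proof -
  have e: "indicator C (x, y) * F (x, y) = (\<Sum>p\<in>I \<times> J. (c (fst p) * d (snd p) * (A (fst (fst p)) x * A' (fst (snd p)) x))
      * (B (snd (fst p)) y * B' (snd (snd p)) y))" if "x \<notin> S" "y \<notin> S" for x y
    unfolding eq[OF that] quadratic_expansion by (simp add: sum.cartesian_product case_prod_unfold mult_ac)
  note sep = set_integral_separated[OF S, where J = "I \<times> J" and
      A = "\<lambda>p x. c (fst p) * d (snd p) * (A (fst (fst p)) x * A' (fst (snd p)) x)" and
      B = "\<lambda>p y. B (snd (fst p)) y * B' (snd (snd p)) y", OF _ _ e]
  show "set_integrable lebesgue C F" by (rule sep(1)) (auto intro: A B)
  have "(LINT p:C|lebesgue. F p) = (\<Sum>p\<in>I \<times> J. (LINT x|lborel. c (fst p) * d (snd p) * (A (fst (fst p)) x * A' (fst (snd p)) x)) *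
     (LINT y|lborel. B (snd (fst p)) y * B' (snd (snd p)) y))"
    by (rule sep(2)) (auto intro: A B)
  then show "(LINT p:C|lebesgue. F p) = bilin I J c d (\<lambda>\<kappa> \<mu>. LINT x|lborel. A \<kappa> x * A' \<mu> x) (\<lambda>\<kappa> \<mu>. LINT y|lborel. B \<kappa> y * B' \<mu> y)"
    by (simp add: bilin_def sum.cartesian_product case_prod_unfold mult_ac)
qed

text \<open>Common core of the gradient and the divergence terms. The differentiated function
  \<open>r\<close> belongs to the mesh whose cell is integrated over, so \<open>deriv\<close> meets
  only a polynomial, whereas \<open>P\<close> may jump inside the cell along lines of the other
  mesh.\<close>

lemma cell_term_x:
  assumes g: "grid M g" and h: "grid M' h" and P: "rep k' M' h c P" and r: "rep k M g d r" and ij: "i < M" "j < M"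
  shows "set_integrable lebesgue (cell g i j) (\<lambda>p. P p * (case p of (x, y) \<Rightarrow> deriv (\<lambda>\<xi>. r (\<xi>, y)) x))"
    "(LINT p:cell g i j|lebesgue. P p * (case p of (x, y) \<Rightarrow> deriv (\<lambda>\<xi>. r (\<xi>, y)) x))
      = bilin (idx2 M' k') (idx2 M k) c (on_cell i j d) (vol h g) (mass h g)"
proof -
  have e: "indicator (cell g i j) (x, y) * (P (x, y) * (case (x, y) of (x, y) \<Rightarrow> deriv (\<lambda>\<xi>. r (\<xi>, y)) x)) =
        (\<Sum>a\<in>idx2 M' k'. c a * (basis h (fst a) x * basis h (snd a) y)) * (\<Sum>e\<in>idx2 M k. on_cell i j d e * (dbasis g (fst e) x * basis g (snd e) y))"
    if "x \<notin> h ` {..M'}" "y \<notin> h ` {..M'}" for x y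
  proof (cases "(x, y) \<in> cell g i j")
    case True
    then have x: "g i < x" "x < g (i + 1)" and y: "g j < y" "y < g (j + 1)" by (auto simp: cell_iff)
    have "P (x, y) = (\<Sum>a\<in>idx2 M' k'. c a * (basis h (fst a) x * basis h (snd a) y))"
      using P that open_interval_off_grid[OF g ij(1) x] open_interval_off_grid[OF g ij(2) y] by (auto simp: rep_def)
    moreover have "deriv (\<lambda>\<xi>. r (\<xi>, y)) x = (\<Sum>e\<in>idx2 M k. on_cell i j d e * (dbasis g (fst e) x * basis g (snd e) y))"
      by (rule trans[OF deriv_cell_x[OF _ True]], rule rep_cell[OF r g ij], assumption, intro sum.cong refl)
         (auto simp: idx2_def on_cell_def basis_in_cell[OF g ij(1) _ x] basis_in_cell[OF g ij(2) _ y])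
    ultimately show ?thesis using True by simp
  next
    case False
    then have "(\<Sum>e\<in>idx2 M k. on_cell i j d e * (dbasis g (fst e) x * basis g (snd e) y)) = 0"
      by (intro sum.neutral) (auto simp: on_cell_def dbasis_def basis_def cell_iff)
    then show ?thesis using False by simp
  qed
  show "set_integrable lebesgue (cell g i j) (\<lambda>p. P p * (case p of (x, y) \<Rightarrow> deriv (\<lambda>\<xi>. r (\<xi>, y)) x))"
    "(LINT p:cell g i j|lebesgue. P p * (case p of (x, y) \<Rightarrow> deriv (\<lambda>\<xi>. r (\<xi>, y)) x))
      = bilin (idx2 M' k') (idx2 M k) c (on_cell i j d) (vol h g) (mass h g)"
    unfolding vol_def[abs_def] mass_def[abs_def]
    by (rule bilin_separated[OF finite_imageI[OF finite_atMost] integrable_basis_dbasis integrable_basis_basis], rule e, assumption, assumption)+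
qed

lemma cell_term_y:
  assumes g: "grid M g" and h: "grid M' h" and P: "rep k' M' h c P" and r: "rep k M g d r" and ij: "i < M" "j < M"
  shows "set_integrable lebesgue (cell g i j) (\<lambda>p. P p * (case p of (x, y) \<Rightarrow> deriv (\<lambda>\<eta>. r (x, \<eta>)) y))"
    "(LINT p:cell g i j|lebesgue. P p * (case p of (x, y) \<Rightarrow> deriv (\<lambda>\<eta>. r (x, \<eta>)) y))
      = bilin (idx2 M' k') (idx2 M k) c (on_cell i j d) (mass h g) (vol h g)"
proof -
  have e: "indicator (cell g i j) (x, y) * (P (x, y) * (case (x, y) of (x, y) \<Rightarrow> deriv (\<lambda>\<eta>. r (x, \<eta>)) y)) =
        (\<Sum>a\<in>idx2 M' k'. c a * (basis h (fst a) x * basis h (snd a) y)) * (\<Sum>e\<in>idx2 M k. on_cell i j d e * (basis g (fst e) x * dbasis g (snd e) y))"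
    if "x \<notin> h ` {..M'}" "y \<notin> h ` {..M'}" for x y
  proof (cases "(x, y) \<in> cell g i j")
    case True
    then have x: "g i < x" "x < g (i + 1)" and y: "g j < y" "y < g (j + 1)" by (auto simp: cell_iff)
    have "P (x, y) = (\<Sum>a\<in>idx2 M' k'. c a * (basis h (fst a) x * basis h (snd a) y))"
      using P that open_interval_off_grid[OF g ij(1) x] open_interval_off_grid[OF g ij(2) y] by (auto simp: rep_def)
    moreover have "deriv (\<lambda>\<eta>. r (x, \<eta>)) y = (\<Sum>e\<in>idx2 M k. on_cell i j d e * (basis g (fst e) x * dbasis g (snd e) y))"
      by (rule trans[OF deriv_cell_y[OF _ True]], rule rep_cell[OF r g ij], assumption, intro sum.cong refl)
         (auto simp: idx2_def on_cell_def basis_in_cell[OF g ij(1) _ x] basis_in_cell[OF g ij(2) _ y])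
    ultimately show ?thesis using True by simp
  next
    case False
    then have "(\<Sum>e\<in>idx2 M k. on_cell i j d e * (basis g (fst e) x * dbasis g (snd e) y)) = 0"
      by (intro sum.neutral) (auto simp: on_cell_def dbasis_def basis_def cell_iff)
    then show ?thesis using False by simp
  qed
  show "set_integrable lebesgue (cell g i j) (\<lambda>p. P p * (case p of (x, y) \<Rightarrow> deriv (\<lambda>\<eta>. r (x, \<eta>)) y))"
    "(LINT p:cell g i j|lebesgue. P p * (case p of (x, y) \<Rightarrow> deriv (\<lambda>\<eta>. r (x, \<eta>)) y))
      = bilin (idx2 M' k') (idx2 M k) c (on_cell i j d) (mass h g) (vol h g)"
    unfolding vol_def[abs_def] mass_def[abs_def]
    by (rule bilin_separated[OF finite_imageI[OF finite_atMost] integrable_basis_basis integrable_basis_dbasis], rule e, assumption, assumption)+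
qed

lemma ip_grad:
  assumes g: "grid M g" and h: "grid M' h"
    and q: "rep k M' h cx (\<lambda>p. fst (q p))" "rep k M' h cy (\<lambda>p. snd (q p))"
    and v: "rep k M g d v" and ij: "i < M" "j < M"
  shows "ip (cell g i j) q (grad v) = bilin (idx2 M' k) (idx2 M k) cx (on_cell i j d) (vol h g) (mass h g)
     + bilin (idx2 M' k) (idx2 M k) cy (on_cell i j d) (mass h g) (vol h g)"
proof -
  have "ip (cell g i j) q (grad v) = (LINT p:cell g i j|lebesgue. fst (q p) * (case p of (x, y) \<Rightarrow> deriv (\<lambda>\<xi>. v (\<xi>, y)) x)
     + snd (q p) * (case p of (x, y) \<Rightarrow> deriv (\<lambda>\<eta>. v (x, \<eta>)) y))"
    by (simp add: ip_def grad_def inner_prod_def case_prod_unfold)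
  then show ?thesis
    using cell_term_x[OF g h q(1) v ij] cell_term_y[OF g h q(2) v ij] by (simp add: set_integral_add)
qed

lemma ip_divergence:
  assumes g: "grid M g" and h: "grid M' h"
    and q: "rep k M g cx (\<lambda>p. fst (q p))" "rep k M g cy (\<lambda>p. snd (q p))"
    and u: "rep k M' h d u" and ij: "i < M" "j < M"
  shows "ip (cell g i j) u (divergence q) = bilin (idx2 M' k) (idx2 M k) d (on_cell i j cx) (vol h g) (mass h g)
     + bilin (idx2 M' k) (idx2 M k) d (on_cell i j cy) (mass h g) (vol h g)"
proof -
  have "ip (cell g i j) u (divergence q) = (LINT p:cell g i j|lebesgue. u p * (case p of (x, y) \<Rightarrow> deriv (\<lambda>\<xi>. (\<lambda>p. fst (q p)) (\<xi>, y)) x)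
     + u p * (case p of (x, y) \<Rightarrow> deriv (\<lambda>\<eta>. (\<lambda>p. snd (q p)) (x, \<eta>)) y))"
    by (simp add: ip_def divergence_def case_prod_unfold distrib_left)
  then show ?thesis
    using cell_term_x[OF g h u q(1) ij] cell_term_y[OF g h u q(2) ij] by (simp add: set_integral_add)
qed

section \<open>Fractional terms\<close>

lemma D_left_eq:
  assumes g: "grid M g" and s: "0 < s" "s < 1" "0 < r" "r < 1"
    and q: "rep k M g cx (\<lambda>p. fst (q p))" "rep k M g cy (\<lambda>p. snd (q p))"
    and x: "x \<in> {0<..<1} - g ` {..M}" and y: "y \<in> {0<..<1} - g ` {..M}"
  shows "fst (D_left s r q (x, y)) = (\<Sum>a\<in>idx2 M k. cx a * (lbasis s g (fst a) x * basis g (snd a) y))"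
    "snd (D_left s r q (x, y)) = (\<Sum>a\<in>idx2 M k. cy a * (basis g (fst a) x * lbasis r g (snd a) y))"
    "fst (D_right s r q (x, y)) = (\<Sum>a\<in>idx2 M k. cx a * (rbasis s g (fst a) x * basis g (snd a) y))"
    "snd (D_right s r q (x, y)) = (\<Sum>a\<in>idx2 M k. cy a * (basis g (fst a) x * rbasis r g (snd a) y))"
proof -
  have k: "0 \<le> g (fst \<kappa>) \<and> g (fst \<kappa>) < g (fst \<kappa> + 1) \<and> z \<noteq> g (fst \<kappa>) \<and> z \<noteq> g (fst \<kappa> + 1)"
    "g (fst \<kappa> + 1) \<le> 1 \<and> g (fst \<kappa>) < g (fst \<kappa> + 1) \<and> z \<noteq> g (fst \<kappa>) \<and> z \<noteq> g (fst \<kappa> + 1)"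
    if "\<kappa> \<in> idx1 M k" "z \<in> {0<..<1} - g ` {..M}" for \<kappa> z
    using grid_idx1[OF g that(1)] that by (auto simp: idx1_def)
  \<comment> \<open>For fixed \<open>y\<close> off the grid lines, the slice is a one-dimensional
    broken polynomial whose coefficients absorb the basis values at \<open>y\<close>. The
    one-dimensional derivative formulas then apply to it.\<close>
  have Qx: "fst (q (\<xi>, y)) = (\<Sum>\<kappa>\<in>idx1 M k. (\<Sum>\<mu>\<in>idx1 M k. cx (\<kappa>, \<mu>) * basis g \<mu> y) * basis g \<kappa> \<xi>)"
    if "\<xi> \<in> {0<..<1} - g ` {..M}" for \<xi>
    using q(1) that y by (simp add: rep_def sum_idx2 sum_distrib_right sum_distrib_left mult_ac)
  have Qy: "snd (q (x, \<eta>)) = (\<Sum>\<kappa>\<in>idx1 M k. (\<Sum>\<mu>\<in>idx1 M k. cy (\<mu>, \<kappa>) * basis g \<mu> x) * basis g \<kappa> \<eta>)"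
    if "\<eta> \<in> {0<..<1} - g ` {..M}" for \<eta>
  proof -
    have "snd (q (x, \<eta>)) = (\<Sum>\<mu>\<in>idx1 M k. \<Sum>\<kappa>\<in>idx1 M k. cy (\<mu>, \<kappa>) * (basis g \<mu> x * basis g \<kappa> \<eta>))"
      using q(2) that x by (simp add: rep_def sum_idx2)
    also have "\<dots> = (\<Sum>\<kappa>\<in>idx1 M k. \<Sum>\<mu>\<in>idx1 M k. cy (\<mu>, \<kappa>) * (basis g \<mu> x * basis g \<kappa> \<eta>))"
      by (rule sum.swap)
    finally show ?thesis by (simp add: sum_distrib_right mult.assoc)
  qed
  have x': "x \<in> {0<..<1}" and y': "y \<in> {0<..<1}" using x y by auto
  have Lx: "RL_left s (\<lambda>\<xi>. fst (q (\<xi>, y))) x = (\<Sum>\<kappa>\<in>idx1 M k. (\<Sum>\<mu>\<in>idx1 M k. cx (\<kappa>, \<mu>) * basis g \<mu> y) * lbasis s g \<kappa> x)"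
  proof (rule RL_left_basis_sum[OF s(1,2) finite_idx1, where S = "g ` {..M}"])
    show "finite (g ` {..M})" by simp
  qed ((rule k(1)[OF _ x], assumption) | rule x' | (rule Qx, assumption))+
  have Ly: "RL_left r (\<lambda>\<xi>. snd (q (x, \<xi>))) y = (\<Sum>\<kappa>\<in>idx1 M k. (\<Sum>\<mu>\<in>idx1 M k. cy (\<mu>, \<kappa>) * basis g \<mu> x) * lbasis r g \<kappa> y)"
  proof (rule RL_left_basis_sum[OF s(3,4) finite_idx1, where S = "g ` {..M}"])
    show "finite (g ` {..M})" by simp
  qed ((rule k(1)[OF _ y], assumption) | rule y' | (rule Qy, assumption))+
  have Rx: "RL_right s (\<lambda>\<xi>. fst (q (\<xi>, y))) x = (\<Sum>\<kappa>\<in>idx1 M k. (\<Sum>\<mu>\<in>idx1 M k. cx (\<kappa>, \<mu>) * basis g \<mu> y) * rbasis s g \<kappa> x)"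
  proof (rule RL_right_basis_sum[OF s(1,2) finite_idx1, where S = "g ` {..M}"])
    show "finite (g ` {..M})" by simp
  qed ((rule k(2)[OF _ x], assumption) | rule x' | (rule Qx, assumption))+
  have Ry: "RL_right r (\<lambda>\<xi>. snd (q (x, \<xi>))) y = (\<Sum>\<kappa>\<in>idx1 M k. (\<Sum>\<mu>\<in>idx1 M k. cy (\<mu>, \<kappa>) * basis g \<mu> x) * rbasis r g \<kappa> y)"
  proof (rule RL_right_basis_sum[OF s(3,4) finite_idx1, where S = "g ` {..M}"])
    show "finite (g ` {..M})" by simp
  qed ((rule k(2)[OF _ y], assumption) | rule y' | (rule Qy, assumption))+
  show "fst (D_left s r q (x, y)) = (\<Sum>a\<in>idx2 M k. cx a * (lbasis s g (fst a) x * basis g (snd a) y))"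
    by (simp add: D_left_def Lx sum_idx2 sum_distrib_right sum_distrib_left mult_ac)
  show "fst (D_right s r q (x, y)) = (\<Sum>a\<in>idx2 M k. cx a * (rbasis s g (fst a) x * basis g (snd a) y))"
    by (simp add: D_right_def Rx sum_idx2 sum_distrib_right sum_distrib_left mult_ac)
  show "snd (D_left s r q (x, y)) = (\<Sum>a\<in>idx2 M k. cy a * (basis g (fst a) x * lbasis r g (snd a) y))"
    unfolding sum_idx2 by (subst sum.swap) (simp add: D_left_def Ly sum_distrib_right sum_distrib_left mult_ac)
  show "snd (D_right s r q (x, y)) = (\<Sum>a\<in>idx2 M k. cy a * (basis g (fst a) x * rbasis r g (snd a) y))"
    unfolding sum_idx2 by (subst sum.swap) (simp add: D_right_def Ry sum_distrib_right sum_distrib_left mult_ac)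
qed

lemma basis_outside: "grid M g \<Longrightarrow> \<kappa> \<in> idx1 M k \<Longrightarrow> x \<le> 0 \<or> 1 \<le> x \<Longrightarrow> basis g \<kappa> x = 0"
  using grid_idx1[of M g \<kappa> k] by (auto simp: basis_def)

lemma lbasis_outside:
  assumes "grid M g" "\<kappa> \<in> idx1 M k" "x \<le> 0" shows "lbasis s g \<kappa> x = 0"
proof -
  have "lpow c r x = 0" if "0 \<le> c" for c r using assms(3) that by (simp add: lpow_def)
  then show ?thesis using grid_idx1[OF assms(1,2)] unfolding lbasis_def tmono_def by simp
qed

lemma rbasis_outside:
  assumes "grid M g" "\<kappa> \<in> idx1 M k" "1 \<le> x" shows "rbasis s g \<kappa> x = 0"
proof -
  have "rpow d r x = 0" if "d \<le> 1" for d r using assms(3) that by (simp add: rpow_def)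
  then show ?thesis using grid_idx1[OF assms(1,2)] unfolding rbasis_def rmono_def by simp
qed

lemma ip_D_left_D_right:
  assumes g: "grid M g" and s: "0 < s" "s < 1 / 2" "0 < r" "r < 1 / 2"
    and q: "rep k M g cx (\<lambda>p. fst (q p))" "rep k M g cy (\<lambda>p. snd (q p))"
    and p: "rep k M g dx (\<lambda>z. fst (p z))" "rep k M g dy (\<lambda>z. snd (p z))"
  shows "ip Omega (D_left s r q) (D_right s r p) = bilin (idx2 M k) (idx2 M k) cx dx (frac s g) (mass g g)
     + bilin (idx2 M k) (idx2 M k) cy dy (mass g g) (frac r g)"
proof -
  have s1: "s < 1" "r < 1" using s by auto
  note D = D_left_eq[OF g s(1) s1(1) s(3) s1(2)]
  have 1: "indicator Omega (x, y) * (fst (D_left s r q (x, y)) * fst (D_right s r p (x, y))) =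
     (\<Sum>a\<in>idx2 M k. cx a * (lbasis s g (fst a) x * basis g (snd a) y)) * (\<Sum>a\<in>idx2 M k. dx a * (rbasis s g (fst a) x * basis g (snd a) y))"
    if "x \<notin> g ` {..M}" "y \<notin> g ` {..M}" for x y
  proof (cases "x \<in> {0<..<1} \<and> y \<in> {0<..<1}")
    case True
    then show ?thesis using that D(1)[OF q, of x y] D(3)[OF p, of x y] by (simp add: Omega_def)
  next
    case False
    \<comment> \<open>\<open>lbasis\<close> has a tail beyond 1 and \<open>rbasis\<close> one below
      0. On each side of the square it is the other factor that vanishes.\<close>
    then consider "x \<le> 0" | "1 \<le> x" | "y \<le> 0 \<or> 1 \<le> y" by fastforce
    then have "(\<Sum>a\<in>idx2 M k. cx a * (lbasis s g (fst a) x * basis g (snd a) y)) = 0 \<or> (\<Sum>a\<in>idx2 M k. dx a * (rbasis s g (fst a) x * basis g (snd a) y)) = 0"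
    proof cases
      case 1 then show ?thesis using lbasis_outside[OF g] by (auto intro!: sum.neutral simp: idx2_def)
    next
      case 2 then show ?thesis using rbasis_outside[OF g] by (auto intro!: sum.neutral simp: idx2_def)
    next
      case 3 then show ?thesis using basis_outside[OF g] by (auto intro!: sum.neutral simp: idx2_def)
    qed
    then show ?thesis using False by (auto simp: Omega_def)
  qed
  have 2: "indicator Omega (x, y) * (snd (D_left s r q (x, y)) * snd (D_right s r p (x, y))) =
     (\<Sum>a\<in>idx2 M k. cy a * (basis g (fst a) x * lbasis r g (snd a) y)) * (\<Sum>a\<in>idx2 M k. dy a * (basis g (fst a) x * rbasis r g (snd a) y))"
    if "x \<notin> g ` {..M}" "y \<notin> g ` {..M}" for x y
  proof (cases "x \<in> {0<..<1} \<and> y \<in> {0<..<1}")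
    case True
    then show ?thesis using that D(2)[OF q, of x y] D(4)[OF p, of x y] by (simp add: Omega_def)
  next
    case False
    then consider "y \<le> 0" | "1 \<le> y" | "x \<le> 0 \<or> 1 \<le> x" by fastforce
    then have "(\<Sum>a\<in>idx2 M k. cy a * (basis g (fst a) x * lbasis r g (snd a) y)) = 0 \<or> (\<Sum>a\<in>idx2 M k. dy a * (basis g (fst a) x * rbasis r g (snd a) y)) = 0"
    proof cases
      case 1 then show ?thesis using lbasis_outside[OF g] by (auto intro!: sum.neutral simp: idx2_def)
    next
      case 2 then show ?thesis using rbasis_outside[OF g] by (auto intro!: sum.neutral simp: idx2_def)
    next
      case 3 then show ?thesis using basis_outside[OF g] by (auto intro!: sum.neutral simp: idx2_def)
    qed
    then show ?thesis using False by (auto simp: Omega_def)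
  qed
  note i = integrable_basis_basis integrable_lbasis_rbasis[OF s(1,2)] integrable_lbasis_rbasis[OF s(3,4)]
  have F: "finite (g ` {..M})" by simp
  have I1: "set_integrable lebesgue Omega (\<lambda>z. fst (D_left s r q z) * fst (D_right s r p z))"
    "(LINT z:Omega|lebesgue. fst (D_left s r q z) * fst (D_right s r p z)) = bilin (idx2 M k) (idx2 M k) cx dx (frac s g) (mass g g)"
    unfolding frac_def[abs_def] mass_def[abs_def]
    by (rule bilin_separated[OF F i(2) i(1)], rule 1, assumption, assumption)+
  have I2: "set_integrable lebesgue Omega (\<lambda>z. snd (D_left s r q z) * snd (D_right s r p z))"
    "(LINT z:Omega|lebesgue. snd (D_left s r q z) * snd (D_right s r p z)) = bilin (idx2 M k) (idx2 M k) cy dy (mass g g) (frac r g)"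
    unfolding frac_def[abs_def] mass_def[abs_def]
    by (rule bilin_separated[OF F i(1) i(3)], rule 2, assumption, assumption)+
  have "ip Omega (D_left s r q) (D_right s r p) =
     (LINT z:Omega|lebesgue. fst (D_left s r q z) * fst (D_right s r p z) + snd (D_left s r q z) * snd (D_right s r p z))"
    by (simp add: ip_def inner_prod_def)
  also have "\<dots> = bilin (idx2 M k) (idx2 M k) cx dx (frac s g) (mass g g) + bilin (idx2 M k) (idx2 M k) cy dy (mass g g) (frac r g)"
    using I1 I2 by (simp add: set_integral_add)
  finally show ?thesis .
qed

lemma ip_commute: "ip C f h = ip C h f"
  by (simp add: ip_def inner_commute)

lemma bilin_swap: "bilin I J c d P S = bilin J I d c (\<lambda>\<kappa> \<mu>. P \<mu> \<kappa>) (\<lambda>\<kappa> \<mu>. S \<mu> \<kappa>)"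
  unfolding bilin_def by (rule trans[OF sum.swap]) (intro sum.cong refl, simp)

section \<open>Traces and boundary integrals\<close>

lemma at_within_box_nontrivial:
  fixes x y a b c d :: real
  assumes "a < b" "c < d" "x \<in> {a..b}" "y \<in> {c..d}"
  shows "at (x, y) within {a<..<b} \<times> {c<..<d} \<noteq> bot"
proof -
  have cl: "(x, y) \<in> closure ({a<..<b} \<times> {c<..<d})"
    using assms by (simp add: closure_Times)
  have "open ({a<..<b} \<times> {c<..<d})" by (intro open_Times) auto
  then have "(x, y) islimpt ({a<..<b} \<times> {c<..<d})"
    using cl interior_limit_point[of "(x, y)" "{a<..<b} \<times> {c<..<d}"] unfolding closure_def
    by (cases "(x, y) \<in> {a<..<b} \<times> {c<..<d}") (auto simp: interior_open)
  then show ?thesis by (simp add: trivial_limit_within)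
qed

lemma tbasis_located:
  assumes g: "grid M g" and k: "\<kappa> \<in> idx1 M k" and i: "i < M" and x: "x \<in> {0..1}"
    "g i < x \<or> x = 0 \<and> g i = 0" "x < g (i + 1) \<or> x = 1 \<and> g (i + 1) = 1"
  shows "tbasis g \<kappa> x = (if fst \<kappa> = i then x ^ snd \<kappa> else 0)"
proof (cases "fst \<kappa> = i")
  case True
  then show ?thesis using x by (simp add: tbasis_def)
next
  case False
  have "fst \<kappa> < M" using k by (auto simp: idx1_def)
  consider "fst \<kappa> + 1 \<le> i" | "i + 1 \<le> fst \<kappa>" using False by linarith
  then have "\<not> ((g (fst \<kappa>) < x \<or> x = 0 \<and> g (fst \<kappa>) = 0) \<and> (x < g (fst \<kappa> + 1) \<or> x = 1 \<and> g (fst \<kappa> + 1) = 1))"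
  proof cases
    case 1
    then have "g (fst \<kappa> + 1) \<le> g i" using i by (intro grid_mono[OF g]) auto
    moreover have "g i < g (i + 1)" "g (i + 1) \<le> 1" using g i grid_bounds[OF g, of "i + 1"] by (auto simp: grid_def)
    ultimately show ?thesis using x by linarith
  next
    case 2
    then have "g (i + 1) \<le> g (fst \<kappa>)" using \<open>fst \<kappa> < M\<close> by (intro grid_mono[OF g]) auto
    moreover have "g i < g (i + 1)" "0 \<le> g i" using g i grid_bounds[OF g, of i] by (auto simp: grid_def)
    moreover have "g (fst \<kappa>) < g (fst \<kappa> + 1)" "g (fst \<kappa> + 1) \<le> 1" using g \<open>fst \<kappa> < M\<close> grid_bounds[OF g, of "fst \<kappa> + 1"] by (auto simp: grid_def)
    ultimately show ?thesis using x by linarith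
  qed
  then show ?thesis using False by (simp only: tbasis_def if_False)
qed

lemma tbasis_eq_basis: "0 < x \<Longrightarrow> x < 1 \<Longrightarrow> tbasis g \<kappa> x = basis g \<kappa> x"
  by (auto simp: tbasis_def basis_def)

lemma cpoly_tendsto: "((\<lambda>p. cpoly I c (fst p) (snd p)) \<longlongrightarrow> cpoly I c x y) (at (x, y) within C)"
proof -
  have "continuous (at (x, y) within C) (\<lambda>p. cpoly I c (fst p) (snd p))"
    unfolding cpoly_def by (intro continuous_intros)
  then show ?thesis by (simp add: continuous_within)
qed

lemma tendsto_Omega:
  assumes g: "grid M g" and w: "rep k M g c w"
    and x: "x \<in> {0..1}" "x \<notin> g ` {1..<M}" and y: "y \<in> {0..1}" "y \<notin> g ` {1..<M}"
  shows "(w \<longlongrightarrow> (\<Sum>a\<in>idx2 M k. c a * (tbasis g (fst a) x * tbasis g (snd a) y))) (at (x, y) within Omega)"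
proof -
  obtain i where i: "i < M" "g i < x \<or> x = 0 \<and> g i = 0" "x < g (i + 1) \<or> x = 1 \<and> g (i + 1) = 1"
    using grid_locate[OF g x] .
  obtain j where j: "j < M" "g j < y \<or> y = 0 \<and> g j = 0" "y < g (j + 1) \<or> y = 1 \<and> g (j + 1) = 1"
    using grid_locate[OF g y] .
  \<comment> \<open>At 0 and 1 the located interval is widened past the boundary, by the arbitrary
    outside values -1 and 2. The box becomes an open neighbourhood of the point, and its part inside
    the domain still lies in a single cell.\<close>
  define lo where "lo i x = (if x = 0 then -1 else g i)" for i and x :: real
  define hi where "hi i x = (if x = 1 then 2 else g (i + 1))" for i and x :: real
  have b: "0 \<le> g i" "g (i + 1) \<le> 1" "0 \<le> g j" "g (j + 1) \<le> 1"
    using grid_bounds[OF g] i(1) j(1) by auto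
  have "open ({lo i x<..<hi i x} \<times> {lo j y<..<hi j y})" by (intro open_Times) auto
  moreover have "(x, y) \<in> {lo i x<..<hi i x} \<times> {lo j y<..<hi j y}"
  proof -
    have "lo i x < x" "lo j y < y" using i(2) j(2) x(1) y(1) by (cases "x = 0"; cases "y = 0"; simp add: lo_def)+
    moreover have "x < hi i x" "y < hi j y" using i(3) j(3) x(1) y(1) by (cases "x = 1"; cases "y = 1"; simp add: hi_def)+
    ultimately show ?thesis by simp
  qed
  moreover have "w p = cpoly (idx2 M k) (on_cell i j c) (fst p) (snd p)"
    if "p \<in> {lo i x<..<hi i x} \<times> {lo j y<..<hi j y}" "p \<in> Omega" for p
  proof -
    have "(fst p, snd p) \<in> cell g i j"
    proof -
      have o: "0 < fst p" "fst p < 1" "0 < snd p" "snd p < 1" using that(2) by (auto simp: Omega_def)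
      have l: "lo i x < fst p" "fst p < hi i x" "lo j y < snd p" "snd p < hi j y" using that(1) by (auto simp: mem_Times_iff)
      have "g i < fst p"
        using l(1) o(1) i(2) b(1) by (cases "x = 0") (simp_all add: lo_def)
      moreover have "g j < snd p"
        using l(3) o(3) j(2) b(3) by (cases "y = 0") (simp_all add: lo_def)
      moreover have "fst p < g (i + 1)"
        using l(2) o(2) i(3) b(2) by (cases "x = 1") (simp_all add: hi_def)
      moreover have "snd p < g (j + 1)"
        using l(4) o(4) j(3) b(4) by (cases "y = 1") (simp_all add: hi_def)
      ultimately show ?thesis unfolding cell_iff by blast
    qed
    then show ?thesis using rep_cell[OF w g i(1) j(1), of "fst p" "snd p"] by simp
  qed
  ultimately have "eventually (\<lambda>p. cpoly (idx2 M k) (on_cell i j c) (fst p) (snd p) = w p) (at (x, y) within Omega)"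
    unfolding eventually_at_topological by metis
  then have "(w \<longlongrightarrow> cpoly (idx2 M k) (on_cell i j c) x y) (at (x, y) within Omega)"
    by (rule Lim_transform_eventually[OF cpoly_tendsto])
  also have "cpoly (idx2 M k) (on_cell i j c) x y = (\<Sum>a\<in>idx2 M k. c a * (tbasis g (fst a) x * tbasis g (snd a) y))"
    unfolding cpoly_def
  proof (rule sum.cong[OF refl])
    fix a assume "a \<in> idx2 M k"
    then have "fst a \<in> idx1 M k" "snd a \<in> idx1 M k" by (auto simp: idx2_def)
    then show "on_cell i j c a * (x ^ snd (fst a) * y ^ snd (snd a)) = c a * (tbasis g (fst a) x * tbasis g (snd a) y)"
      using tbasis_located[OF g _ i(1) x(1) i(2,3)] tbasis_located[OF g _ j(1) y(1) j(2,3)] by (simp add: on_cell_def)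
  qed
  finally show ?thesis .
qed

lemma trace_from_Omega:
  assumes g: "grid M g" and q: "rep k M g cx (\<lambda>p. fst (q p))" "rep k M g cy (\<lambda>p. snd (q p))"
    and x: "x \<in> {0..1}" "x \<notin> g ` {1..<M}" and y: "y \<in> {0..1}" "y \<notin> g ` {1..<M}"
  shows "trace_from Omega q (x, y) = (\<Sum>a\<in>idx2 M k. cx a * (tbasis g (fst a) x * tbasis g (snd a) y),
      \<Sum>a\<in>idx2 M k. cy a * (tbasis g (fst a) x * tbasis g (snd a) y))"
  unfolding trace_from_def
proof (rule tendsto_Lim)
  \<comment> \<open>\<open>Lim\<close> is determined only along a nontrivial filter. Points on the
    edges and corners of the square qualify as limits of interior points.\<close>
  show "at (x, y) within Omega \<noteq> bot"
    unfolding Omega_def using x y by (intro at_within_box_nontrivial) auto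
  show "(q \<longlongrightarrow> (\<Sum>a\<in>idx2 M k. cx a * (tbasis g (fst a) x * tbasis g (snd a) y),
      \<Sum>a\<in>idx2 M k. cy a * (tbasis g (fst a) x * tbasis g (snd a) y))) (at (x, y) within Omega)"
    using tendsto_Pair[OF tendsto_Omega[OF g q(1) x y] tendsto_Omega[OF g q(2) x y]] by simp
qed

lemma tendsto_cell:
  assumes g: "grid M g" and w: "rep k M g c w" and ij: "i < M" "j < M"
  shows "(w \<longlongrightarrow> cpoly (idx2 M k) (on_cell i j c) x y) (at (x, y) within cell g i j)"
proof (rule Lim_transform_eventually[OF cpoly_tendsto])
  show "eventually (\<lambda>p. cpoly (idx2 M k) (on_cell i j c) (fst p) (snd p) = w p) (at (x, y) within cell g i j)"
    unfolding eventually_at_topological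
    using rep_cell[OF w g ij] by (intro exI[of _ UNIV]) auto
qed

lemma at_within_cell_nontrivial:
  assumes g: "grid M g" and ij: "i < M" "j < M" and "x \<in> {g i..g (i + 1)}" "y \<in> {g j..g (j + 1)}"
  shows "at (x, y) within cell g i j \<noteq> bot"
  unfolding cell_def using assms by (intro at_within_box_nontrivial) (auto simp: grid_def)

lemma trace_from_cell:
  assumes g: "grid M g" and w: "rep k M g c w" and ij: "i < M" "j < M"
    and xy: "x \<in> {g i..g (i + 1)}" "y \<in> {g j..g (j + 1)}"
  shows "trace_from (cell g i j) w (x, y) = cpoly (idx2 M k) (on_cell i j c) x y"
  unfolding trace_from_def
  using at_within_cell_nontrivial[OF g ij xy] tendsto_cell[OF g w ij] by (rule tendsto_Lim)

lemma trace_from_cell_vec: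
  assumes g: "grid M g" and q: "rep k M g cx (\<lambda>p. fst (q p))" "rep k M g cy (\<lambda>p. snd (q p))" and ij: "i < M" "j < M"
    and xy: "x \<in> {g i..g (i + 1)}" "y \<in> {g j..g (j + 1)}"
  shows "trace_from (cell g i j) q (x, y) = (cpoly (idx2 M k) (on_cell i j cx) x y, cpoly (idx2 M k) (on_cell i j cy) x y)"
  unfolding trace_from_def
proof (rule tendsto_Lim[OF at_within_cell_nontrivial[OF g ij xy]])
  show "(q \<longlongrightarrow> (cpoly (idx2 M k) (on_cell i j cx) x y, cpoly (idx2 M k) (on_cell i j cy) x y)) (at (x, y) within cell g i j)"
    using tendsto_Pair[OF tendsto_cell[OF g q(1) ij] tendsto_cell[OF g q(2) ij]] by simp
qed

lemma edge_integral_x: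
  assumes S: "finite S" and F: "\<And>y. y \<in> {g j<..<g (j + 1)} - S \<Longrightarrow>
      F y = (\<Sum>a\<in>I. c a * (\<alpha> (fst a) x0 * basis h (snd a) y)) * cpoly J (on_cell i j d) x0 y"
  shows "(LINT y:{g j<..<g (j + 1)}|lebesgue. F y) =
     (\<Sum>a\<in>I. \<Sum>e\<in>J. c a * on_cell i j d e * ((\<alpha> (fst a) x0 * x0 ^ snd (fst e)) * mass h g (snd a) (snd e)))"
proof -
  have "(LINT y:{g j<..<g (j + 1)}|lebesgue. F y) =
    (\<Sum>p\<in>I \<times> J. (c (fst p) * on_cell i j d (snd p) * (\<alpha> (fst (fst p)) x0 * x0 ^ snd (fst (snd p))))
        * (LINT y|lborel. basis h (snd (fst p)) y * basis g (snd (snd p)) y))"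
  proof (rule set_integral_expansion[OF S])
    fix y assume y: "y \<notin> S"
    have r: "indicator {g j<..<g (j + 1)} y * (on_cell i j d e * y ^ snd (snd e)) = on_cell i j d e * basis g (snd e) y" for e
      by (auto simp: on_cell_def basis_def indicator_def)
    have "indicator {g j<..<g (j + 1)} y * F y = indicator {g j<..<g (j + 1)} y *
      ((\<Sum>a\<in>I. c a * (\<alpha> (fst a) x0 * basis h (snd a) y)) * cpoly J (on_cell i j d) x0 y)"
      using F[of y] y by (auto simp: indicator_def)
    also have "\<dots> = (\<Sum>a\<in>I. c a * (\<alpha> (fst a) x0 * basis h (snd a) y)) *
       (\<Sum>e\<in>J. x0 ^ snd (fst e) * (indicator {g j<..<g (j + 1)} y * (on_cell i j d e * y ^ snd (snd e))))"
      by (simp add: cpoly_def sum_distrib_left mult_ac)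
    also have "\<dots> = (\<Sum>p\<in>I \<times> J. (c (fst p) * on_cell i j d (snd p) * (\<alpha> (fst (fst p)) x0 * x0 ^ snd (fst (snd p))))
        * (basis h (snd (fst p)) y * basis g (snd (snd p)) y))"
      unfolding r sum_product by (simp add: sum.cartesian_product case_prod_unfold mult_ac)
    finally show "indicator {g j<..<g (j + 1)} y * F y = (\<Sum>p\<in>I \<times> J. (c (fst p) * on_cell i j d (snd p) * (\<alpha> (fst (fst p)) x0 * x0 ^ snd (fst (snd p))))
        * (basis h (snd (fst p)) y * basis g (snd (snd p)) y))" .
  qed (rule integrable_basis_basis)
  then show ?thesis by (simp add: sum.cartesian_product case_prod_unfold mass_def mult.assoc)
qed

lemma edge_integral_y:
  assumes S: "finite S" and F: "\<And>x. x \<in> {g i<..<g (i + 1)} - S \<Longrightarrow>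
      F x = (\<Sum>a\<in>I. c a * (basis h (fst a) x * \<alpha> (snd a) y0)) * cpoly J (on_cell i j d) x y0"
  shows "(LINT x:{g i<..<g (i + 1)}|lebesgue. F x) =
     (\<Sum>a\<in>I. \<Sum>e\<in>J. c a * on_cell i j d e * (mass h g (fst a) (fst e) * (\<alpha> (snd a) y0 * y0 ^ snd (snd e))))"
proof -
  have "(LINT x:{g i<..<g (i + 1)}|lebesgue. F x) =
    (\<Sum>p\<in>I \<times> J. (c (fst p) * on_cell i j d (snd p) * (\<alpha> (snd (fst p)) y0 * y0 ^ snd (snd (snd p))))
        * (LINT x|lborel. basis h (fst (fst p)) x * basis g (fst (snd p)) x))"
  proof (rule set_integral_expansion[OF S])
    fix x assume x: "x \<notin> S"
    have r: "indicator {g i<..<g (i + 1)} x * (on_cell i j d e * x ^ snd (fst e)) = on_cell i j d e * basis g (fst e) x" for e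
      by (auto simp: on_cell_def basis_def indicator_def)
    have "indicator {g i<..<g (i + 1)} x * F x = indicator {g i<..<g (i + 1)} x *
      ((\<Sum>a\<in>I. c a * (basis h (fst a) x * \<alpha> (snd a) y0)) * cpoly J (on_cell i j d) x y0)"
      using F[of x] x by (auto simp: indicator_def)
    also have "\<dots> = (\<Sum>a\<in>I. c a * (basis h (fst a) x * \<alpha> (snd a) y0)) *
       (\<Sum>e\<in>J. y0 ^ snd (snd e) * (indicator {g i<..<g (i + 1)} x * (on_cell i j d e * x ^ snd (fst e))))"
      by (simp add: cpoly_def sum_distrib_left mult_ac)
    also have "\<dots> = (\<Sum>p\<in>I \<times> J. (c (fst p) * on_cell i j d (snd p) * (\<alpha> (snd (fst p)) y0 * y0 ^ snd (snd (snd p))))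
        * (basis h (fst (fst p)) x * basis g (fst (snd p)) x))"
      unfolding r sum_product by (simp add: sum.cartesian_product case_prod_unfold mult_ac)
    finally show "indicator {g i<..<g (i + 1)} x * F x = (\<Sum>p\<in>I \<times> J. (c (fst p) * on_cell i j d (snd p) * (\<alpha> (snd (fst p)) y0 * y0 ^ snd (snd (snd p))))
        * (basis h (fst (fst p)) x * basis g (fst (snd p)) x))" .
  qed (rule integrable_basis_basis)
  then show ?thesis by (simp add: sum.cartesian_product case_prod_unfold mass_def mult_ac)
qed

text \<open>The normal one-sided value is kept as a parameter \<open>\<alpha>\<close>, so that the
  flux terms (\<open>tbasis\<close>) and the test terms (\<open>basis\<close>) are instances of one
  computation.\<close>

lemma bd_integral_expansion:
  assumes S: "finite S"
    and Fx: "\<And>x y. x \<in> {g i, g (i + 1)} \<Longrightarrow> y \<in> {g j<..<g (j + 1)} - S \<Longrightarrow>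
      F (1, 0) (x, y) = (\<Sum>a\<in>I. c a * (\<alpha> (fst a) x * basis h (snd a) y)) * cpoly J (on_cell i j d) x y \<and>
      F (- 1, 0) (x, y) = - ((\<Sum>a\<in>I. c a * (\<alpha> (fst a) x * basis h (snd a) y)) * cpoly J (on_cell i j d) x y)"
    and Fy: "\<And>x y. y \<in> {g j, g (j + 1)} \<Longrightarrow> x \<in> {g i<..<g (i + 1)} - S \<Longrightarrow>
      F (0, 1) (x, y) = (\<Sum>a\<in>I. c' a * (basis h (fst a) x * \<alpha> (snd a) y)) * cpoly J (on_cell i j d') x y \<and>
      F (0, - 1) (x, y) = - ((\<Sum>a\<in>I. c' a * (basis h (fst a) x * \<alpha> (snd a) y)) * cpoly J (on_cell i j d') x y)"
  shows "bd_integral g i j F = bilin I J c (on_cell i j d) (flux \<alpha> g) (mass h g) + bilin I J c' (on_cell i j d') (mass h g) (flux \<alpha> g)"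
proof -
  let ?X = "\<lambda>x0. \<Sum>a\<in>I. \<Sum>e\<in>J. c a * on_cell i j d e * ((\<alpha> (fst a) x0 * x0 ^ snd (fst e)) * mass h g (snd a) (snd e))"
  let ?Y = "\<lambda>y0. \<Sum>a\<in>I. \<Sum>e\<in>J. c' a * on_cell i j d' e * (mass h g (fst a) (fst e) * (\<alpha> (snd a) y0 * y0 ^ snd (snd e)))"
  have x1: "(LINT y:{g j<..<g (j + 1)}|lebesgue. F (1, 0) (g (i + 1), y)) = ?X (g (i + 1))"
    using Fx by (intro edge_integral_x[OF S]) auto
  have "(LINT y:{g j<..<g (j + 1)}|lebesgue. - F (- 1, 0) (g i, y)) = ?X (g i)"
    using Fx by (intro edge_integral_x[OF S]) auto
  then have x2: "(LINT y:{g j<..<g (j + 1)}|lebesgue. F (- 1, 0) (g i, y)) = - ?X (g i)"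
    by (simp add: set_lebesgue_integral_def)
  have y1: "(LINT x:{g i<..<g (i + 1)}|lebesgue. F (0, 1) (x, g (j + 1))) = ?Y (g (j + 1))"
    using Fy by (intro edge_integral_y[OF S]) auto
  have "(LINT x:{g i<..<g (i + 1)}|lebesgue. - F (0, - 1) (x, g j)) = ?Y (g j)"
    using Fy by (intro edge_integral_y[OF S]) auto
  then have y2: "(LINT x:{g i<..<g (i + 1)}|lebesgue. F (0, - 1) (x, g j)) = - ?Y (g j)"
    by (simp add: set_lebesgue_integral_def)
  \<comment> \<open>Opposite edges combine to a difference of end-point values. The cutoff forces
    the interval of the test index to be \<open>i\<close>, which identifies this difference with
    \<open>flux\<close>.\<close>
  have "?X (g (i + 1)) - ?X (g i) = bilin I J c (on_cell i j d) (flux \<alpha> g) (mass h g)"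
    unfolding bilin_def flux_def sum_subtractf[symmetric] by (intro sum.cong refl) (auto simp: on_cell_def algebra_simps)
  moreover have "?Y (g (j + 1)) - ?Y (g j) = bilin I J c' (on_cell i j d') (mass h g) (flux \<alpha> g)"
    unfolding bilin_def flux_def sum_subtractf[symmetric] by (intro sum.cong refl) (auto simp: on_cell_def algebra_simps)
  ultimately show ?thesis unfolding bd_integral_def x1 x2 y1 y2 by linarith
qed

text \<open>Staggering in the form used for traces: the edge lines of one mesh avoid the interior
  grid lines of the other, where a limit from the domain could fail to exist.\<close>

lemma cell_node_regular:
  assumes g: "grid M g" and h: "grid M' h" and dis: "disjoint_grids M g M' h" and "i \<le> M"
  shows "g i \<in> {0..1}" "g i \<notin> h ` {1..<M'}"
proof -
  show "g i \<in> {0..1}" using grid_bounds[OF g \<open>i \<le> M\<close>] by simp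
  show "g i \<notin> h ` {1..<M'}"
  proof
    assume "g i \<in> h ` {1..<M'}"
    then obtain j where j: "1 \<le> j" "j < M'" "g i = h j" by auto
    then have "0 < h j" "h j < 1"
      using grid_strict_mono[OF h, of 0 j] grid_strict_mono[OF h, of j M'] h by (auto simp: grid_def)
    moreover have "g i = 0 \<or> g i = 1"
      using dis[unfolded disjoint_grids_def, rule_format, OF \<open>i \<le> M\<close> _ j(3)] j(2) by simp
    ultimately show False using j(3) by linarith
  qed
qed

lemma bd_flux:
  assumes g: "grid M g" and h: "grid M' h" and dis: "disjoint_grids M g M' h"
    and q: "rep k M' h cx (\<lambda>p. fst (q p))" "rep k M' h cy (\<lambda>p. snd (q p))"
    and v: "rep k M g d v" and ij: "i < M" "j < M"
  shows "bd_integral g i j (\<lambda>n p. (n \<bullet> trace_from Omega q p) * trace_from (cell g i j) v p)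
     = bilin (idx2 M' k) (idx2 M k) cx (on_cell i j d) (flux (tbasis h) g) (mass h g)
     + bilin (idx2 M' k) (idx2 M k) cy (on_cell i j d) (mass h g) (flux (tbasis h) g)"
proof (rule bd_integral_expansion[where S = "h ` {..M'}"])
  have lt: "g i < g (i + 1)" "g j < g (j + 1)" using g ij by (auto simp: grid_def)
  have reg: "z \<in> {0..1}" "z \<notin> h ` {1..<M'}" if "z \<in> {g i, g (i + 1), g j, g (j + 1)}" for z
  proof -
    have le: "i \<le> M" "i + 1 \<le> M" "j \<le> M" "j + 1 \<le> M" using ij by auto
    have "z = g i \<or> z = g (i + 1) \<or> z = g j \<or> z = g (j + 1)" using that by simp
    then have "z \<in> {0..1} \<and> z \<notin> h ` {1..<M'}"
      by (elim disjE) (simp_all only: cell_node_regular[OF g h dis le(1)] cell_node_regular[OF g h dis le(2)]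
          cell_node_regular[OF g h dis le(3)] cell_node_regular[OF g h dis le(4)] not_False_eq_True simp_thms)
    then show "z \<in> {0..1}" "z \<notin> h ` {1..<M'}" by blast+
  qed
  \<comment> \<open>Tangential coordinates along an edge stay strictly between 0 and 1, where
    \<open>tbasis\<close> and \<open>basis\<close> agree. Only the normal coordinate can reach the
    boundary of the domain.\<close>
  have inn: "z \<in> {0..1}" "z \<notin> h ` {1..<M'}" "0 < z" "z < 1"
    if "z \<in> {g l<..<g (l + 1)} - h ` {..M'}" "l < M" for z l
    using open_interval_off_grid[OF g that(2), of z] that(1) by auto
  show "((1, 0) \<bullet> trace_from Omega q (x, y)) * trace_from (cell g i j) v (x, y) =
      (\<Sum>a\<in>idx2 M' k. cx a * (tbasis h (fst a) x * basis h (snd a) y)) * cpoly (idx2 M k) (on_cell i j d) x y \<and>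
     ((- 1, 0) \<bullet> trace_from Omega q (x, y)) * trace_from (cell g i j) v (x, y) =
      - ((\<Sum>a\<in>idx2 M' k. cx a * (tbasis h (fst a) x * basis h (snd a) y)) * cpoly (idx2 M k) (on_cell i j d) x y)"
    if x: "x \<in> {g i, g (i + 1)}" and y: "y \<in> {g j<..<g (j + 1)} - h ` {..M'}" for x y
  proof -
    have "trace_from (cell g i j) v (x, y) = cpoly (idx2 M k) (on_cell i j d) x y"
      using x y lt by (intro trace_from_cell[OF g v ij]) auto
    moreover have "fst (trace_from Omega q (x, y)) = (\<Sum>a\<in>idx2 M' k. cx a * (tbasis h (fst a) x * basis h (snd a) y))"
      using trace_from_Omega[OF h q reg(1) reg(2) inn(1)[OF y ij(2)] inn(2)[OF y ij(2)], of x] x tbasis_eq_basis[OF inn(3,4)[OF y ij(2)]] by auto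
    ultimately show ?thesis by (simp add: inner_prod_def)
  qed
  show "((0, 1) \<bullet> trace_from Omega q (x, y)) * trace_from (cell g i j) v (x, y) =
      (\<Sum>a\<in>idx2 M' k. cy a * (basis h (fst a) x * tbasis h (snd a) y)) * cpoly (idx2 M k) (on_cell i j d) x y \<and>
     ((0, - 1) \<bullet> trace_from Omega q (x, y)) * trace_from (cell g i j) v (x, y) =
      - ((\<Sum>a\<in>idx2 M' k. cy a * (basis h (fst a) x * tbasis h (snd a) y)) * cpoly (idx2 M k) (on_cell i j d) x y)"
    if y: "y \<in> {g j, g (j + 1)}" and x: "x \<in> {g i<..<g (i + 1)} - h ` {..M'}" for x y
  proof -
    have "trace_from (cell g i j) v (x, y) = cpoly (idx2 M k) (on_cell i j d) x y"
      using x y lt by (intro trace_from_cell[OF g v ij]) auto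
    moreover have "snd (trace_from Omega q (x, y)) = (\<Sum>a\<in>idx2 M' k. cy a * (basis h (fst a) x * tbasis h (snd a) y))"
      using trace_from_Omega[OF h q inn(1)[OF x ij(1)] inn(2)[OF x ij(1)] reg(1) reg(2), of y] y tbasis_eq_basis[OF inn(3,4)[OF x ij(1)]] by auto
    ultimately show ?thesis by (simp add: inner_prod_def)
  qed
qed auto

text \<open>An interior edge of the other mesh is not a grid line of \<open>h\<close>, so the
  expansion holds on it. On the boundary both sides are zero, by the exterior values of
  \<open>u\<close> and because \<open>basis\<close> lives on open intervals. This is where the
  boundary condition on \<open>u\<close> enters.\<close>

lemma rep_at_nodes:
  assumes g: "grid M g" and h: "grid M' h" and dis: "disjoint_grids M g M' h"
    and u: "rep k M' h d u" and u0: "\<And>p. p \<notin> Omega \<Longrightarrow> u p = 0" and l: "l \<le> M"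
    and z: "z \<in> {0<..<1} - h ` {..M'}"
  shows "u (g l, z) = (\<Sum>a\<in>idx2 M' k. d a * (basis h (fst a) (g l) * basis h (snd a) z))"
    "u (z, g l) = (\<Sum>a\<in>idx2 M' k. d a * (basis h (fst a) z * basis h (snd a) (g l)))"
proof -
  have "u (g l, z) = (\<Sum>a\<in>idx2 M' k. d a * (basis h (fst a) (g l) * basis h (snd a) z)) \<and>
    u (z, g l) = (\<Sum>a\<in>idx2 M' k. d a * (basis h (fst a) z * basis h (snd a) (g l)))"
  proof (cases "0 < g l \<and> g l < 1")
    case True
    have "g l \<notin> h ` {..M'}"
    proof
      assume "g l \<in> h ` {..M'}"
      then obtain j where j: "j \<le> M'" "g l = h j" by auto
      show False using True dis[unfolded disjoint_grids_def, rule_format, OF l j] by linarith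
    qed
    then show ?thesis using u z True unfolding rep_def by auto
  next
    case False
    then have "u (g l, z) = 0" "u (z, g l) = 0" by (auto intro!: u0 simp: Omega_def)
    moreover have "basis h (fst a) (g l) = 0" "basis h (snd a) (g l) = 0" if "a \<in> idx2 M' k" for a
      using basis_outside[OF h, of _ k "g l"] that False by (auto simp: idx2_def)
    ultimately show ?thesis by simp
  qed
  then show "u (g l, z) = (\<Sum>a\<in>idx2 M' k. d a * (basis h (fst a) (g l) * basis h (snd a) z))"
    "u (z, g l) = (\<Sum>a\<in>idx2 M' k. d a * (basis h (fst a) z * basis h (snd a) (g l)))" by auto
qed

lemma bd_test:
  assumes g: "grid M g" and h: "grid M' h" and dis: "disjoint_grids M g M' h"
    and q: "rep k M g cx (\<lambda>p. fst (q p))" "rep k M g cy (\<lambda>p. snd (q p))"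
    and u: "rep k M' h d u" and u0: "\<And>p. p \<notin> Omega \<Longrightarrow> u p = 0" and ij: "i < M" "j < M"
  shows "bd_integral g i j (\<lambda>n p. u p * (n \<bullet> trace_from (cell g i j) q p))
     = bilin (idx2 M' k) (idx2 M k) d (on_cell i j cx) (flux (basis h) g) (mass h g)
     + bilin (idx2 M' k) (idx2 M k) d (on_cell i j cy) (mass h g) (flux (basis h) g)"
proof (rule bd_integral_expansion[where S = "h ` {..M'}"])
  have lt: "g i < g (i + 1)" "g j < g (j + 1)" using g ij by (auto simp: grid_def)
  have inn: "z \<in> {0<..<1} - h ` {..M'}"
    if "z \<in> {g l<..<g (l + 1)} - h ` {..M'}" "l < M" for z l
    using open_interval_off_grid[OF g that(2), of z] that(1) by auto
  show "u (x, y) * ((1, 0) \<bullet> trace_from (cell g i j) q (x, y)) =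
      (\<Sum>a\<in>idx2 M' k. d a * (basis h (fst a) x * basis h (snd a) y)) * cpoly (idx2 M k) (on_cell i j cx) x y \<and>
     u (x, y) * ((- 1, 0) \<bullet> trace_from (cell g i j) q (x, y)) =
      - ((\<Sum>a\<in>idx2 M' k. d a * (basis h (fst a) x * basis h (snd a) y)) * cpoly (idx2 M k) (on_cell i j cx) x y)"
    if x: "x \<in> {g i, g (i + 1)}" and y: "y \<in> {g j<..<g (j + 1)} - h ` {..M'}" for x y
  proof -
    have "fst (trace_from (cell g i j) q (x, y)) = cpoly (idx2 M k) (on_cell i j cx) x y"
      using x y lt by (subst trace_from_cell_vec[OF g q ij]) auto
    moreover have "u (x, y) = (\<Sum>a\<in>idx2 M' k. d a * (basis h (fst a) x * basis h (snd a) y))"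
      using x rep_at_nodes(1)[OF g h dis u u0 _ inn[OF y ij(2)], of i] rep_at_nodes(1)[OF g h dis u u0 _ inn[OF y ij(2)], of "i + 1"] ij by auto
    ultimately show ?thesis by (simp add: inner_prod_def)
  qed
  show "u (x, y) * ((0, 1) \<bullet> trace_from (cell g i j) q (x, y)) =
      (\<Sum>a\<in>idx2 M' k. d a * (basis h (fst a) x * basis h (snd a) y)) * cpoly (idx2 M k) (on_cell i j cy) x y \<and>
     u (x, y) * ((0, - 1) \<bullet> trace_from (cell g i j) q (x, y)) =
      - ((\<Sum>a\<in>idx2 M' k. d a * (basis h (fst a) x * basis h (snd a) y)) * cpoly (idx2 M k) (on_cell i j cy) x y)"
    if y: "y \<in> {g j, g (j + 1)}" and x: "x \<in> {g i<..<g (i + 1)} - h ` {..M'}" for x y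
  proof -
    have "snd (trace_from (cell g i j) q (x, y)) = cpoly (idx2 M k) (on_cell i j cy) x y"
      using x y lt by (subst trace_from_cell_vec[OF g q ij]) auto
    moreover have "u (x, y) = (\<Sum>a\<in>idx2 M' k. d a * (basis h (fst a) x * basis h (snd a) y))"
      using y rep_at_nodes(2)[OF g h dis u u0 _ inn[OF x ij(1)], of j] rep_at_nodes(2)[OF g h dis u u0 _ inn[OF x ij(1)], of "j + 1"] ij by auto
    ultimately show ?thesis by (simp add: inner_prod_def)
  qed
qed auto

text \<open>In each direction the transverse factor of all four terms is the same mass matrix, by
  its symmetry. Factoring it out leaves the one-dimensional cancellation for every pair of
  indices.\<close>

lemma green_cancel:
  assumes g: "grid M g" and h: "grid M' h" and dis: "disjoint_grids M g M' h"
  shows "bilin (idx2 M' k) (idx2 M k) c d (vol h g) (mass h g) - bilin (idx2 M' k) (idx2 M k) c d (flux (tbasis h) g) (mass h g)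
     + (bilin (idx2 M k) (idx2 M' k) d c (vol g h) (mass g h) - bilin (idx2 M k) (idx2 M' k) d c (flux (basis g) h) (mass g h)) = 0"
    and "bilin (idx2 M' k) (idx2 M k) c d (mass h g) (vol h g) - bilin (idx2 M' k) (idx2 M k) c d (mass h g) (flux (tbasis h) g)
     + (bilin (idx2 M k) (idx2 M' k) d c (mass g h) (vol g h) - bilin (idx2 M k) (idx2 M' k) d c (mass g h) (flux (basis g) h)) = 0"
proof -
  have A: "vol h g \<kappa>' \<kappa> - flux (tbasis h) g \<kappa>' \<kappa> + (vol g h \<kappa> \<kappa>' - flux (basis g) h \<kappa> \<kappa>') = 0"
    if "\<kappa> \<in> idx1 M k" "\<kappa>' \<in> idx1 M' k" for \<kappa> \<kappa>'
    using vol_flux_cancel[OF g h dis that] .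
  have m: "mass g h \<kappa> \<mu> = mass h g \<mu> \<kappa>" for \<kappa> \<mu> by (rule mass_commute)
  have z: "x * y * (p * s) - x * y * (p' * s) + (x * y * (r * s) - x * y * (r' * s)) = 0" if "p - p' + (r - r') = 0" for x y p p' r r' s :: real
  proof -
    have "x * y * (p * s) - x * y * (p' * s) + (x * y * (r * s) - x * y * (r' * s)) = x * y * s * (p - p' + (r - r'))"
      by (simp add: algebra_simps)
    then show ?thesis using that by simp
  qed
  have z': "x * y * (s * p) - x * y * (s * p') + (x * y * (s * r) - x * y * (s * r')) = 0" if "p - p' + (r - r') = 0" for x y p p' r r' s :: real
    using z[OF that, of x y s] by (simp add: mult.commute[of s])
  show "bilin (idx2 M' k) (idx2 M k) c d (vol h g) (mass h g) - bilin (idx2 M' k) (idx2 M k) c d (flux (tbasis h) g) (mass h g)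
     + (bilin (idx2 M k) (idx2 M' k) d c (vol g h) (mass g h) - bilin (idx2 M k) (idx2 M' k) d c (flux (basis g) h) (mass g h)) = 0"
    unfolding bilin_swap[of "idx2 M k" "idx2 M' k"] unfolding bilin_def m sum_subtractf[symmetric] sum.distrib[symmetric]
    by (intro sum.neutral ballI z A) (auto simp: idx2_def)
  show "bilin (idx2 M' k) (idx2 M k) c d (mass h g) (vol h g) - bilin (idx2 M' k) (idx2 M k) c d (mass h g) (flux (tbasis h) g)
     + (bilin (idx2 M k) (idx2 M' k) d c (mass g h) (vol g h) - bilin (idx2 M k) (idx2 M' k) d c (mass g h) (flux (basis g) h)) = 0"
    unfolding bilin_swap[of "idx2 M k" "idx2 M' k"] unfolding bilin_def m sum_subtractf[symmetric] sum.distrib[symmetric]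
    by (intro sum.neutral ballI z' A) (auto simp: idx2_def)
qed

section \<open>Dependence on time\<close>

text \<open>Fubini works with the Borel product measure. An exceptional set is therefore first
  enclosed in a Borel null set, whose sections in either direction are almost all null.\<close>

lemma AE_lebesgue_pair:
  fixes P :: "real \<times> real \<times> real \<Rightarrow> bool"
  assumes "AE z in lebesgue. P z"
  shows "AE t in lebesgue. AE p in lebesgue. P (t, p)" "AE p in lebesgue. AE t in lebesgue. P (t, p)"
proof -
  have "AE z in lborel \<Otimes>\<^sub>M lborel. P z"
    using assms unfolding AE_completion_iff by (subst lborel_prod)
  then obtain N where N: "N \<in> null_sets (lborel \<Otimes>\<^sub>M (lborel :: (real \<times> real) measure))" "{z. \<not> P z} \<subseteq> N"
    unfolding eventually_ae_filter by (auto simp: space_pair_measure)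
  have ae: "AE z in lborel \<Otimes>\<^sub>M lborel. z \<notin> N" using N(1) by (rule AE_not_in)
  have "AE t in lborel. AE p in lborel. (t, p) \<notin> N"
    using lborel_pair.AE_pair[OF ae] .
  then show "AE t in lebesgue. AE p in lebesgue. P (t, p)"
    unfolding AE_completion_iff by eventually_elim (erule eventually_mono, use N(2) in blast)
  have "AE p in lborel. AE t in lborel. (t, p) \<notin> N"
  proof (subst lborel_pair.AE_commute[symmetric])
    have "{z \<in> space (lborel \<Otimes>\<^sub>M (lborel :: (real \<times> real) measure)). (fst z, snd z) \<notin> N} = space (lborel \<Otimes>\<^sub>M lborel) - N"
      by auto
    then show "{z \<in> space (lborel \<Otimes>\<^sub>M (lborel :: (real \<times> real) measure)). (fst z, snd z) \<notin> N} \<in> sets (lborel \<Otimes>\<^sub>M lborel)"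
      using sets.compl_sets[OF null_setsD2[OF N(1)]] by simp
  qed (rule lborel_pair.AE_pair[OF ae])
  then show "AE p in lebesgue. AE t in lebesgue. P (t, p)"
    unfolding AE_completion_iff by eventually_elim (erule eventually_mono, use N(2) in blast)
qed

text \<open>A Borel representative on all of space-time, extended by zero. It gives access to
  product measures and leaves no side conditions on the cylinder.\<close>

lemma L2_time_borel:
  assumes "w \<in> L2_time T X"
  shows "\<exists>W. W \<in> borel_measurable borel \<and> (\<forall>z. z \<notin> {0..T} \<times> Omega \<longrightarrow> W z = 0) \<and>
    integrable lborel (\<lambda>z. (W z)\<^sup>2) \<and> (AE z in lebesgue. z \<in> {0..T} \<times> Omega \<longrightarrow> w (fst z) (snd z) = W z)"
proof -
  let ?Q = "{0..T} \<times> Omega"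
  have Q [measurable]: "?Q \<in> sets borel"
    unfolding Omega_def by (intro borel_Times) (auto intro!: borel_Times)
  let ?f = "\<lambda>z. indicator ?Q z *\<^sub>R (case z of (t, p) \<Rightarrow> w t p)"
  have "?f \<in> borel_measurable lebesgue" using assms by (simp add: L2_time_def set_borel_measurable_def)
  then obtain V where V: "V \<in> borel_measurable lborel" "AE z in lborel. ?f z = V z"
    using completion_ex_borel_measurable_real by blast
  define W where "W z = indicator ?Q z * V z" for z
  have Wm: "W \<in> borel_measurable borel" using V(1) unfolding W_def[abs_def] by measurable
  have ae: "AE z in lebesgue. ?f z = W z"
    using AE_completion[OF V(2)]
  proof eventually_elim
    case (elim z)
    then show ?case by (cases "z \<in> ?Q") (simp_all add: W_def)
  qed
  have "integrable lebesgue (\<lambda>z. indicator ?Q z *\<^sub>R (case z of (t, p) \<Rightarrow> (w t p)\<^sup>2))"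
    using assms by (simp add: L2_time_def set_integrable_def)
  then have "integrable lebesgue (\<lambda>z. (W z)\<^sup>2)"
  proof (rule integrable_lebesgue_cong_AE)
    show "AE z in lebesgue. indicator ?Q z *\<^sub>R (case z of (t, p) \<Rightarrow> (w t p)\<^sup>2) = (W z)\<^sup>2"
      using ae by eventually_elim (auto simp: indicator_def split: prod.splits if_splits)
  qed
  then have "integrable lborel (\<lambda>z. (W z)\<^sup>2)" using Wm by (subst (asm) integrable_completion) auto
  moreover have "AE z in lebesgue. z \<in> ?Q \<longrightarrow> w (fst z) (snd z) = W z"
    using ae by eventually_elim (auto split: prod.splits)
  moreover have "W z = 0" if "z \<notin> ?Q" for z using that by (simp add: W_def)
  ultimately show ?thesis using Wm by blast
qed

section \<open>Inner products in time and the energy identity\<close>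

lemma integrable_mult_L2:
  fixes f h :: "'a \<Rightarrow> real"
  assumes [measurable]: "f \<in> borel_measurable M" "h \<in> borel_measurable M"
    and "integrable M (\<lambda>x. (f x)\<^sup>2)" "integrable M (\<lambda>x. (h x)\<^sup>2)"
  shows "integrable M (\<lambda>x. f x * h x)"
proof (rule Bochner_Integration.integrable_bound[OF Bochner_Integration.integrable_add[OF assms(3,4)]])
  have "\<bar>a * b\<bar> \<le> \<bar>a\<^sup>2 + b\<^sup>2\<bar>" for a b :: real
  proof -
    have "2 * (\<bar>a\<bar> * \<bar>b\<bar>) \<le> a\<^sup>2 + b\<^sup>2" using sum_squares_bound[of "\<bar>a\<bar>" "\<bar>b\<bar>"] by simp
    moreover have "0 \<le> \<bar>a\<bar> * \<bar>b\<bar>" by simp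
    ultimately show ?thesis unfolding abs_mult by linarith
  qed
  then show "AE x in M. norm (f x * h x) \<le> norm ((f x)\<^sup>2 + (h x)\<^sup>2)" by simp
qed measurable

text \<open>Both halves are needed to split inner products of differences: integrability in space at
  almost every time to split \<open>ip\<close>, and integrability in time to split its time
  integral.\<close>

lemma ip_time_integrable:
  assumes w: "w \<in> L2_time T X" and v: "v \<in> L2_time T Y" and C: "C \<in> sets borel" "C \<subseteq> Omega"
  shows "set_integrable lebesgue {0..T} (\<lambda>t. ip C (w t) (v t))"
    "AE t in lebesgue. t \<in> {0..T} \<longrightarrow> set_integrable lebesgue C (\<lambda>p. w t p * v t p)"
proof -
  obtain W where W: "W \<in> borel_measurable borel" "\<And>z. z \<notin> {0..T} \<times> Omega \<Longrightarrow> W z = 0"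
    "integrable lborel (\<lambda>z. (W z)\<^sup>2)" "AE z in lebesgue. z \<in> {0..T} \<times> Omega \<longrightarrow> w (fst z) (snd z) = W z"
    using L2_time_borel[OF w] by blast
  obtain V where V: "V \<in> borel_measurable borel" "\<And>z. z \<notin> {0..T} \<times> Omega \<Longrightarrow> V z = 0"
    "integrable lborel (\<lambda>z. (V z)\<^sup>2)" "AE z in lebesgue. z \<in> {0..T} \<times> Omega \<longrightarrow> v (fst z) (snd z) = V z"
    using L2_time_borel[OF v] by blast
  have [measurable]: "C \<in> sets borel" by fact
  note [measurable] = W(1) V(1)
  have i: "integrable lborel (\<lambda>z. indicator C (snd z) *\<^sub>R (W z * V z))"
  proof (rule Bochner_Integration.integrable_bound)
    show "integrable lborel (\<lambda>z. W z * V z)" using W V by (intro integrable_mult_L2) auto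
    have "(\<lambda>z :: real \<times> real \<times> real. snd z) \<in> borel_measurable borel" by (intro borel_measurable_continuous_onI continuous_intros)
    then show "(\<lambda>z. indicator C (snd z) *\<^sub>R (W z * V z)) \<in> borel_measurable lborel" by measurable
  qed (auto simp: indicator_def)
  then have i': "integrable (lborel \<Otimes>\<^sub>M lborel) (\<lambda>z. indicator C (snd z) *\<^sub>R (W z * V z))"
    by (simp add: lborel_prod)
  have sec: "AE t in lborel. integrable lborel (\<lambda>p. indicator C p *\<^sub>R (W (t, p) * V (t, p)))"
    using lborel_pair.AE_integrable_fst'[OF i'] by simp
  have int: "integrable lborel (\<lambda>t. LINT p|lborel. indicator C p *\<^sub>R (W (t, p) * V (t, p)))"
    using lborel_pair.integrable_fst'[OF i'] by simp
  have ae: "AE t in lebesgue. AE p in lebesgue. t \<in> {0..T} \<longrightarrow> p \<in> Omega \<longrightarrow> w t p = W (t, p) \<and> v t p = V (t, p)"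
    using AE_lebesgue_pair(1)[OF W(4)] AE_lebesgue_pair(1)[OF V(4)]
  proof eventually_elim
    case (elim t)
    then show ?case by eventually_elim auto
  qed
  have sec': "AE t in lebesgue. t \<in> {0..T} \<longrightarrow> set_integrable lebesgue C (\<lambda>p. w t p * v t p) \<and>
     ip C (w t) (v t) = (LINT p|lborel. indicator C p *\<^sub>R (W (t, p) * V (t, p)))"
    using ae AE_completion[OF sec]
  proof eventually_elim
    case (elim t)
    show ?case
    proof
      assume t: "t \<in> {0..T}"
      have eq: "AE p in lebesgue. indicator C p *\<^sub>R (W (t, p) * V (t, p)) = indicator C p *\<^sub>R (w t p * v t p)"
        using elim(1) by eventually_elim (use t C in \<open>auto simp: indicator_def\<close>)
      have m: "(\<lambda>p. indicator C p *\<^sub>R (W (t, p) * V (t, p))) \<in> borel_measurable lborel" using elim(2) by auto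
      have "integrable lebesgue (\<lambda>p. indicator C p *\<^sub>R (W (t, p) * V (t, p)))"
        using elim(2) integrable_completion[OF m] by simp
      then have "set_integrable lebesgue C (\<lambda>p. w t p * v t p)"
        unfolding set_integrable_def by (rule integrable_lebesgue_cong_AE[OF _ eq])
      moreover have "ip C (w t) (v t) = (LINT p|lborel. indicator C p *\<^sub>R (W (t, p) * V (t, p)))"
        unfolding ip_def set_lebesgue_integral_def inner_real_def
        using integral_lebesgue_cong_AE[OF eq] integral_completion[OF m] by simp
      ultimately show "set_integrable lebesgue C (\<lambda>p. w t p * v t p) \<and>
        ip C (w t) (v t) = (LINT p|lborel. indicator C p *\<^sub>R (W (t, p) * V (t, p)))" ..
    qed
  qed
  then show "AE t in lebesgue. t \<in> {0..T} \<longrightarrow> set_integrable lebesgue C (\<lambda>p. w t p * v t p)"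
    by eventually_elim blast
  have "integrable lebesgue (\<lambda>t. indicator {0..T} t *\<^sub>R (LINT p|lborel. indicator C p *\<^sub>R (W (t, p) * V (t, p))))"
  proof -
    have "integrable lborel (\<lambda>t. indicator {0..T} t *\<^sub>R (LINT p|lborel. indicator C p *\<^sub>R (W (t, p) * V (t, p))))"
      by (rule integrable_mult_indicator[OF _ int]) simp
    then show ?thesis by (subst integrable_completion) auto
  qed
  then show "set_integrable lebesgue {0..T} (\<lambda>t. ip C (w t) (v t))"
    unfolding set_integrable_def
  proof (rule integrable_lebesgue_cong_AE)
    show "AE t in lebesgue. indicator {0..T} t *\<^sub>R (LINT p|lborel. indicator C p *\<^sub>R (W (t, p) * V (t, p)))
       = indicator {0..T} t *\<^sub>R ip C (w t) (v t)"
      using sec' by eventually_elim (auto simp: indicator_def)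
  qed
qed

text \<open>The chain rule for the square of an indefinite integral, without differentiating it.
  Exchanging the variables maps the part \<open>s \<le> t\<close> of the symmetric integrand
  \<open>f t * f s\<close> onto the part \<open>t \<le> s\<close>, so each is half of the integral
  over the full square.\<close>

lemma integral_triangle:
  fixes f :: "real \<Rightarrow> real"
  assumes f: "integrable lborel f" and f0: "\<And>t. t \<notin> {0..T} \<Longrightarrow> f t = 0"
  shows "integrable lborel (\<lambda>t. f t * (c + (LINT s:{0..t}|lborel. f s)))"
    "(LINT t|lborel. f t * (c + (LINT s:{0..t}|lborel. f s))) = ((c + integral\<^sup>L lborel f)\<^sup>2 - c\<^sup>2) / 2"
proof -
  have [measurable]: "f \<in> borel_measurable borel" using f by auto
  let ?G = "integral\<^sup>L lborel f"
  have ff: "integrable (lborel \<Otimes>\<^sub>M lborel) (\<lambda>(t, s). f t * f s)"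
    using integrable_separated(1)[OF f f] by (simp add: lborel_prod)
  have lo: "integrable (lborel \<Otimes>\<^sub>M lborel) (\<lambda>(t, s). f t * (indicator {0..} (t - s) * f s))"
    and hi: "integrable (lborel \<Otimes>\<^sub>M lborel) (\<lambda>(t, s). f t * (indicator {0..} (s - t) * f s))"
    by (rule Bochner_Integration.integrable_bound[OF ff]; simp add: case_prod_unfold indicator_def)+
  have e1: "(LINT s:{0..t}|lborel. f s) = (LINT s|lborel. indicator {0..} (t - s) * f s)" for t
    unfolding set_lebesgue_integral_def using f0
    by (intro Bochner_Integration.integral_cong refl) (auto simp: indicator_def)
  have sum: "(LINT s|lborel. indicator {0..} (t - s) * f s) + (LINT s|lborel. indicator {0..} (s - t) * f s) = ?G" for t
  proof -
    have i: "integrable lborel (\<lambda>s. indicator {0..} (t - s) * f s)" "integrable lborel (\<lambda>s. indicator {0..} (s - t) * f s)"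
      by (rule Bochner_Integration.integrable_bound[OF f]; simp add: indicator_def)+
    have "AE s in lborel. s \<noteq> t" using AE_lborel_singleton by auto
    then have "AE s in lborel. indicator {0..} (t - s) * f s + indicator {0..} (s - t) * f s = f s"
      by eventually_elim (auto simp: indicator_def)
    then have "(LINT s|lborel. indicator {0..} (t - s) * f s + indicator {0..} (s - t) * f s) = ?G"
      by (intro integral_cong_AE) measurable
    then show ?thesis using i by (simp add: Bochner_Integration.integral_add)
  qed
  have L: "integrable lborel (\<lambda>t. f t * (LINT s|lborel. indicator {0..} (t - s) * f s))"
    using lborel_pair.integrable_fst'[OF lo] by simp
  have H: "integrable lborel (\<lambda>t. f t * (LINT s|lborel. indicator {0..} (s - t) * f s))"
    using lborel_pair.integrable_fst'[OF hi] by simp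
  have "(LINT t|lborel. f t * (LINT s|lborel. indicator {0..} (t - s) * f s)) =
     (LINT s|lborel. LINT t|lborel. f t * (indicator {0..} (t - s) * f s))"
    using lborel_pair.Fubini_integral[OF lo] by simp
  also have "\<dots> = (LINT t|lborel. f t * (LINT s|lborel. indicator {0..} (s - t) * f s))"
  proof (rule Bochner_Integration.integral_cong[OF refl])
    fix s
    have "(\<lambda>t. f t * (indicator {0..} (t - s) * f s)) = (\<lambda>t. f s * (indicator {0..} (t - s) * f t))" by (auto simp: mult_ac)
    then show "(LINT t|lborel. f t * (indicator {0..} (t - s) * f s)) = f s * (LINT t|lborel. indicator {0..} (t - s) * f t)" by simp
  qed
  finally have LH: "(LINT t|lborel. f t * (LINT s|lborel. indicator {0..} (t - s) * f s)) = 
      (LINT t|lborel. f t * (LINT s|lborel. indicator {0..} (s - t) * f s))" .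
  have "(LINT t|lborel. f t * (LINT s|lborel. indicator {0..} (t - s) * f s)) + (LINT t|lborel. f t * (LINT s|lborel. indicator {0..} (s - t) * f s))
     = (LINT t|lborel. f t * ?G)"
    by (subst Bochner_Integration.integral_add[OF L H, symmetric]) (simp add: distrib_left[symmetric] sum)
  then have half: "(LINT t|lborel. f t * (LINT s|lborel. indicator {0..} (t - s) * f s)) = ?G * ?G / 2"
    using LH by simp
  show "integrable lborel (\<lambda>t. f t * (c + (LINT s:{0..t}|lborel. f s)))"
    unfolding e1 distrib_left using L f by auto
  show "(LINT t|lborel. f t * (c + (LINT s:{0..t}|lborel. f s))) = ((c + ?G)\<^sup>2 - c\<^sup>2) / 2"
    unfolding e1 distrib_left using L f half by (simp add: power2_eq_square field_simps)
qed

text \<open>Carried out at each point of space: for almost every \<open>p\<close>, the section of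
  \<open>E\<close> is at almost every time \<open>E0 p\<close> plus the indefinite integral of
  \<open>G\<close>, so the scalar identity applies. Fubini reassembles the result.\<close>

lemma energy_identity:
  assumes T: "0 < T" and e: "e \<in> L2_time T X" and d: "has_time_deriv T e g"
    and e0: "set_integrable lebesgue Omega (\<lambda>p. (e 0 p)\<^sup>2)" and eT: "set_integrable lebesgue Omega (\<lambda>p. (e T p)\<^sup>2)"
    and e0m: "set_borel_measurable lebesgue Omega (e 0)"
  shows "(LINT t:{0..T}|lebesgue. ip Omega (g t) (e t)) =
    ((LINT p:Omega|lebesgue. (e T p)\<^sup>2) - (LINT p:Omega|lebesgue. (e 0 p)\<^sup>2)) / 2"
proof -
  have g: "g \<in> L2_time T UNIV" using d by (simp add: has_time_deriv_def)
  obtain G where G: "G \<in> borel_measurable borel" "\<And>z. z \<notin> {0..T} \<times> Omega \<Longrightarrow> G z = 0"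
    "integrable lborel (\<lambda>z. (G z)\<^sup>2)" "AE z in lebesgue. z \<in> {0..T} \<times> Omega \<longrightarrow> g (fst z) (snd z) = G z"
    using L2_time_borel[OF g] by blast
  obtain E where E: "E \<in> borel_measurable borel" "\<And>z. z \<notin> {0..T} \<times> Omega \<Longrightarrow> E z = 0"
    "integrable lborel (\<lambda>z. (E z)\<^sup>2)" "AE z in lebesgue. z \<in> {0..T} \<times> Omega \<longrightarrow> e (fst z) (snd z) = E z"
    using L2_time_borel[OF e] by blast
  obtain E0 where E0: "E0 \<in> borel_measurable lborel" "AE p in lborel. indicator Omega p *\<^sub>R e 0 p = E0 p"
    using completion_ex_borel_measurable_real[OF e0m[unfolded set_borel_measurable_def]] by blast
  note [measurable] = G(1) E(1)
  have [measurable]: "E0 \<in> borel_measurable borel" using E0(1) by simp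
  have [measurable]: "Omega \<in> sets borel" unfolding Omega_def by (intro borel_Times) auto
  have [measurable]: "(\<lambda>z :: real \<times> real \<times> real. snd z) \<in> borel_measurable borel"
    by (intro borel_measurable_continuous_onI continuous_intros)
  have Gm [measurable]: "(\<lambda>s. G (s, p)) \<in> borel_measurable borel" for p by measurable
  have Gz: "G (t, p) = 0" if "t \<notin> {0..T} \<or> p \<notin> Omega" for t p
    using that by (intro G(2)) auto
  define \<Gamma> where "\<Gamma> t p = (LINT s:{0..t}|lborel. G (s, p))" for t p
  have Gsec: "AE p in lebesgue. AE s in lebesgue. s \<in> {0..T} \<longrightarrow> p \<in> Omega \<longrightarrow> g s p = G (s, p)"
    using AE_lebesgue_pair(2)[OF G(4)] by eventually_elim (auto elim: eventually_mono)
  have \<Gamma>: "AE p in lebesgue. p \<in> Omega \<longrightarrow> (\<forall>t\<in>{0..T}. (LINT s:{0..t}|lebesgue. g s p) = \<Gamma> t p)"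
    using Gsec
  proof eventually_elim
    case (elim p)
    show ?case
    proof safe
      fix t assume p: "p \<in> Omega" and t: "t \<in> {0..T}"
      have "(LINT s:{0..t}|lebesgue. g s p) = (LINT s:{0..t}|lebesgue. G (s, p))"
        unfolding set_lebesgue_integral_def
      proof (rule integral_lebesgue_cong_AE)
        show "AE s in lebesgue. indicator {0..t} s *\<^sub>R g s p = indicator {0..t} s *\<^sub>R G (s, p)"
          using elim by eventually_elim (use p t in \<open>auto simp: indicator_def\<close>)
      qed
      also have "\<dots> = \<Gamma> t p" unfolding \<Gamma>_def set_lebesgue_integral_def by (intro integral_completion) measurable
      finally show "(LINT s:{0..t}|lebesgue. g s p) = \<Gamma> t p" .
    qed
  qed
  have eqt: "AE p in lebesgue. p \<in> Omega \<longrightarrow> e t p = E0 p + \<Gamma> t p" if t: "t \<in> {0..T}" for t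
  proof -
    have "AE p in lebesgue_on Omega. e t p = e 0 p + (LINT s:{0..t}|lebesgue. g s p)"
      using d t by (simp add: has_time_deriv_def)
    then have "AE p in lebesgue. p \<in> Omega \<longrightarrow> e t p = e 0 p + (LINT s:{0..t}|lebesgue. g s p)"
      by (subst (asm) AE_restrict_space_iff) auto
    then show ?thesis using \<Gamma> AE_completion[OF E0(2)] by eventually_elim (use t in auto)
  qed
  have GE: "integrable (lborel \<Otimes>\<^sub>M lborel) (\<lambda>z. G z * E z)"
    using integrable_mult_L2[of G lborel E] G E by (simp add: lborel_prod)
  have \<Gamma>m [measurable]: "(\<lambda>z. \<Gamma> (fst z) (snd z)) \<in> borel_measurable (lborel \<Otimes>\<^sub>M lborel)"
  proof -
    have e: "\<Gamma> t p = (LINT s|lborel. (indicator {0..} s * indicator {0..} (t - s)) *\<^sub>R G (s, p))" for t p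
      unfolding \<Gamma>_def set_lebesgue_integral_def
      by (intro Bochner_Integration.integral_cong refl) (auto simp: indicator_def)
    show ?thesis unfolding e by measurable
  qed
  have GEt: "AE t in lborel. AE p in lborel. t \<in> {0..T} \<and> p \<in> Omega \<longrightarrow> E (t, p) = E0 p + \<Gamma> t p"
  proof -
    have "AE t in lebesgue. AE p in lebesgue. t \<in> {0..T} \<and> p \<in> Omega \<longrightarrow> E (t, p) = E0 p + \<Gamma> t p"
      using AE_lebesgue_pair(1)[OF E(4)]
    proof eventually_elim
      case (elim t)
      show ?case
      proof (cases "t \<in> {0..T}")
        case True
        show ?thesis using elim eqt[OF True] by eventually_elim auto
      qed (intro AE_I2, auto)
    qed
    then show ?thesis by (simp only: AE_completion_iff)
  qed
  \<comment> \<open>\<open>has_time_deriv\<close> quantifies over times first and then over almost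
    all points. Exchanging the order requires a measurable set, here exhibited as the zero set of
    \<open>?h\<close>.\<close>
  have GEp: "AE p in lborel. AE t in lborel. t \<in> {0..T} \<and> p \<in> Omega \<longrightarrow> E (t, p) = E0 p + \<Gamma> t p"
  proof (subst lborel_pair.AE_commute[symmetric])
    let ?M = "lborel \<Otimes>\<^sub>M (lborel :: (real \<times> real) measure)"
    let ?h = "\<lambda>z. indicator {0..T} (fst z) * (indicator Omega (snd z) * (E z - E0 (snd z) - \<Gamma> (fst z) (snd z)))"
    have [measurable]: "E \<in> borel_measurable ?M" unfolding lborel_prod by simp
    have E0': "(\<lambda>z. E0 (snd z)) \<in> borel_measurable ?M" by measurable
    have "?h \<in> borel_measurable ?M"
      by (intro borel_measurable_times borel_measurable_diff \<Gamma>m E0') measurable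
    then have "?h -` {0} \<inter> space ?M \<in> sets ?M" by (rule measurable_sets) simp
    also have "?h -` {0} \<inter> space ?M = {z \<in> space ?M. fst z \<in> {0..T} \<and> snd z \<in> Omega \<longrightarrow> E (fst z, snd z) = E0 (snd z) + \<Gamma> (fst z) (snd z)}"
      by (auto simp: indicator_def)
    finally show "{z \<in> space ?M. fst z \<in> {0..T} \<and> snd z \<in> Omega \<longrightarrow> E (fst z, snd z) = E0 (snd z) + \<Gamma> (fst z) (snd z)} \<in> sets ?M" .
  qed (rule GEt)
  have G2: "AE p in lborel. integrable lborel (\<lambda>t. (G (t, p))\<^sup>2)"
    using lborel_pair.AE_integrable_snd[of "\<lambda>t p. (G (t, p))\<^sup>2"] G(3) by (simp add: lborel_prod case_prod_unfold)
  have inner: "AE p in lborel. (LINT t|lborel. G (t, p) * E (t, p)) = indicator Omega p *\<^sub>R (((E0 p + \<Gamma> T p)\<^sup>2 - (E0 p)\<^sup>2) / 2)"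
    using GEp G2
  proof eventually_elim
    case (elim p)
    show ?case
    proof (cases "p \<in> Omega")
      case True
      have Gi: "integrable lborel (\<lambda>t. G (t, p))"
      proof -
        have "integrable lborel (\<lambda>t. indicator {0..T} t * G (t, p))"
        proof (rule integrable_mult_L2)
          show "integrable lborel (\<lambda>t. (indicator {0..T} t :: real)\<^sup>2)"
          proof -
            have "(\<lambda>t. (indicator {0..T} t :: real)\<^sup>2) = indicator {0..T}" by (auto simp: indicator_def)
            moreover have "integrable lborel (indicator {0..T} :: real \<Rightarrow> real)"
              by (intro integrable_real_indicator) (use T in auto)
            ultimately show ?thesis by (simp only:)
          qed
        qed (use elim(2) in auto)
        also have "(\<lambda>t. indicator {0..T} t * G (t, p)) = (\<lambda>t. G (t, p))"
        proof
          fix t show "indicator {0..T} t * G (t, p) = G (t, p)"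
            using Gz[of t p] by (cases "t \<in> {0..T}") auto
        qed
        finally show ?thesis .
      qed
      have G0: "G (t, p) = 0" if "t \<notin> {0..T}" for t using Gz that by blast
      have "(LINT t|lborel. G (t, p) * E (t, p)) = (LINT t|lborel. G (t, p) * (E0 p + \<Gamma> t p))"
      proof (rule integral_cong_AE)
        show "AE t in lborel. G (t, p) * E (t, p) = G (t, p) * (E0 p + \<Gamma> t p)"
          using elim(1) by eventually_elim (use True G0 in \<open>metis mult_zero_left\<close>)
        show "(\<lambda>t. G (t, p) * (E0 p + \<Gamma> t p)) \<in> borel_measurable lborel"
        proof -
          have "integrable lborel (\<lambda>t. G (t, p) * (E0 p + \<Gamma> t p))"
            unfolding \<Gamma>_def by (rule integral_triangle(1)[OF Gi]) (rule G0)
          then show ?thesis by (rule borel_measurable_integrable)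
        qed
      qed measurable
      also have "\<dots> = ((E0 p + integral\<^sup>L lborel (\<lambda>t. G (t, p)))\<^sup>2 - (E0 p)\<^sup>2) / 2"
        unfolding \<Gamma>_def by (rule integral_triangle(2)[OF Gi]) (rule G0)
      also have "integral\<^sup>L lborel (\<lambda>t. G (t, p)) = \<Gamma> T p"
        unfolding \<Gamma>_def set_lebesgue_integral_def using G0
        by (intro Bochner_Integration.integral_cong refl) (auto simp: indicator_def)
      finally show ?thesis using True by simp
    next
      case False
      then have "G (t, p) = 0" for t using Gz by blast
      then show ?thesis using False by simp
    qed
  qed
  have ipGE: "AE t in lebesgue. indicator {0..T} t *\<^sub>R ip Omega (g t) (e t) = (LINT p|lborel. G (t, p) * E (t, p))"
    using AE_lebesgue_pair(1)[OF G(4)] AE_lebesgue_pair(1)[OF E(4)]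
  proof eventually_elim
    case (elim t)
    show ?case
    proof (cases "t \<in> {0..T}")
      case True
      have "AE p in lebesgue. indicator Omega p *\<^sub>R (g t p * e t p) = G (t, p) * E (t, p)"
        using elim
      proof eventually_elim
        case (elim p)
        then show ?case using True Gz[of t p] by (cases "p \<in> Omega") auto
      qed
      then have "ip Omega (g t) (e t) = (LINT p|lebesgue. G (t, p) * E (t, p))"
        unfolding ip_def set_lebesgue_integral_def inner_real_def by (rule integral_lebesgue_cong_AE)
      also have "\<dots> = (LINT p|lborel. G (t, p) * E (t, p))"
        by (intro integral_completion) measurable
      finally show ?thesis using True by simp
    next
      case False
      then have "G (t, p) = 0" for p using Gz by blast
      then show ?thesis using False by simp
    qed
  qed
  have "(LINT t:{0..T}|lebesgue. ip Omega (g t) (e t)) = (LINT t|lebesgue. LINT p|lborel. G (t, p) * E (t, p))"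
    unfolding set_lebesgue_integral_def by (rule integral_lebesgue_cong_AE[OF ipGE])
  also have "\<dots> = (LINT t|lborel. LINT p|lborel. G (t, p) * E (t, p))"
    using lborel_pair.integrable_fst'[OF GE] by (intro integral_completion) auto
  also have "\<dots> = (LINT p|lborel. LINT t|lborel. G (t, p) * E (t, p))"
    using lborel_pair.Fubini_integral[of "\<lambda>t p. G (t, p) * E (t, p)"] GE by (simp add: case_prod_unfold)
  also have "\<dots> = (LINT p|lebesgue. LINT t|lborel. G (t, p) * E (t, p))"
    using lborel_pair.integrable_snd[of "\<lambda>t p. G (t, p) * E (t, p)"] GE
    by (intro integral_completion[symmetric]) (auto simp: case_prod_unfold)
  also have "\<dots> = (LINT p|lebesgue. ((indicator Omega p *\<^sub>R (e T p)\<^sup>2) - (indicator Omega p *\<^sub>R (e 0 p)\<^sup>2)) / 2)"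
  proof (rule integral_lebesgue_cong_AE)
    \<comment> \<open>\<open>eqt\<close> holds at every single time, so it may be used at
      \<open>T\<close> itself, although \<open>E\<close> represents \<open>e\<close> only for almost
      every time.\<close>
    have "T \<in> {0..T}" using T by simp
    from AE_completion[OF inner] eqt[OF this] AE_completion[OF E0(2)]
    show "AE p in lebesgue. (LINT t|lborel. G (t, p) * E (t, p)) = ((indicator Omega p *\<^sub>R (e T p)\<^sup>2) - (indicator Omega p *\<^sub>R (e 0 p)\<^sup>2)) / 2"
      by eventually_elim (auto simp: indicator_def)
  qed
  also have "\<dots> = ((LINT p:Omega|lebesgue. (e T p)\<^sup>2) - (LINT p:Omega|lebesgue. (e 0 p)\<^sup>2)) / 2"
    using e0 eT unfolding set_integrable_def set_lebesgue_integral_def by simp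
  finally show ?thesis .
qed

section \<open>Coefficients as square integrable functions of time\<close>

definition sq_int :: "real \<Rightarrow> (real \<Rightarrow> real) \<Rightarrow> bool" where
  "sq_int T c \<longleftrightarrow> (\<lambda>t. indicator {0..T} t * c t) \<in> borel_measurable lebesgue \<and>
     integrable lebesgue (\<lambda>t. (indicator {0..T} t * c t)\<^sup>2)"

lemma sq_int_mult_integrable:
  assumes "sq_int T c" "sq_int T d"
  shows "set_integrable lebesgue {0..T} (\<lambda>t. c t * d t)"
proof -
  have "integrable lebesgue (\<lambda>t. (indicator {0..T} t * c t) * (indicator {0..T} t * d t))"
    using assms unfolding sq_int_def by (intro integrable_mult_L2) auto
  also have "(\<lambda>t. (indicator {0..T} t * c t) * (indicator {0..T} t * d t)) = (\<lambda>t. indicator {0..T} t *\<^sub>R (c t * d t))"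
    by (auto simp: indicator_def)
  finally show ?thesis by (simp add: set_integrable_def)
qed

lemma sq_int_zero: "sq_int T (\<lambda>_. 0)"
  by (simp add: sq_int_def)

lemma sq_int_one: "sq_int T (\<lambda>_. 1)"
proof -
  have "(\<lambda>t. (indicator {0..T} t * 1 :: real)\<^sup>2) = indicator {0..T}" by (auto simp: indicator_def)
  moreover have "integrable lebesgue (indicator {0..T} :: real \<Rightarrow> real)"
  proof (intro integrable_real_indicator)
    show "emeasure lebesgue {0..T} < \<infinity>" by (cases "0 \<le> T") auto
  qed auto
  ultimately show ?thesis by (simp add: sq_int_def)
qed

lemma sq_int_cmult: "sq_int T c \<Longrightarrow> sq_int T (\<lambda>t. r * c t)"
  using borel_measurable_times[OF borel_measurable_const[of r lebesgue], of "\<lambda>t. indicator {0..T} t * c t"]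
  by (simp add: sq_int_def power_mult_distrib mult.left_commute)

lemma sq_int_add:
  assumes "sq_int T c" "sq_int T d" shows "sq_int T (\<lambda>t. c t + d t)"
proof -
  have "integrable lebesgue (\<lambda>t. (indicator {0..T} t * c t) * (indicator {0..T} t * d t))"
    using assms unfolding sq_int_def by (intro integrable_mult_L2) auto
  then show ?thesis using assms unfolding sq_int_def distrib_left power2_sum mult.assoc[of 2] by auto
qed

lemma sq_int_sum: "(\<And>i. i \<in> J \<Longrightarrow> sq_int T (c i)) \<Longrightarrow> sq_int T (\<lambda>t. \<Sum>i\<in>J. c i t)"
  by (induction J rule: infinite_finite_induct) (auto intro: sq_int_zero sq_int_add)

lemma sq_int_diff: "sq_int T c \<Longrightarrow> sq_int T d \<Longrightarrow> sq_int T (\<lambda>t. c t - d t)"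
  using sq_int_add[of T c "\<lambda>t. -1 * d t"] sq_int_cmult[of T d "-1"] by simp

text \<open>By Fubini, evaluation at almost every fixed point of space yields a square integrable
  function of time. Sampling at finitely many such points thus preserves square
  integrability.\<close>

lemma sq_int_section:
  assumes "w \<in> L2_time T X"
  shows "AE p in lebesgue. p \<in> Omega \<longrightarrow> sq_int T (\<lambda>t. w t p)"
proof -
  obtain W where W: "W \<in> borel_measurable borel" "\<And>z. z \<notin> {0..T} \<times> Omega \<Longrightarrow> W z = 0"
    "integrable lborel (\<lambda>z. (W z)\<^sup>2)" "AE z in lebesgue. z \<in> {0..T} \<times> Omega \<longrightarrow> w (fst z) (snd z) = W z"
    using L2_time_borel[OF assms] by blast
  note [measurable] = W(1)
  have "AE p in lborel. integrable lborel (\<lambda>t. (W (t, p))\<^sup>2)"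
    using lborel_pair.AE_integrable_snd[of "\<lambda>t p. (W (t, p))\<^sup>2"] W(3) by (simp add: lborel_prod case_prod_unfold)
  from AE_completion[OF this] AE_lebesgue_pair(2)[OF W(4)] show ?thesis
  proof eventually_elim
    case (elim p)
    show ?case
    proof
      assume p: "p \<in> Omega"
      have m: "(\<lambda>t. W (t, p)) \<in> borel_measurable lborel" by measurable
      have ae: "AE t in lebesgue. W (t, p) = indicator {0..T} t * w t p"
        using elim(2)
      proof eventually_elim
        case (elim t)
        then show ?case using W(2)[of "(t, p)"] p by (cases "t \<in> {0..T}") auto
      qed
      then have ae2: "AE t in lebesgue. (W (t, p))\<^sup>2 = (indicator {0..T} t * w t p)\<^sup>2" by eventually_elim simp
      have "(\<lambda>t. indicator {0..T} t * w t p) \<in> borel_measurable lebesgue"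
        by (rule borel_measurable_lebesgue_cong_AE[OF measurable_completion[OF m] ae])
      moreover have "integrable lebesgue (\<lambda>t. (indicator {0..T} t * w t p)\<^sup>2)"
        by (rule integrable_lebesgue_cong_AE[OF _ ae2]) (use elim(1) in \<open>subst integrable_completion, auto\<close>)
      ultimately show "sq_int T (\<lambda>t. w t p)" by (simp add: sq_int_def)
    qed
  qed
qed

text \<open>A set of full measure in a nondegenerate interval is infinite, so any number of sample
  points can be taken from it.\<close>

lemma finite_subset_AE_interval:
  fixes a b :: real
  assumes "AE x in lborel. P x" "a < b"
  shows "\<exists>X. finite X \<and> card X = n \<and> X \<subseteq> {a<..<b} \<and> (\<forall>x\<in>X. P x)"
proof -
  have "infinite {x \<in> {a<..<b}. P x}"
  proof
    assume fin: "finite {x \<in> {a<..<b}. P x}"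
    have "AE x in lborel. x \<notin> {x \<in> {a<..<b}. P x}"
      using fin by (intro AE_not_in finite_imp_null_set_lborel)
    with assms(1) have "AE x in lborel. x \<notin> {a<..<b}" by eventually_elim auto
    then have "emeasure lborel {a<..<b} = 0"
      by (subst (asm) AE_iff_null_sets[symmetric]) (auto simp: null_sets_def)
    then show False using assms(2) by simp
  qed
  then obtain X where "finite X" "card X = n" "X \<subseteq> {x \<in> {a<..<b}. P x}"
    using infinite_arbitrarily_large by blast
  then show ?thesis by (intro exI[of _ X]) auto
qed

text \<open>The inverse of the Vandermonde matrix, read off from the Lagrange polynomials. The
  weights depend on the sample points only, so the coefficients inherit measurability and square
  integrability from the samples.\<close>

lemma interpolation_coefficients:
  fixes X :: "real set"
  assumes fin: "finite X" and card: "card X = k + 1"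
  shows "\<exists>L :: nat \<Rightarrow> real \<Rightarrow> real. \<forall>c m. m \<le> k \<longrightarrow> (\<Sum>x\<in>X. L m x * (\<Sum>l\<le>k. c l * x ^ l)) = c m"
proof -
  define lag where "lag x = (\<Prod>z\<in>X - {x}. smult (1 / (x - z)) [:- z, 1:])" for x :: real
  have lag: "poly (lag x) y = (if y = x then 1 else 0)" if "x \<in> X" "y \<in> X" for x y
  proof (cases "y = x")
    case True
    have "poly (smult (1 / (x - z)) [:- z, 1:]) x = 1" if "z \<noteq> x" for z
      using that by (simp add: diff_divide_distrib[symmetric])
    then show ?thesis unfolding True lag_def poly_prod by (simp add: prod.neutral)
  next
    case False
    then have "y \<in> X - {x}" using that by simp
    then show ?thesis using False fin by (auto simp: lag_def poly_prod intro!: prod_zero bexI[of _ y])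
  qed
  have deg: "degree (lag x) \<le> k" if "x \<in> X" for x
  proof -
    have "degree (lag x) \<le> (\<Sum>z\<in>X - {x}. degree (smult (1 / (x - z)) [:- z, 1:]))"
      using degree_prod_sum_le[of "X - {x}" "\<lambda>z. smult (1 / (x - z)) [:- z, 1:]"] fin by (simp add: lag_def o_def)
    also have "\<dots> \<le> (\<Sum>z\<in>X - {x}. 1)" by (intro sum_mono) auto
    also have "\<dots> = k" using that card fin by simp
    finally show ?thesis .
  qed
  have "(\<Sum>x\<in>X. poly.coeff (lag x) m * (\<Sum>l\<le>k. c l * x ^ l)) = c m" if "m \<le> k" for c m
  proof -
    define p where "p = (\<Sum>l\<le>k. monom (c l) l)"
    define q where "q = (\<Sum>x\<in>X. smult (poly p x) (lag x))"
    have pp: "poly p x = (\<Sum>l\<le>k. c l * x ^ l)" for x by (simp add: p_def poly_sum poly_monom)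
    have "p = q"
    proof (rule poly_eqI_degree[of X])
      fix y assume y: "y \<in> X"
      have "poly q y = (\<Sum>x\<in>X. if x = y then poly p x else 0)"
        unfolding q_def poly_sum by (intro sum.cong) (auto simp: lag y)
      then show "poly p y = poly q y" using y fin by simp
    next
      have "degree p \<le> k" unfolding p_def by (intro degree_sum_le) (auto intro: order_trans[OF degree_monom_le])
      then show "degree p < card X" using card by simp
      have "degree q \<le> k" unfolding q_def using fin deg
        by (intro degree_sum_le) (auto intro: order_trans[OF degree_smult_le])
      then show "degree q < card X" using card by simp
    qed
    moreover have "poly.coeff q m = (\<Sum>x\<in>X. poly p x * poly.coeff (lag x) m)" by (simp add: q_def coeff_sum)
    ultimately have "poly.coeff p m = (\<Sum>x\<in>X. poly p x * poly.coeff (lag x) m)" by (rule ssubst)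
    moreover have "poly.coeff p m = c m" using that by (simp add: p_def coeff_sum)
    ultimately show ?thesis by (simp add: pp mult.commute)
  qed
  then show ?thesis by (intro exI[of _ "\<lambda>m x. poly.coeff (lag x) m"]) simp
qed

text \<open>
  By Fubini almost every point has a square integrable time section, so the coefficients are
  linear combinations of point values on a tensor grid of such points.
\<close>

lemma cell_coefficients:
  fixes a b c d :: real
  assumes w: "w \<in> L2_time T X" and sub: "{a<..<b} \<times> {c<..<d} \<subseteq> Omega" and ab: "a < b" and cd: "c < d"
    and poly: "AE t in lebesgue. t \<in> {0..T} \<longrightarrow> (\<exists>D. \<forall>x\<in>{a<..<b}. \<forall>y\<in>{c<..<d}. w t (x, y) = (\<Sum>m\<le>k. \<Sum>n\<le>k. D m n * x ^ m * y ^ n))"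
  shows "\<exists>C. (\<forall>m n. sq_int T (C m n)) \<and> (AE t in lebesgue. t \<in> {0..T} \<longrightarrow>
     (\<forall>x\<in>{a<..<b}. \<forall>y\<in>{c<..<d}. w t (x, y) = (\<Sum>m\<le>k. \<Sum>n\<le>k. C m n t * x ^ m * y ^ n)))"
proof -
  let ?P = "\<lambda>p. p \<in> Omega \<longrightarrow> sq_int T (\<lambda>t. w t p)"
  have "AE p in lborel \<Otimes>\<^sub>M lborel. ?P p"
    using sq_int_section[OF w] unfolding AE_completion_iff lborel_prod .
  then have aex: "AE x in lborel. AE y in lborel. ?P (x, y)" by (rule lborel_pair.AE_pair)
  \<comment> \<open>First fix the columns, each good for almost every \<open>y\<close>. Finitely
    many null sets can then be avoided at once when choosing the rows, so every point of the tensor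
    grid is good.\<close>
  obtain X where X: "finite X" "card X = k + 1" "X \<subseteq> {a<..<b}" "\<And>x. x \<in> X \<Longrightarrow> AE y in lborel. ?P (x, y)"
    using finite_subset_AE_interval[OF aex ab, of "k + 1"] by blast
  have aey: "AE y in lborel. \<forall>x\<in>X. ?P (x, y)" using X by (intro AE_finite_allI)
  obtain Y where Y: "finite Y" "card Y = k + 1" "Y \<subseteq> {c<..<d}" "\<And>y. y \<in> Y \<Longrightarrow> \<forall>x\<in>X. ?P (x, y)"
    using finite_subset_AE_interval[OF aey cd, of "k + 1"] by blast
  obtain L where L: "\<And>c m. m \<le> k \<Longrightarrow> (\<Sum>x\<in>X. L m x * (\<Sum>l\<le>k. c l * x ^ l)) = c m"
    using interpolation_coefficients[OF X(1,2)] by blast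
  obtain L' where L': "\<And>c m. m \<le> k \<Longrightarrow> (\<Sum>x\<in>Y. L' m x * (\<Sum>l\<le>k. c l * x ^ l)) = c m"
    using interpolation_coefficients[OF Y(1,2)] by blast
  \<comment> \<open>Both interpolation functionals are applied to the samples. Since
    \<open>C\<close> is given by this formula at every time, no measurable selection among the
    unknown coefficients \<open>D\<close> is required; they are identified with \<open>C\<close>
    afterwards, time by time.\<close>
  define C where "C m n t = (\<Sum>x\<in>X. \<Sum>y\<in>Y. (L m x * L' n y) * w t (x, y))" for m n t
  have "sq_int T (C m n)" for m n
    unfolding C_def using X Y sub by (intro sq_int_sum sq_int_cmult) blast
  moreover have "AE t in lebesgue. t \<in> {0..T} \<longrightarrow>
     (\<forall>x\<in>{a<..<b}. \<forall>y\<in>{c<..<d}. w t (x, y) = (\<Sum>m\<le>k. \<Sum>n\<le>k. C m n t * x ^ m * y ^ n))"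
    using poly
  proof eventually_elim
    case (elim t)
    show ?case
    proof
      assume "t \<in> {0..T}"
      then obtain D where D: "\<And>x y. x \<in> {a<..<b} \<Longrightarrow> y \<in> {c<..<d} \<Longrightarrow> w t (x, y) = (\<Sum>m\<le>k. \<Sum>n\<le>k. D m n * x ^ m * y ^ n)"
        using elim by blast
      have "C m n t = D m n" if mn: "m \<le> k" "n \<le> k" for m n
      proof -
        have "C m n t = (\<Sum>x\<in>X. L m x * (\<Sum>y\<in>Y. L' n y * (\<Sum>n'\<le>k. (\<Sum>m'\<le>k. D m' n' * x ^ m') * y ^ n')))"
          unfolding C_def
        proof (rule sum.cong[OF refl])
          fix x assume x: "x \<in> X"
          have "w t (x, y) = (\<Sum>n'\<le>k. (\<Sum>m'\<le>k. D m' n' * x ^ m') * y ^ n')" if "y \<in> Y" for y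
          proof -
            have "x \<in> {a<..<b}" "y \<in> {c<..<d}" using x that X Y by auto
            then have "w t (x, y) = (\<Sum>m\<le>k. \<Sum>n\<le>k. D m n * x ^ m * y ^ n)" by (rule D)
            also have "\<dots> = (\<Sum>n\<le>k. \<Sum>m\<le>k. D m n * x ^ m * y ^ n)" by (rule sum.swap)
            finally show ?thesis by (simp add: sum_distrib_right)
          qed
          then show "(\<Sum>y\<in>Y. L m x * L' n y * w t (x, y)) = L m x * (\<Sum>y\<in>Y. L' n y * (\<Sum>n'\<le>k. (\<Sum>m'\<le>k. D m' n' * x ^ m') * y ^ n'))"
            unfolding sum_distrib_left[of "L m x"] by (intro sum.cong) (simp_all add: mult.assoc)
        qed
        also have "\<dots> = D m n" unfolding L'[OF mn(2)] by (rule L[OF mn(1)])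
        finally show ?thesis .
      qed
      then show "\<forall>x\<in>{a<..<b}. \<forall>y\<in>{c<..<d}. w t (x, y) = (\<Sum>m\<le>k. \<Sum>n\<le>k. C m n t * x ^ m * y ^ n)"
        using D by simp
    qed
  qed
  ultimately show ?thesis by blast
qed

lemma sum_idx1_delta:
  assumes "i < M"
  shows "(\<Sum>\<kappa>\<in>idx1 M k. if fst \<kappa> = i then F \<kappa> else 0) = (\<Sum>m\<le>k. F (i, m))"
proof -
  have "(\<Sum>\<kappa>\<in>idx1 M k. if fst \<kappa> = i then F \<kappa> else 0) = (\<Sum>l<M. \<Sum>m\<le>k. if l = i then F (l, m) else 0)"
    unfolding idx1_def sum.cartesian_product by (intro sum.cong) auto
  also have "\<dots> = (\<Sum>l<M. if l = i then (\<Sum>m\<le>k. F (l, m)) else 0)"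
    by (intro sum.cong) auto
  also have "\<dots> = (\<Sum>m\<le>k. F (i, m))" using assms by simp
  finally show ?thesis .
qed

lemma rep_of_cells:
  assumes g: "grid M g"
    and w: "\<And>i j x y. i < M \<Longrightarrow> j < M \<Longrightarrow> (x, y) \<in> cell g i j \<Longrightarrow> w (x, y) = (\<Sum>m\<le>k. \<Sum>n\<le>k. C i j m n * x ^ m * y ^ n)"
  shows "rep k M g (\<lambda>a. C (fst (fst a)) (fst (snd a)) (snd (fst a)) (snd (snd a))) w"
  unfolding rep_def
proof (intro ballI)
  fix x y assume x: "x \<in> {0<..<1} - g ` {..M}" and y: "y \<in> {0<..<1} - g ` {..M}"
  have "x \<in> {0..1}" "x \<notin> g ` {1..<M}" "y \<in> {0..1}" "y \<notin> g ` {1..<M}" using x y by auto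
  note r = this
  obtain i where i: "i < M" "g i < x \<or> x = 0 \<and> g i = 0" "x < g (i + 1) \<or> x = 1 \<and> g (i + 1) = 1"
    using grid_locate[OF g r(1,2)] .
  obtain j where "j < M" "g j < y \<or> y = 0 \<and> g j = 0" "y < g (j + 1) \<or> y = 1 \<and> g (j + 1) = 1"
    using grid_locate[OF g r(3,4)] .
  note i this
  then have i: "i < M" "g i < x" "x < g (i + 1)" and j: "j < M" "g j < y" "y < g (j + 1)" using x y by auto
  have "(\<Sum>a\<in>idx2 M k. C (fst (fst a)) (fst (snd a)) (snd (fst a)) (snd (snd a)) * (basis g (fst a) x * basis g (snd a) y)) =
    (\<Sum>\<kappa>\<in>idx1 M k. \<Sum>\<mu>\<in>idx1 M k. C (fst \<kappa>) (fst \<mu>) (snd \<kappa>) (snd \<mu>) * (basis g \<kappa> x * basis g \<mu> y))"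
    by (simp add: sum_idx2)
  also have "\<dots> = (\<Sum>\<kappa>\<in>idx1 M k. if fst \<kappa> = i then (\<Sum>\<mu>\<in>idx1 M k. if fst \<mu> = j then C i j (snd \<kappa>) (snd \<mu>) * (x ^ snd \<kappa> * y ^ snd \<mu>) else 0) else 0)"
    using basis_in_cell(1)[OF g i(1) _ i(2,3)] basis_in_cell(1)[OF g j(1) _ j(2,3)]
    by (intro sum.cong refl) (auto intro!: sum.cong)
  also have "\<dots> = (\<Sum>m\<le>k. \<Sum>n\<le>k. C i j m n * (x ^ m * y ^ n))"
    by (simp only: sum_idx1_delta[OF i(1)] sum_idx1_delta[OF j(1)] fst_conv snd_conv)
  also have "\<dots> = w (x, y)" using w[OF i(1) j(1), of x y] i j by (simp add: cell_iff mult.assoc)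
  finally show "w (x, y) = (\<Sum>a\<in>idx2 M k. C (fst (fst a)) (fst (snd a)) (snd (fst a)) (snd (snd a)) * (basis g (fst a) x * basis g (snd a) y))" ..
qed

text \<open>Total degree at most \<open>k\<close> is padded with zero coefficients to degree at most
  \<open>k\<close> in each variable, an index set that factors into one-dimensional ones.\<close>

lemma broken_poly_cell:
  assumes "w \<in> broken_poly k M g" "i < M" "j < M"
  shows "\<exists>D. \<forall>x\<in>{g i<..<g (i + 1)}. \<forall>y\<in>{g j<..<g (j + 1)}. w (x, y) = (\<Sum>m\<le>k. \<Sum>n\<le>k. D m n * x ^ m * y ^ n)"
proof -
  obtain c where c: "\<forall>(x, y)\<in>cell g i j. w (x, y) = (\<Sum>m\<le>k. \<Sum>n\<le>k - m. c m n * x ^ m * y ^ n)"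
    using assms unfolding broken_poly_def by blast
  have e: "(\<Sum>n\<le>k - m. c m n * x ^ m * y ^ n) = (\<Sum>n\<le>k. (if n \<le> k - m then c m n else 0) * x ^ m * y ^ n)" for m :: nat and x y :: real
    by (rule sum.mono_neutral_cong_left) auto
  show ?thesis
    by (rule exI[of _ "\<lambda>m n. if n \<le> k - m then c m n else 0"]) (use c in \<open>auto simp: cell_def e\<close>)
qed

text \<open>The version at a single time, for the times 0 and \<open>T\<close> in the energy:
  expansions valid for almost every time say nothing there.\<close>

lemma rep_exists:
  assumes "grid M g" "w \<in> broken_poly k M g"
  shows "\<exists>c. rep k M g c w"
proof -
  define D where "D i j = (SOME D. \<forall>x\<in>{g i<..<g (i + 1)}. \<forall>y\<in>{g j<..<g (j + 1)}.
     w (x, y) = (\<Sum>m\<le>k. \<Sum>n\<le>k. D m n * x ^ m * y ^ n))" for i j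
  have "\<forall>x\<in>{g i<..<g (i + 1)}. \<forall>y\<in>{g j<..<g (j + 1)}. w (x, y) = (\<Sum>m\<le>k. \<Sum>n\<le>k. D i j m n * x ^ m * y ^ n)"
    if "i < M" "j < M" for i j
    unfolding D_def by (rule someI_ex[OF broken_poly_cell[OF assms(2) that]])
  then have "rep k M g (\<lambda>a. D (fst (fst a)) (fst (snd a)) (snd (fst a)) (snd (snd a))) w"
    by (intro rep_of_cells[OF assms(1)]) (simp add: cell_def)
  then show ?thesis by blast
qed

definition coeff_rep :: "real \<Rightarrow> nat \<Rightarrow> nat \<Rightarrow> (nat \<Rightarrow> real) \<Rightarrow> ((nat \<times> nat) \<times> (nat \<times> nat) \<Rightarrow> real \<Rightarrow> real) \<Rightarrow>
    (real \<Rightarrow> scalar_field) \<Rightarrow> bool" where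
  "coeff_rep T k M g c w \<longleftrightarrow> (\<forall>a. sq_int T (c a)) \<and>
     (AE t in lebesgue. t \<in> {0..T} \<longrightarrow> rep k M g (\<lambda>a. c a t) (w t))"

lemma L2_time_coefficients:
  assumes g: "grid M g" and w: "w \<in> L2_time T (broken_poly k M g)"
  shows "\<exists>c. coeff_rep T k M g c w"
proof -
  have bp: "AE t in lebesgue. t \<in> {0..T} \<longrightarrow> w t \<in> broken_poly k M g"
    using w unfolding L2_time_def by (auto simp: AE_restrict_space_iff)
  \<comment> \<open>For indices outside the mesh only square integrability is asked, which zero
    satisfies. One choice of coefficients thus serves all indices.\<close>
  define Q where "Q i j C \<longleftrightarrow> (\<forall>m n. sq_int T (C m n)) \<and> (i < M \<longrightarrow> j < M \<longrightarrow> (AE t in lebesgue. t \<in> {0..T} \<longrightarrow>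
     (\<forall>x\<in>{g i<..<g (i + 1)}. \<forall>y\<in>{g j<..<g (j + 1)}. w t (x, y) = (\<Sum>m\<le>k. \<Sum>n\<le>k. C m n t * x ^ m * y ^ n))))" for i j and C :: "nat \<Rightarrow> nat \<Rightarrow> real \<Rightarrow> real"
  have exQ: "\<exists>C. Q i j C" for i j
  proof (cases "i < M \<and> j < M")
    case True
    then have b: "0 \<le> g i" "g (i + 1) \<le> 1" "0 \<le> g j" "g (j + 1) \<le> 1" "g i < g (i + 1)" "g j < g (j + 1)"
      using grid_bounds[OF g] g by (auto simp: grid_def)
    have "\<exists>C. (\<forall>m n. sq_int T (C m n)) \<and> (AE t in lebesgue. t \<in> {0..T} \<longrightarrow>
     (\<forall>x\<in>{g i<..<g (i + 1)}. \<forall>y\<in>{g j<..<g (j + 1)}. w t (x, y) = (\<Sum>m\<le>k. \<Sum>n\<le>k. C m n t * x ^ m * y ^ n)))"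
    proof (rule cell_coefficients[OF w _ b(5,6)])
      show "{g i<..<g (i + 1)} \<times> {g j<..<g (j + 1)} \<subseteq> Omega" using b by (auto simp: Omega_def)
      show "AE t in lebesgue. t \<in> {0..T} \<longrightarrow> (\<exists>D. \<forall>x\<in>{g i<..<g (i + 1)}. \<forall>y\<in>{g j<..<g (j + 1)}.
          w t (x, y) = (\<Sum>m\<le>k. \<Sum>n\<le>k. D m n * x ^ m * y ^ n))"
        using bp by eventually_elim (use broken_poly_cell True in blast)
    qed
    then show ?thesis unfolding Q_def by blast
  next
    case False
    then show ?thesis unfolding Q_def using sq_int_zero by (intro exI[of _ "\<lambda>_ _ _. 0"]) auto
  qed
  define C where "C i j = (SOME C. Q i j C)" for i j
  have "Q i j (C i j)" for i j unfolding C_def by (rule someI_ex[OF exQ])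
  then have C: "\<And>i j m n. sq_int T (C i j m n)" "\<And>i j. i < M \<Longrightarrow> j < M \<Longrightarrow> AE t in lebesgue. t \<in> {0..T} \<longrightarrow>
     (\<forall>x\<in>{g i<..<g (i + 1)}. \<forall>y\<in>{g j<..<g (j + 1)}. w t (x, y) = (\<Sum>m\<le>k. \<Sum>n\<le>k. C i j m n t * x ^ m * y ^ n))"
    unfolding Q_def by blast+
  have "AE t in lebesgue. \<forall>i\<in>{..<M}. \<forall>j\<in>{..<M}. t \<in> {0..T} \<longrightarrow>
     (\<forall>x\<in>{g i<..<g (i + 1)}. \<forall>y\<in>{g j<..<g (j + 1)}. w t (x, y) = (\<Sum>m\<le>k. \<Sum>n\<le>k. C i j m n t * x ^ m * y ^ n))"
    using C(2) by (intro AE_finite_allI) auto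
  then have "AE t in lebesgue. t \<in> {0..T} \<longrightarrow> rep k M g (\<lambda>a. C (fst (fst a)) (fst (snd a)) (snd (fst a)) (snd (snd a)) t) (w t)"
  proof eventually_elim
    case (elim t)
    show ?case
    proof
      assume "t \<in> {0..T}"
      then show "rep k M g (\<lambda>a. C (fst (fst a)) (fst (snd a)) (snd (fst a)) (snd (snd a)) t) (w t)"
        using elim by (intro rep_of_cells[OF g]) (auto simp: cell_def)
    qed
  qed
  with C(1) show ?thesis unfolding coeff_rep_def by (intro exI[of _ "\<lambda>a. C (fst (fst a)) (fst (snd a)) (snd (fst a)) (snd (snd a))"]) blast
qed

section \<open>Differences and cutoffs of discrete functions\<close>

lemma rep_diff:
  assumes "rep k M g c w" "rep k M g d v"
  shows "rep k M g (\<lambda>a. c a - d a) (\<lambda>p. w p - v p)"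
  using assms by (simp add: rep_def left_diff_distrib sum_subtractf)

lemma coeff_rep_diff:
  assumes "coeff_rep T k M g c w" "coeff_rep T k M g d v"
  shows "coeff_rep T k M g (\<lambda>a t. c a t - d a t) (\<lambda>t p. w t p - v t p)"
proof -
  have "AE t in lebesgue. t \<in> {0..T} \<longrightarrow> rep k M g (\<lambda>a. c a t) (w t)"
    "AE t in lebesgue. t \<in> {0..T} \<longrightarrow> rep k M g (\<lambda>a. d a t) (v t)"
    using assms by (auto simp: coeff_rep_def)
  then have "AE t in lebesgue. t \<in> {0..T} \<longrightarrow> rep k M g (\<lambda>a. c a t - d a t) (\<lambda>p. w t p - v t p)"
    by eventually_elim (auto intro: rep_diff)
  then show ?thesis using assms unfolding coeff_rep_def by (blast intro: sq_int_diff)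
qed

lemma rep_restrict:
  assumes g: "grid M g" and w: "rep k M g c w" and ij: "i < M" "j < M"
  shows "rep k M g (on_cell i j c) (\<lambda>p. if p \<in> cell g i j then w p else 0)"
  unfolding rep_def
proof (intro ballI)
  fix x y assume x: "x \<in> {0<..<1} - g ` {..M}" and y: "y \<in> {0<..<1} - g ` {..M}"
  show "(if (x, y) \<in> cell g i j then w (x, y) else 0) = (\<Sum>a\<in>idx2 M k. on_cell i j c a * (basis g (fst a) x * basis g (snd a) y))"
  proof (cases "(x, y) \<in> cell g i j")
    case True
    then have x: "g i < x" "x < g (i + 1)" and y: "g j < y" "y < g (j + 1)" by (auto simp: cell_iff)
    have "w (x, y) = cpoly (idx2 M k) (on_cell i j c) x y" by (rule rep_cell[OF w g ij True])
    also have "\<dots> = (\<Sum>a\<in>idx2 M k. on_cell i j c a * (basis g (fst a) x * basis g (snd a) y))"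
      unfolding cpoly_def
    proof (rule sum.cong[OF refl])
      fix a assume "a \<in> idx2 M k"
      then have "fst a \<in> idx1 M k" "snd a \<in> idx1 M k" by (auto simp: idx2_def)
      then show "on_cell i j c a * (x ^ snd (fst a) * y ^ snd (snd a)) = on_cell i j c a * (basis g (fst a) x * basis g (snd a) y)"
        using basis_in_cell(1)[OF g ij(1) _ x] basis_in_cell(1)[OF g ij(2) _ y] by (auto simp: on_cell_def)
    qed
    finally show ?thesis using True by simp
  next
    case False
    then have "(\<Sum>a\<in>idx2 M k. on_cell i j c a * (basis g (fst a) x * basis g (snd a) y)) = 0"
      by (intro sum.neutral) (auto simp: on_cell_def basis_def cell_iff)
    then show ?thesis using False by simp
  qed
qed

lemma rep_square_integrable:
  assumes g: "grid M g" and w: "rep k M g c w"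
  shows "set_integrable lebesgue Omega (\<lambda>p. (w p)\<^sup>2)" "set_borel_measurable lebesgue Omega w"
proof -
  have eq: "indicator Omega (x, y) * w (x, y) = (\<Sum>a\<in>idx2 M k. c a * (basis g (fst a) x * basis g (snd a) y))"
    if "x \<notin> g ` {..M}" "y \<notin> g ` {..M}" for x y
  proof (cases "(x, y) \<in> Omega")
    case True
    then show ?thesis using w that by (auto simp: rep_def Omega_def)
  next
    case False
    then have "x \<le> 0 \<or> 1 \<le> x \<or> y \<le> 0 \<or> 1 \<le> y" by (auto simp: Omega_def)
    then have "(\<Sum>a\<in>idx2 M k. c a * (basis g (fst a) x * basis g (snd a) y)) = 0"
      using basis_outside[OF g] by (intro sum.neutral) (auto simp: idx2_def)
    then show ?thesis using False by simp
  qed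
  have eq2: "indicator Omega (x, y) * (w (x, y))\<^sup>2 = (\<Sum>a\<in>idx2 M k. c a * (basis g (fst a) x * basis g (snd a) y)) *
      (\<Sum>a\<in>idx2 M k. c a * (basis g (fst a) x * basis g (snd a) y))" if "x \<notin> g ` {..M}" "y \<notin> g ` {..M}" for x y
    unfolding eq[OF that, symmetric] by (simp add: power2_eq_square indicator_def)
  show "set_integrable lebesgue Omega (\<lambda>p. (w p)\<^sup>2)"
    by (rule bilin_separated(1)[OF finite_imageI[OF finite_atMost] integrable_basis_basis integrable_basis_basis])
       (rule eq2, assumption, assumption)
  let ?S = "\<lambda>p. \<Sum>a\<in>idx2 M k. c a * (basis g (fst a) (fst p) * basis g (snd a) (snd p))"
  have "?S \<in> borel_measurable (lborel \<Otimes>\<^sub>M lborel)" by measurable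
  then have "?S \<in> borel_measurable lborel" by (simp only: lborel_prod)
  then have "?S \<in> borel_measurable lebesgue" by (rule measurable_completion)
  then show "set_borel_measurable lebesgue Omega w"
    unfolding set_borel_measurable_def
  proof (rule borel_measurable_lebesgue_cong_AE)
    have "finite (g ` {..M})" by simp
    from AE_completion[OF AE_lborel_pair_notin_finite[OF this]]
    show "AE p in lebesgue. ?S p = indicator Omega p *\<^sub>R w p"
    proof eventually_elim
      case (elim p)
      then show ?case using eq[of "fst p" "snd p"] by simp
    qed
  qed
qed

lemma L2_time_mono: "w \<in> L2_time T X \<Longrightarrow> w \<in> L2_time T UNIV"
  by (simp add: L2_time_def)

lemma L2_time_diff:
  assumes w: "w \<in> L2_time T X" and v: "v \<in> L2_time T X"
    and X: "\<And>f h. f \<in> X \<Longrightarrow> h \<in> X \<Longrightarrow> (\<lambda>p. f p - h p) \<in> X"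
  shows "(\<lambda>t p. w t p - v t p) \<in> L2_time T X"
proof -
  let ?Q = "{0..T} \<times> Omega"
  let ?w = "\<lambda>z. indicator ?Q z *\<^sub>R (case z of (t, p) \<Rightarrow> w t p)"
  let ?v = "\<lambda>z. indicator ?Q z *\<^sub>R (case z of (t, p) \<Rightarrow> v t p)"
  have m: "?w \<in> borel_measurable lebesgue" "?v \<in> borel_measurable lebesgue"
    using w v by (simp_all add: L2_time_def set_borel_measurable_def)
  have sq: "(\<lambda>z. indicator ?Q z *\<^sub>R (case z of (t, p) \<Rightarrow> (u t p)\<^sup>2)) = (\<lambda>z. (indicator ?Q z *\<^sub>R (case z of (t, p) \<Rightarrow> u t p))\<^sup>2)" for u :: "real \<Rightarrow> real \<times> real \<Rightarrow> real"
    by (auto simp: indicator_def)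
  have i: "integrable lebesgue (\<lambda>z. (?w z)\<^sup>2)" "integrable lebesgue (\<lambda>z. (?v z)\<^sup>2)"
    using w v unfolding L2_time_def set_integrable_def sq by auto
  have d: "indicator ?Q z *\<^sub>R (case z of (t, p) \<Rightarrow> w t p - v t p) = ?w z - ?v z" for z
    by (simp add: right_diff_distrib split: prod.split)
  have 1: "integrable lebesgue (\<lambda>z. (?w z - ?v z)\<^sup>2)"
    unfolding power2_diff using i integrable_mult_L2[OF m i] by (auto simp: mult.assoc)
  have 2: "(\<lambda>z. ?w z - ?v z) \<in> borel_measurable lebesgue" using m by (rule borel_measurable_diff)
  have 3: "AE t in lebesgue_on {0..T}. (\<lambda>p. w t p - v t p) \<in> X"
  proof -
    have "AE t in lebesgue_on {0..T}. w t \<in> X" "AE t in lebesgue_on {0..T}. v t \<in> X"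
      using w v by (auto simp: L2_time_def)
    then show ?thesis by eventually_elim (rule X)
  qed
  show ?thesis unfolding L2_time_def set_borel_measurable_def set_integrable_def sq d mem_Collect_eq by (intro conjI 1 2 3)
qed

lemma L2_time_restrict:
  assumes w: "w \<in> L2_time T X" and C: "C \<in> sets borel"
    and X: "\<And>f. f \<in> X \<Longrightarrow> (\<lambda>p. if p \<in> C then f p else 0) \<in> X"
  shows "(\<lambda>t p. if p \<in> C then w t p else 0) \<in> L2_time T X"
proof -
  let ?Q = "{0..T} \<times> Omega"
  let ?I = "\<lambda>z :: real \<times> real \<times> real. indicator C (snd z) :: real"
  have I: "?I \<in> borel_measurable borel"
  proof -
    have [measurable]: "(\<lambda>z :: real \<times> real \<times> real. snd z) \<in> borel_measurable borel"
      by (intro borel_measurable_continuous_onI continuous_intros)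
    note C[measurable]
    show ?thesis by measurable
  qed
  have I': "?I \<in> borel_measurable lebesgue" by (rule measurable_completion) (use I in simp)
  have e: "(\<lambda>z. indicator ?Q z *\<^sub>R (case z of (t, p) \<Rightarrow> if p \<in> C then w t p else 0)) = (\<lambda>z. ?I z * (indicator ?Q z *\<^sub>R (case z of (t, p) \<Rightarrow> w t p)))"
    by (auto simp: indicator_def)
  have e2: "(\<lambda>z. indicator ?Q z *\<^sub>R (case z of (t, p) \<Rightarrow> (if p \<in> C then w t p else 0)\<^sup>2)) = (\<lambda>z. ?I z * (indicator ?Q z *\<^sub>R (case z of (t, p) \<Rightarrow> (w t p)\<^sup>2)))"
    by (auto simp: indicator_def)
  have 1: "set_borel_measurable lebesgue ?Q (\<lambda>(t, p). if p \<in> C then w t p else 0)"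
    using w I' unfolding set_borel_measurable_def e L2_time_def by (auto intro!: borel_measurable_times)
  have 2: "set_integrable lebesgue ?Q (\<lambda>(t, p). (if p \<in> C then w t p else 0)\<^sup>2)"
    unfolding set_integrable_def e2
  proof (rule Bochner_Integration.integrable_bound)
    show i: "integrable lebesgue (\<lambda>z. indicator ?Q z *\<^sub>R (case z of (t, p) \<Rightarrow> (w t p)\<^sup>2))"
      using w unfolding L2_time_def set_integrable_def by simp
    show "(\<lambda>z. ?I z * (indicator ?Q z *\<^sub>R (case z of (t, p) \<Rightarrow> (w t p)\<^sup>2))) \<in> borel_measurable lebesgue"
      using I' borel_measurable_integrable[OF i] by (rule borel_measurable_times)
  qed (auto simp: indicator_def)
  have 3: "AE t in lebesgue_on {0..T}. (\<lambda>p. if p \<in> C then w t p else 0) \<in> X"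
  proof -
    have "AE t in lebesgue_on {0..T}. w t \<in> X" using w by (auto simp: L2_time_def)
    then show ?thesis by eventually_elim (rule X)
  qed
  show ?thesis unfolding L2_time_def mem_Collect_eq by (intro conjI 1 2 3)
qed

text \<open>The time integrals may be subtracted only where they converge: at almost every point the
  sections are square integrable, hence integrable over a bounded interval by pairing them with the
  constant 1.\<close>

lemma has_time_deriv_diff:
  assumes "has_time_deriv T u g" "has_time_deriv T v h"
  shows "has_time_deriv T (\<lambda>t p. u t p - v t p) (\<lambda>t p. g t p - h t p)"
proof -
  have gh: "g \<in> L2_time T UNIV" "h \<in> L2_time T UNIV" using assms by (auto simp: has_time_deriv_def)
  have [simp]: "Omega \<in> sets lebesgue" unfolding Omega_def by (intro sets_completionI_sets) (simp add: borel_Times)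
  show ?thesis unfolding has_time_deriv_def
  proof (intro conjI ballI)
    show "(\<lambda>t p. g t p - h t p) \<in> L2_time T UNIV" using L2_time_diff[OF gh] by simp
    fix t assume t: "t \<in> {0..T}"
    have a: "AE p in lebesgue. p \<in> Omega \<longrightarrow> u t p = u 0 p + (LINT s:{0..t}|lebesgue. g s p)"
      "AE p in lebesgue. p \<in> Omega \<longrightarrow> v t p = v 0 p + (LINT s:{0..t}|lebesgue. h s p)"
      using assms t by (auto simp: has_time_deriv_def AE_restrict_space_iff)
    have si: "set_integrable lebesgue {0..t} c" if "sq_int T c" for c
      using set_integrable_subset[OF sq_int_mult_integrable[OF that sq_int_one], of "{0..t}"] t by simp
    have "AE p in lebesgue. p \<in> Omega \<longrightarrow> u t p - v t p = u 0 p - v 0 p + (LINT s:{0..t}|lebesgue. g s p - h s p)"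
      using a sq_int_section[OF gh(1)] sq_int_section[OF gh(2)]
      by eventually_elim (auto simp: set_integral_diff(2)[OF si si])
    then show "AE p in lebesgue_on Omega. u t p - v t p = u 0 p - v 0 p + (LINT s:{0..t}|lebesgue. g s p - h s p)"
      by (subst AE_restrict_space_iff) auto
  qed
qed

lemma broken_poly_diff:
  assumes "f \<in> broken_poly k M g" "h \<in> broken_poly k M g"
  shows "(\<lambda>p. f p - h p) \<in> broken_poly k M g"
  unfolding broken_poly_def
proof safe
  fix i j assume ij: "i < M" "j < M"
  obtain c d where cd: "\<forall>(x, y)\<in>cell g i j. f (x, y) = (\<Sum>m\<le>k. \<Sum>n\<le>k - m. c m n * x ^ m * y ^ n)"
    "\<forall>(x, y)\<in>cell g i j. h (x, y) = (\<Sum>m\<le>k. \<Sum>n\<le>k - m. d m n * x ^ m * y ^ n)"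
    using assms ij unfolding broken_poly_def by blast
  have "f (x, y) - h (x, y) = (\<Sum>m\<le>k. \<Sum>n\<le>k - m. (c m n - d m n) * x ^ m * y ^ n)" if "(x, y) \<in> cell g i j" for x y
    using bspec[OF cd(1) that] bspec[OF cd(2) that] by (simp add: left_diff_distrib sum_subtractf)
  then show "\<exists>c. \<forall>(x, y)\<in>cell g i j. f (x, y) - h (x, y) = (\<Sum>m\<le>k. \<Sum>n\<le>k - m. c m n * x ^ m * y ^ n)"
    by (intro exI[of _ "\<lambda>m n. c m n - d m n"]) blast
qed

lemma broken_poly_restrict:
  assumes g: "grid M g" and f: "f \<in> broken_poly k M g" and ij: "i < M" "j < M"
  shows "(\<lambda>p. if p \<in> cell g i j then f p else 0) \<in> broken_poly k M g"
  unfolding broken_poly_def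
proof safe
  fix i' j' assume ij': "i' < M" "j' < M"
  obtain c where c: "\<forall>(x, y)\<in>cell g i' j'. f (x, y) = (\<Sum>m\<le>k. \<Sum>n\<le>k - m. c m n * x ^ m * y ^ n)"
    using f ij' unfolding broken_poly_def by blast
  show "\<exists>c. \<forall>(x, y)\<in>cell g i' j'. (if (x, y) \<in> cell g i j then f (x, y) else 0) = (\<Sum>m\<le>k. \<Sum>n\<le>k - m. c m n * x ^ m * y ^ n)"
  proof (cases "i' = i \<and> j' = j")
    case True
    then show ?thesis using c by auto
  next
    case False
    then have "p \<notin> cell g i j" if "p \<in> cell g i' j'" for p
      using that grid_interval_unique[OF g ij'(1) ij(1), of "fst p"] grid_interval_unique[OF g ij'(2) ij(2), of "snd p"]
      by (auto simp: cell_def)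
    then show ?thesis by (intro exI[of _ "\<lambda>_ _. 0"]) auto
  qed
qed

section \<open>Stability\<close>

lemma cell_open: "open (cell g i j)"
  unfolding cell_def by (intro open_Times) auto

lemma cell_subset_Omega:
  assumes "grid M g" "i < M" "j < M" shows "cell g i j \<subseteq> Omega"
  using grid_bounds[OF assms(1), of i] grid_bounds[OF assms(1), of "i + 1"]
    grid_bounds[OF assms(1), of j] grid_bounds[OF assms(1), of "j + 1"] assms(2,3)
  by (force simp: cell_def Omega_def)

lemma set_integral_sum2:
  fixes f :: "nat \<Rightarrow> nat \<Rightarrow> 'a \<Rightarrow> real"
  assumes "\<And>i j. i < M \<Longrightarrow> j < M \<Longrightarrow> set_integrable N A (f i j)"
  shows "set_integrable N A (\<lambda>t. \<Sum>i<M. \<Sum>j<M. f i j t)"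
    "(\<Sum>i<M. \<Sum>j<M. LINT t:A|N. f i j t) = (LINT t:A|N. (\<Sum>i<M. \<Sum>j<M. f i j t))"
proof -
  have e: "indicator A t *\<^sub>R (\<Sum>i<M. \<Sum>j<M. f i j t) = (\<Sum>i<M. \<Sum>j<M. indicator A t *\<^sub>R f i j t)" for t
    by (simp only: scaleR_sum_right)
  have inner: "integrable N (\<lambda>t. \<Sum>j<M. indicator A t *\<^sub>R f i j t)" if "i < M" for i
    using assms that unfolding set_integrable_def by (intro Bochner_Integration.integrable_sum) auto
  show "set_integrable N A (\<lambda>t. \<Sum>i<M. \<Sum>j<M. f i j t)"
    unfolding set_integrable_def e
  proof (rule Bochner_Integration.integrable_sum)
    fix i assume "i \<in> {..<M}"
    then show "integrable N (\<lambda>t. \<Sum>j<M. indicator A t *\<^sub>R f i j t)" by (intro inner) simp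
  qed
  have "(LINT t:A|N. (\<Sum>i<M. \<Sum>j<M. f i j t)) = (\<Sum>i<M. LINT t|N. (\<Sum>j<M. indicator A t *\<^sub>R f i j t))"
    unfolding set_lebesgue_integral_def e
  proof (rule Bochner_Integration.integral_sum)
    fix i assume "i \<in> {..<M}"
    then show "integrable N (\<lambda>t. \<Sum>j<M. indicator A t *\<^sub>R f i j t)" by (intro inner) simp
  qed
  also have "\<dots> = (\<Sum>i<M. \<Sum>j<M. LINT t|N. indicator A t *\<^sub>R f i j t)"
  proof (rule sum.cong[OF refl], rule Bochner_Integration.integral_sum)
    fix i j assume "i \<in> {..<M}" "j \<in> {..<M}"
    then show "integrable N (\<lambda>t. indicator A t *\<^sub>R f i j t)" using assms[of i j] unfolding set_integrable_def by blast
  qed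
  finally show "(\<Sum>i<M. \<Sum>j<M. LINT t:A|N. f i j t) = (LINT t:A|N. (\<Sum>i<M. \<Sum>j<M. f i j t))"
    by (simp add: set_lebesgue_integral_def)
qed

lemma sum_cells_integral:
  fixes f :: "real \<times> real \<Rightarrow> real"
  assumes g: "grid M g" and f: "set_integrable lebesgue Omega f"
  shows "(\<Sum>i<M. \<Sum>j<M. LINT p:cell g i j|lebesgue. f p) = (LINT p:Omega|lebesgue. f p)"
proof -
  have i: "integrable lebesgue (\<lambda>p. indicator (cell g i j) p *\<^sub>R f p)" if "i < M" "j < M" for i j
    using set_integrable_subset[OF f _ cell_subset_Omega[OF g that]] cell_open[of g i j]
    by (simp add: set_integrable_def sets_completionI_sets borel_open)
  have "(LINT p:Omega|lebesgue. f p) = (LINT p|lebesgue. (\<Sum>i<M. \<Sum>j<M. indicator (cell g i j) p *\<^sub>R f p))"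
    unfolding set_lebesgue_integral_def
  proof (rule integral_lebesgue_cong_AE)
    have fin: "finite (g ` {..M})" by simp
    from AE_completion[OF AE_lborel_pair_notin_finite[OF fin]]
    show "AE p in lebesgue. indicator Omega p *\<^sub>R f p = (\<Sum>i<M. \<Sum>j<M. indicator (cell g i j) p *\<^sub>R f p)"
    proof eventually_elim
      case (elim p)
      obtain x y where p: "p = (x, y)" by (cases p)
      show ?case
      proof (cases "p \<in> Omega")
        case True
        then have xy: "0 < x" "x < 1" "0 < y" "y < 1" by (auto simp: p Omega_def)
        have r: "x \<in> {0..1}" "x \<notin> g ` {1..<M}" "y \<in> {0..1}" "y \<notin> g ` {1..<M}" using elim xy by (auto simp: p)
        obtain i0 where "i0 < M" "g i0 < x \<or> x = 0 \<and> g i0 = 0" "x < g (i0 + 1) \<or> x = 1 \<and> g (i0 + 1) = 1"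
          using grid_locate[OF g r(1,2)] .
        then have i0: "i0 < M" "g i0 < x" "x < g (i0 + 1)" using xy by auto
        obtain j0 where "j0 < M" "g j0 < y \<or> y = 0 \<and> g j0 = 0" "y < g (j0 + 1) \<or> y = 1 \<and> g (j0 + 1) = 1"
          using grid_locate[OF g r(3,4)] .
        then have j0: "j0 < M" "g j0 < y" "y < g (j0 + 1)" using xy by auto
        have c: "p \<in> cell g i j \<longleftrightarrow> i = i0 \<and> j = j0" if "i < M" "j < M" for i j
          using grid_interval_unique[OF g that(1) i0(1) _ _ i0(2,3)] grid_interval_unique[OF g that(2) j0(1) _ _ j0(2,3)] i0 j0
          unfolding p cell_iff by blast
        have "(\<Sum>i<M. \<Sum>j<M. indicator (cell g i j) p *\<^sub>R f p) = (\<Sum>i<M. if i = i0 then (\<Sum>j<M. if j = j0 then f p else 0) else 0)"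
          by (intro sum.cong refl) (auto simp: c indicator_def intro!: sum.cong)
        also have "\<dots> = f p" using i0 j0 by simp
        finally show ?thesis using True by simp
      next
        case False
        then have "indicator (cell g i j) p *\<^sub>R f p = 0" if "i < M" "j < M" for i j
          using cell_subset_Omega[OF g that] by (auto simp: indicator_def)
        then have "(\<Sum>i<M. \<Sum>j<M. indicator (cell g i j) p *\<^sub>R f p) = 0" by (intro sum.neutral ballI) simp
        then show ?thesis using False by simp
      qed
    qed
  qed
  also have "\<dots> = (\<Sum>i<M. \<Sum>j<M. LINT p|lebesgue. indicator (cell g i j) p *\<^sub>R f p)"
  proof -
    have "(\<Sum>i<M. \<Sum>j<M. LINT p:UNIV|lebesgue. indicator (cell g i j) p *\<^sub>R f p) =
        (LINT p:UNIV|lebesgue. (\<Sum>i<M. \<Sum>j<M. indicator (cell g i j) p *\<^sub>R f p))"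
      by (rule set_integral_sum2(2)) (use i in \<open>simp add: set_integrable_def\<close>)
    then show ?thesis by (simp only: set_lebesgue_integral_def indicator_UNIV scaleR_one)
  qed
  finally show ?thesis by (simp add: set_lebesgue_integral_def)
qed

section \<open>The forms of the scheme in coefficients\<close>

lemma bilin_add_left: "bilin I J (\<lambda>a. c a + c' a) d P S = bilin I J c d P S + bilin I J c' d P S"
  by (simp add: bilin_def sum.distrib distrib_right)

lemma bilin_diff_left: "bilin I J (\<lambda>a. c a - c' a) d P S = bilin I J c d P S - bilin I J c' d P S"
  by (simp add: bilin_def sum_subtractf left_diff_distrib)

lemma bilin_integrable:
  assumes "\<And>a. sq_int T (c a)" "\<And>a. sq_int T (d a)"
  shows "set_integrable lebesgue {0..T} (\<lambda>t. bilin I J (\<lambda>a. c a t) (\<lambda>a. d a t) P S)"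
proof -
  have "set_integrable lebesgue {0..T} (\<lambda>t. c a t * d e t * w)" for a e w
    using sq_int_mult_integrable[OF assms(1)[of a] assms(2)[of e]] by simp
  then have "integrable lebesgue (\<lambda>t. \<Sum>a\<in>I. \<Sum>e\<in>J. indicator {0..T} t *\<^sub>R (c a t * d e t * (P (fst a) (fst e) * S (snd a) (snd e))))"
    unfolding set_integrable_def by (intro Bochner_Integration.integrable_sum)
  then show ?thesis unfolding set_integrable_def bilin_def by (simp only: scaleR_sum_right)
qed

lemma sq_int_on_cell: "(\<And>a. sq_int T (c a)) \<Longrightarrow> sq_int T (\<lambda>t. on_cell i j (\<lambda>a. c a t) a)"
proof (cases "fst (fst a) = i \<and> fst (snd a) = j")
  case False
  then have "(\<lambda>t. on_cell i j (\<lambda>a. c a t) a) = (\<lambda>_. 0)" by (auto simp: on_cell_def)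
  then show ?thesis by (simp only: sq_int_zero)
qed (simp add: on_cell_def)

type_synonym coeffs = "(nat \<times> nat) \<times> (nat \<times> nat) \<Rightarrow> real"

definition grad_form :: "nat \<Rightarrow> nat \<Rightarrow> (nat \<Rightarrow> real) \<Rightarrow> nat \<Rightarrow> (nat \<Rightarrow> real) \<Rightarrow> coeffs \<Rightarrow> coeffs \<Rightarrow> coeffs \<Rightarrow> real" where
  "grad_form k M g M' h cx cy d =
     bilin (idx2 M' k) (idx2 M k) cx d (vol h g) (mass h g) + bilin (idx2 M' k) (idx2 M k) cy d (mass h g) (vol h g)
     - (bilin (idx2 M' k) (idx2 M k) cx d (flux (tbasis h) g) (mass h g) + bilin (idx2 M' k) (idx2 M k) cy d (mass h g) (flux (tbasis h) g))"

definition div_form :: "nat \<Rightarrow> nat \<Rightarrow> (nat \<Rightarrow> real) \<Rightarrow> nat \<Rightarrow> (nat \<Rightarrow> real) \<Rightarrow> coeffs \<Rightarrow> coeffs \<Rightarrow> coeffs \<Rightarrow> real" where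
  "div_form k M g M' h d cx cy =
     bilin (idx2 M k) (idx2 M' k) d cx (vol g h) (mass g h) + bilin (idx2 M k) (idx2 M' k) d cy (mass g h) (vol g h)
     - (bilin (idx2 M k) (idx2 M' k) d cx (flux (basis g) h) (mass g h) + bilin (idx2 M k) (idx2 M' k) d cy (mass g h) (flux (basis g) h))"

definition frac_form :: "real \<Rightarrow> real \<Rightarrow> nat \<Rightarrow> nat \<Rightarrow> (nat \<Rightarrow> real) \<Rightarrow> coeffs \<Rightarrow> coeffs \<Rightarrow> coeffs \<Rightarrow> coeffs \<Rightarrow> real" where
  "frac_form s r k M h cx cy ex ey =
     bilin (idx2 M k) (idx2 M k) cx ex (frac s h) (mass h h) + bilin (idx2 M k) (idx2 M k) cy ey (mass h h) (frac r h)"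

text \<open>The term of the right fluxes: the trial function carries the right derivative and the
  test function the left one, so all one-dimensional matrices appear transposed. On the diagonal
  this makes no difference.\<close>

definition frac_form' :: "real \<Rightarrow> real \<Rightarrow> nat \<Rightarrow> nat \<Rightarrow> (nat \<Rightarrow> real) \<Rightarrow> coeffs \<Rightarrow> coeffs \<Rightarrow> coeffs \<Rightarrow> coeffs \<Rightarrow> real" where
  "frac_form' s r k M h cx cy ex ey =
     bilin (idx2 M k) (idx2 M k) cx ex (\<lambda>\<kappa> \<mu>. frac s h \<mu> \<kappa>) (\<lambda>\<kappa> \<mu>. mass h h \<mu> \<kappa>)
     + bilin (idx2 M k) (idx2 M k) cy ey (\<lambda>\<kappa> \<mu>. mass h h \<mu> \<kappa>) (\<lambda>\<kappa> \<mu>. frac r h \<mu> \<kappa>)"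

lemma grad_div_cancel:
  assumes "grid M g" "grid M' h" "disjoint_grids M g M' h"
  shows "grad_form k M g M' h cx cy d + div_form k M g M' h d cx cy = 0"
  using green_cancel(1)[OF assms, of k cx d] green_cancel(2)[OF assms, of k cy d]
  unfolding grad_form_def div_form_def by linarith

lemma frac_forms_nonneg:
  assumes "0 < s" "s < 1 / 2" "0 < r" "r < 1 / 2" "grid M h"
  shows "0 \<le> frac_form s r k M h cx cy cx cy" "0 \<le> frac_form' s r k M h cx cy cx cy"
proof -
  show *: "0 \<le> frac_form s r k M h cx cy cx cy"
    unfolding frac_form_def using frac_form_nonneg[OF assms(1,2,5)] frac_form_nonneg[OF assms(3,4,5)]
    by (intro add_nonneg_nonneg bilin_nonneg)
  have "frac_form' s r k M h cx cy cx cy = frac_form s r k M h cx cy cx cy"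
    unfolding frac_form_def frac_form'_def bilin_swap[of "idx2 M k" "idx2 M k" cx cx "frac s h"] bilin_swap[of "idx2 M k" "idx2 M k" cy cy "mass h h"] ..
  then show "0 \<le> frac_form' s r k M h cx cy cx cy" using * by simp
qed

text \<open>All spatial terms of one equation, with the cell sums already carried out:
  \<open>c\<close> and \<open>du\<close> are trial coefficients, \<open>e\<close> and
  \<open>dv\<close> test coefficients without cutoff.\<close>

definition coupling :: "real \<Rightarrow> real \<Rightarrow> nat \<Rightarrow> nat \<Rightarrow> (nat \<Rightarrow> real) \<Rightarrow> nat \<Rightarrow> (nat \<Rightarrow> real) \<Rightarrow> coeffs \<Rightarrow> coeffs \<Rightarrow>
    coeffs \<Rightarrow> coeffs \<Rightarrow> coeffs \<Rightarrow> coeffs \<Rightarrow> coeffs \<Rightarrow> coeffs \<Rightarrow> coeffs \<Rightarrow> coeffs \<Rightarrow> real" where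
  "coupling s r k M g M' h du cLx cLy cRx cRy dv eLx eLy eRx eRy =
     grad_form k M g M' h (\<lambda>a. cLx a + cRx a) (\<lambda>a. cLy a + cRy a) dv
     + (frac_form s r k M' h cLx cLy eLx eLy + div_form k M g M' h du eLx eLy
     + frac_form' s r k M' h cRx cRy eRx eRy + div_form k M g M' h du eRx eRy)"

lemma form_sum_on_cell:
  "(\<Sum>i<M. \<Sum>j<M. grad_form k M g M' h cx cy (on_cell i j d)) = grad_form k M g M' h cx cy d"
  "(\<Sum>i<M'. \<Sum>j<M'. div_form k M g M' h d (on_cell i j cx) (on_cell i j cy)) = div_form k M g M' h d cx cy"
  "(\<Sum>i<M. \<Sum>j<M. frac_form s r k M h cx cy (on_cell i j ex) (on_cell i j ey)) = frac_form s r k M h cx cy ex ey"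
  "(\<Sum>i<M. \<Sum>j<M. frac_form' s r k M h cx cy (on_cell i j ex) (on_cell i j ey)) = frac_form' s r k M h cx cy ex ey"
  unfolding grad_form_def div_form_def frac_form_def frac_form'_def
  by (simp_all add: sum.distrib sum_subtractf bilin_sum_on_cell_right)

lemma set_integral_lebesgue_cong_AE:
  fixes f F :: "'a::euclidean_space \<Rightarrow> real"
  assumes "AE t in lebesgue. t \<in> A \<longrightarrow> f t = F t"
  shows "(LINT t:A|lebesgue. f t) = (LINT t:A|lebesgue. F t)"
  unfolding set_lebesgue_integral_def
proof (rule integral_lebesgue_cong_AE)
  show "AE t in lebesgue. indicator A t *\<^sub>R f t = indicator A t *\<^sub>R F t"
    using assms by eventually_elim (auto simp: indicator_def)
qed

text \<open>Applied to each of the two solutions separately, with test functions not yet tied to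
  either. Besides the value it supplies integrability of \<open>Z\<close> and \<open>\<Psi>\<close>,
  without which two evaluations could not be subtracted under the integral.\<close>

lemma LDG_form_eval:
  fixes \<tau> :: real and u w v :: "real \<Rightarrow> scalar_field" and qL qR eL eR :: "real \<Rightarrow> vector_field"
  assumes g: "grid M g" and h: "grid M' h" and dis: "disjoint_grids M g M' h"
    and \<alpha>: "1 < \<alpha>" "\<alpha> < 2" and \<beta>: "1 < \<beta>" "\<beta> < 2"
    and D: "time_deriv T u \<in> L2_time T UNIV" and u: "u \<in> L2_time T X" and w: "w \<in> L2_time T Y" and v: "v \<in> L2_time T V"
    and u0: "\<And>t p. t \<in> {0..T} \<Longrightarrow> p \<notin> Omega \<Longrightarrow> u t p = 0"
    and cr: "coeff_rep T k M g du u" "coeff_rep T k M g dv v"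
      "coeff_rep T k M' h cLx (\<lambda>t p. fst (qL t p))" "coeff_rep T k M' h cLy (\<lambda>t p. snd (qL t p))"
      "coeff_rep T k M' h cRx (\<lambda>t p. fst (qR t p))" "coeff_rep T k M' h cRy (\<lambda>t p. snd (qR t p))"
      "coeff_rep T k M' h eLx (\<lambda>t p. fst (eL t p))" "coeff_rep T k M' h eLy (\<lambda>t p. snd (eL t p))"
      "coeff_rep T k M' h eRx (\<lambda>t p. fst (eR t p))" "coeff_rep T k M' h eRy (\<lambda>t p. snd (eR t p))"
  defines "Z t \<equiv> coupling ((2 - \<alpha>) / 2) ((2 - \<beta>) / 2) k M g M' h (\<lambda>a. du a t) (\<lambda>a. cLx a t) (\<lambda>a. cLy a t)
      (\<lambda>a. cRx a t) (\<lambda>a. cRy a t) (\<lambda>a. dv a t) (\<lambda>a. eLx a t) (\<lambda>a. eLy a t) (\<lambda>a. eRx a t) (\<lambda>a. eRy a t)"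
  defines "\<Psi> t \<equiv> ip Omega (time_deriv T u t) (v t) + 1 / \<tau> * ip Omega (\<lambda>p. u t p - w t p) (v t) + Z t"
  shows "set_integrable lebesgue {0..T} Z" "set_integrable lebesgue {0..T} \<Psi>"
    and "LDG_form \<alpha> \<beta> \<tau> T M g M' h u w qL qR v (\<lambda>i j t p. if p \<in> cell h i j then eL t p else 0) (\<lambda>i j t p. if p \<in> cell h i j then eR t p else 0)
      = (LINT t:{0..T}|lebesgue. \<Psi> t)"
proof -
  let ?a = "(2 - \<alpha>) / 2" and ?b = "(2 - \<beta>) / 2"
  note sq = cr[unfolded coeff_rep_def, THEN conjunct1, rule_format] and rep = cr[unfolded coeff_rep_def, THEN conjunct2]
  have ab: "0 < ?a" "?a < 1 / 2" "0 < ?b" "?b < 1 / 2" using \<alpha> \<beta> by auto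
  let ?\<phi>L = "\<lambda>i j t p. if p \<in> cell h i j then eL t p else 0"
  let ?\<phi>R = "\<lambda>i j t p. if p \<in> cell h i j then eR t p else 0"
  have uw: "(\<lambda>t p. u t p - w t p) \<in> L2_time T UNIV"
    using L2_time_diff[OF L2_time_mono[OF u] L2_time_mono[OF w]] by simp
  have OmB: "Omega \<in> sets borel" unfolding Omega_def by (intro borel_Times) auto
  have cB: "cell g i j \<in> sets borel" for i j using cell_open by (rule borel_open)
  \<comment> \<open>\<open>A\<close> and \<open>B\<close> are the integrands of the two cell sums.
    The time derivative stays an inner product, because the function picked by
    \<open>time_deriv\<close> is only known to be square integrable, not piecewise
    polynomial.\<close>
  define A where "A i j t = ip (cell g i j) (time_deriv T u t) (v t) + 1 / \<tau> * ip (cell g i j) (\<lambda>p. u t p - w t p) (v t)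
     + grad_form k M g M' h (\<lambda>a. cLx a t + cRx a t) (\<lambda>a. cLy a t + cRy a t) (on_cell i j (\<lambda>a. dv a t))" for i j t
  define B where "B i j t = frac_form ?a ?b k M' h (\<lambda>a. cLx a t) (\<lambda>a. cLy a t) (on_cell i j (\<lambda>a. eLx a t)) (on_cell i j (\<lambda>a. eLy a t))
     + div_form k M g M' h (\<lambda>a. du a t) (on_cell i j (\<lambda>a. eLx a t)) (on_cell i j (\<lambda>a. eLy a t))
     + frac_form' ?a ?b k M' h (\<lambda>a. cRx a t) (\<lambda>a. cRy a t) (on_cell i j (\<lambda>a. eRx a t)) (on_cell i j (\<lambda>a. eRy a t))
     + div_form k M g M' h (\<lambda>a. du a t) (on_cell i j (\<lambda>a. eRx a t)) (on_cell i j (\<lambda>a. eRy a t))" for i j t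
  have gradI: "set_integrable lebesgue {0..T} (\<lambda>t. grad_form k M g M' h (\<lambda>a. cLx a t + cRx a t) (\<lambda>a. cLy a t + cRy a t) (\<lambda>a. d a t))"
    if "\<And>a. sq_int T (d a)" for d
    unfolding grad_form_def using sq that
    by (intro set_integral_add set_integral_diff bilin_integrable[where c = "\<lambda>a t. cLx a t + cRx a t"] bilin_integrable[where c = "\<lambda>a t. cLy a t + cRy a t"] sq_int_add) auto
  have divI: "set_integrable lebesgue {0..T} (\<lambda>t. div_form k M g M' h (\<lambda>a. du a t) (\<lambda>a. c a t) (\<lambda>a. d a t))"
    if "\<And>a. sq_int T (c a)" "\<And>a. sq_int T (d a)" for c d
    unfolding div_form_def using sq that by (intro set_integral_add set_integral_diff bilin_integrable) auto
  have fracI: "set_integrable lebesgue {0..T} (\<lambda>t. frac_form ?a ?b k M' h (\<lambda>a. cLx a t) (\<lambda>a. cLy a t) (\<lambda>a. c a t) (\<lambda>a. d a t))"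
    "set_integrable lebesgue {0..T} (\<lambda>t. frac_form' ?a ?b k M' h (\<lambda>a. cRx a t) (\<lambda>a. cRy a t) (\<lambda>a. c a t) (\<lambda>a. d a t))"
    if "\<And>a. sq_int T (c a)" "\<And>a. sq_int T (d a)" for c d
    unfolding frac_form_def frac_form'_def using sq that by (intro set_integral_add bilin_integrable; simp)+
  have resq: "sq_int T (\<lambda>t. on_cell i j (\<lambda>a. dv a t) a)" "sq_int T (\<lambda>t. on_cell i j (\<lambda>a. eLx a t) a)" "sq_int T (\<lambda>t. on_cell i j (\<lambda>a. eLy a t) a)"
     "sq_int T (\<lambda>t. on_cell i j (\<lambda>a. eRx a t) a)" "sq_int T (\<lambda>t. on_cell i j (\<lambda>a. eRy a t) a)" for i j a
    using sq by (auto intro: sq_int_on_cell)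
  have AI: "set_integrable lebesgue {0..T} (A i j)" if "i < M" "j < M" for i j
    unfolding A_def[abs_def] using gradI[OF resq(1)[of i j]]
      ip_time_integrable(1)[OF D v cB cell_subset_Omega[OF g that]] ip_time_integrable(1)[OF uw v cB cell_subset_Omega[OF g that]]
    by (intro set_integral_add set_integrable_mult_right) simp_all
  have BI: "set_integrable lebesgue {0..T} (B i j)" for i j
    unfolding B_def[abs_def] using fracI(1)[OF resq(2)[of i j] resq(3)[of i j]] fracI(2)[OF resq(4)[of i j] resq(5)[of i j]]
      divI[OF resq(2)[of i j] resq(3)[of i j]] divI[OF resq(4)[of i j] resq(5)[of i j]]
    by (intro set_integral_add) simp_all
  show ZI: "set_integrable lebesgue {0..T} Z"
    unfolding Z_def coupling_def using gradI[OF sq(2)] fracI(1)[OF sq(7,8)] fracI(2)[OF sq(9,10)] divI[OF sq(7,8)] divI[OF sq(9,10)]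
    by (intro set_integral_add) simp_all
  show "set_integrable lebesgue {0..T} \<Psi>"
    unfolding \<Psi>_def using ZI ip_time_integrable(1)[OF D v OmB order_refl] ip_time_integrable(1)[OF uw v OmB order_refl]
    by (intro set_integral_add set_integrable_mult_right) simp_all
  have 1: "AE t in lebesgue. t \<in> {0..T} \<longrightarrow>
        (ip (cell g i j) (time_deriv T u t) (v t)
       + 1 / \<tau> * ip (cell g i j) (\<lambda>p. u t p - w t p) (v t)
       + ip (cell g i j) (\<lambda>p. qL t p + qR t p) (grad (v t))
       - bd_integral g i j (\<lambda>n p.
           (n \<bullet> trace_from Omega (\<lambda>p'. qL t p' + qR t p') p) * trace_from (cell g i j) (v t) p)) = A i j t"
    if ij: "i < M" "j < M" for i j
    using rep(2,3,4,5,6)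
  proof eventually_elim
    case (elim t)
    show ?case
    proof
      assume t: "t \<in> {0..T}"
      have q: "rep k M' h (\<lambda>a. cLx a t + cRx a t) (\<lambda>p. fst (qL t p + qR t p))"
        "rep k M' h (\<lambda>a. cLy a t + cRy a t) (\<lambda>p. snd (qL t p + qR t p))"
        using elim t by (simp_all add: rep_def distrib_right sum.distrib)
      have v: "rep k M g (\<lambda>a. dv a t) (v t)" using elim t by simp
      show "ip (cell g i j) (time_deriv T u t) (v t)
       + 1 / \<tau> * ip (cell g i j) (\<lambda>p. u t p - w t p) (v t)
       + ip (cell g i j) (\<lambda>p. qL t p + qR t p) (grad (v t))
       - bd_integral g i j (\<lambda>n p.
           (n \<bullet> trace_from Omega (\<lambda>p'. qL t p' + qR t p') p) * trace_from (cell g i j) (v t) p) = A i j t"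
        unfolding ip_grad[OF g h q v ij] bd_flux[OF g h dis q v ij] A_def grad_form_def by simp
    qed
  qed
  have dis': "disjoint_grids M' h M g" using dis by (simp add: disjoint_grids_commute)
  have 2: "AE t in lebesgue. t \<in> {0..T} \<longrightarrow>
      (ip Omega (D_left ?a ?b (qL t)) (D_right ?a ?b (?\<phi>L i j t))
       + ip (cell h i j) (u t) (divergence (?\<phi>L i j t))
       - bd_integral h i j (\<lambda>n p. u t p * (n \<bullet> trace_from (cell h i j) (?\<phi>L i j t) p))
       + ip Omega (D_right ?a ?b (qR t)) (D_left ?a ?b (?\<phi>R i j t))
       + ip (cell h i j) (u t) (divergence (?\<phi>R i j t))
       - bd_integral h i j (\<lambda>n p. u t p * (n \<bullet> trace_from (cell h i j) (?\<phi>R i j t) p))) = B i j t"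
    if ij: "i < M'" "j < M'" for i j
    using rep(1) rep(3-10)
  proof eventually_elim
    case (elim t)
    show ?case
    proof
      assume t: "t \<in> {0..T}"
      have fi: "(\<lambda>p. fst (if p \<in> cell h i j then f p else 0)) = (\<lambda>p. if p \<in> cell h i j then fst (f p) else 0)"
        "(\<lambda>p. snd (if p \<in> cell h i j then f p else 0)) = (\<lambda>p. if p \<in> cell h i j then snd (f p) else 0)"
        for f :: vector_field by auto
      have L: "rep k M' h (on_cell i j (\<lambda>a. eLx a t)) (\<lambda>p. fst (?\<phi>L i j t p))" "rep k M' h (on_cell i j (\<lambda>a. eLy a t)) (\<lambda>p. snd (?\<phi>L i j t p))"
        unfolding fi using elim t by (intro rep_restrict[OF h _ ij]; simp)+
      have R: "rep k M' h (on_cell i j (\<lambda>a. eRx a t)) (\<lambda>p. fst (?\<phi>R i j t p))" "rep k M' h (on_cell i j (\<lambda>a. eRy a t)) (\<lambda>p. snd (?\<phi>R i j t p))"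
        unfolding fi using elim t by (intro rep_restrict[OF h _ ij]; simp)+
      have qL: "rep k M' h (\<lambda>a. cLx a t) (\<lambda>p. fst (qL t p))" "rep k M' h (\<lambda>a. cLy a t) (\<lambda>p. snd (qL t p))"
        and qR: "rep k M' h (\<lambda>a. cRx a t) (\<lambda>p. fst (qR t p))" "rep k M' h (\<lambda>a. cRy a t) (\<lambda>p. snd (qR t p))"
        and u: "rep k M g (\<lambda>a. du a t) (u t)" using elim t by simp_all
      have DR: "ip Omega (D_right ?a ?b (qR t)) (D_left ?a ?b (?\<phi>R i j t)) =
         frac_form' ?a ?b k M' h (\<lambda>a. cRx a t) (\<lambda>a. cRy a t) (on_cell i j (\<lambda>a. eRx a t)) (on_cell i j (\<lambda>a. eRy a t))"
        unfolding ip_commute[of Omega "D_right ?a ?b (qR t)"] ip_D_left_D_right[OF h ab R qR] frac_form'_def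
        by (intro arg_cong2[where f = "(+)"] bilin_swap)
      have DL: "ip Omega (D_left ?a ?b (qL t)) (D_right ?a ?b (?\<phi>L i j t)) =
         frac_form ?a ?b k M' h (\<lambda>a. cLx a t) (\<lambda>a. cLy a t) (on_cell i j (\<lambda>a. eLx a t)) (on_cell i j (\<lambda>a. eLy a t))"
        unfolding ip_D_left_D_right[OF h ab qL L] frac_form_def ..
      have dv: "ip (cell h i j) (u t) (divergence f) - bd_integral h i j (\<lambda>n p. u t p * (n \<bullet> trace_from (cell h i j) f p))
         = div_form k M g M' h (\<lambda>a. du a t) (on_cell i j cx) (on_cell i j cy)"
        if f: "rep k M' h cx (\<lambda>p. fst (f p))" "rep k M' h cy (\<lambda>p. snd (f p))" for f cx cy
      proof -
        have "bd_integral h i j (\<lambda>n p. u t p * (n \<bullet> trace_from (cell h i j) f p)) =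
           bilin (idx2 M k) (idx2 M' k) (\<lambda>a. du a t) (on_cell i j cx) (flux (basis g) h) (mass g h)
         + bilin (idx2 M k) (idx2 M' k) (\<lambda>a. du a t) (on_cell i j cy) (mass g h) (flux (basis g) h)"
          by (rule bd_test[OF h g dis' f u _ ij]) (rule u0[OF t])
        then show ?thesis unfolding ip_divergence[OF h g f u ij] div_form_def by (simp only:)
      qed
      \<comment> \<open>The test function is cut off to a cell and then integrated over that same
        cell; the second cutoff changes nothing.\<close>
      have rr: "on_cell i j (on_cell i j c) = on_cell i j c" for c by (auto simp: on_cell_def)
      show "ip Omega (D_left ?a ?b (qL t)) (D_right ?a ?b (?\<phi>L i j t))
       + ip (cell h i j) (u t) (divergence (?\<phi>L i j t))
       - bd_integral h i j (\<lambda>n p. u t p * (n \<bullet> trace_from (cell h i j) (?\<phi>L i j t) p))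
       + ip Omega (D_right ?a ?b (qR t)) (D_left ?a ?b (?\<phi>R i j t))
       + ip (cell h i j) (u t) (divergence (?\<phi>R i j t))
       - bd_integral h i j (\<lambda>n p. u t p * (n \<bullet> trace_from (cell h i j) (?\<phi>R i j t) p)) = B i j t"
        using dv[OF L] dv[OF R] unfolding DL DR B_def rr by linarith
    qed
  qed
  have form: "LDG_form \<alpha> \<beta> \<tau> T M g M' h u w qL qR v ?\<phi>L ?\<phi>R =
     (\<Sum>i<M. \<Sum>j<M. LINT t:{0..T}|lebesgue. A i j t) + (\<Sum>i<M'. \<Sum>j<M'. LINT t:{0..T}|lebesgue. B i j t)"
    unfolding LDG_form_def Let_def
    by (intro arg_cong2[where f = "(+)"] sum.cong refl set_integral_lebesgue_cong_AE 1 2) auto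
  also have "\<dots> = (LINT t:{0..T}|lebesgue. (\<Sum>i<M. \<Sum>j<M. A i j t) + (\<Sum>i<M'. \<Sum>j<M'. B i j t))"
    using set_integral_sum2[of M lebesgue "{0..T}" A, OF AI] set_integral_sum2[of M' lebesgue "{0..T}" B, OF BI]
    by (simp add: set_integral_add)
  also have "\<dots> = (LINT t:{0..T}|lebesgue. \<Psi> t)"
  proof (rule set_integral_lebesgue_cong_AE)
    show "AE t in lebesgue. t \<in> {0..T} \<longrightarrow> (\<Sum>i<M. \<Sum>j<M. A i j t) + (\<Sum>i<M'. \<Sum>j<M'. B i j t) = \<Psi> t"
      using ip_time_integrable(2)[OF D v OmB order_refl] ip_time_integrable(2)[OF uw v OmB order_refl]
    proof eventually_elim
      case (elim t)
      show ?case
      proof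
        assume t: "t \<in> {0..T}"
        have s1: "(\<Sum>i<M. \<Sum>j<M. ip (cell g i j) (time_deriv T u t) (v t)) = ip Omega (time_deriv T u t) (v t)"
          unfolding ip_def inner_real_def using elim t by (intro sum_cells_integral[OF g]) simp
        have s2: "(\<Sum>i<M. \<Sum>j<M. ip (cell g i j) (\<lambda>p. u t p - w t p) (v t)) = ip Omega (\<lambda>p. u t p - w t p) (v t)"
          unfolding ip_def inner_real_def using elim t by (intro sum_cells_integral[OF g]) simp
        have "(\<Sum>i<M. \<Sum>j<M. A i j t) = ip Omega (time_deriv T u t) (v t) + 1 / \<tau> * ip Omega (\<lambda>p. u t p - w t p) (v t)
          + grad_form k M g M' h (\<lambda>a. cLx a t + cRx a t) (\<lambda>a. cLy a t + cRy a t) (\<lambda>a. dv a t)"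
          unfolding A_def sum.distrib s1 form_sum_on_cell sum_distrib_left[symmetric] s2 ..
        moreover have "(\<Sum>i<M'. \<Sum>j<M'. B i j t) = frac_form ?a ?b k M' h (\<lambda>a. cLx a t) (\<lambda>a. cLy a t) (\<lambda>a. eLx a t) (\<lambda>a. eLy a t)
            + div_form k M g M' h (\<lambda>a. du a t) (\<lambda>a. eLx a t) (\<lambda>a. eLy a t)
            + frac_form' ?a ?b k M' h (\<lambda>a. cRx a t) (\<lambda>a. cRy a t) (\<lambda>a. eRx a t) (\<lambda>a. eRy a t)
            + div_form k M g M' h (\<lambda>a. du a t) (\<lambda>a. eRx a t) (\<lambda>a. eRy a t)"
          unfolding B_def sum.distrib form_sum_on_cell ..
        ultimately show "(\<Sum>i<M. \<Sum>j<M. A i j t) + (\<Sum>i<M'. \<Sum>j<M'. B i j t) = \<Psi> t"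
          by (simp add: \<Psi>_def Z_def coupling_def)
      qed
    qed
  qed
  finally show "LDG_form \<alpha> \<beta> \<tau> T M g M' h u w qL qR v ?\<phi>L ?\<phi>R = (LINT t:{0..T}|lebesgue. \<Psi> t)" .
qed

text \<open>The trial slots are linear, and the test coefficients are the differences of the trial
  ones. Subtraction puts equal coefficients into both slots; the Green terms cancel for the left and
  the right flux separately, leaving two quadratic forms.\<close>

lemma coupling_diff:
  fixes cLx cLy cRx cRy cLx' cLy' cRx' cRy' du du' :: coeffs
  assumes "grid M g" "grid M' h" "disjoint_grids M g M' h"
  defines "eLx \<equiv> \<lambda>a. cLx a - cLx' a" and "eLy \<equiv> \<lambda>a. cLy a - cLy' a" and "eRx \<equiv> \<lambda>a. cRx a - cRx' a"
    and "eRy \<equiv> \<lambda>a. cRy a - cRy' a" and "dv \<equiv> \<lambda>a. du a - du' a"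
  shows "coupling s r k M g M' h du cLx cLy cRx cRy dv eLx eLy eRx eRy - coupling s r k M g M' h du' cLx' cLy' cRx' cRy' dv eLx eLy eRx eRy
     = frac_form s r k M' h eLx eLy eLx eLy + frac_form' s r k M' h eRx eRy eRx eRy"
proof -
  have G: "grad_form k M g M' h (\<lambda>a. cLx a + cRx a) (\<lambda>a. cLy a + cRy a) dv - grad_form k M g M' h (\<lambda>a. cLx' a + cRx' a) (\<lambda>a. cLy' a + cRy' a) dv
    = grad_form k M g M' h eLx eLy dv + grad_form k M g M' h eRx eRy dv"
    unfolding grad_form_def eLx_def eLy_def eRx_def eRy_def bilin_add_left bilin_diff_left by simp
  have D: "div_form k M g M' h du x y - div_form k M g M' h du' x y = div_form k M g M' h dv x y" for x y
    unfolding div_form_def dv_def bilin_diff_left by simp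
  have F: "frac_form s r k M' h cLx cLy x y - frac_form s r k M' h cLx' cLy' x y = frac_form s r k M' h eLx eLy x y" for x y
    unfolding frac_form_def eLx_def eLy_def bilin_diff_left by simp
  have F': "frac_form' s r k M' h cRx cRy x y - frac_form' s r k M' h cRx' cRy' x y = frac_form' s r k M' h eRx eRy x y" for x y
    unfolding frac_form'_def eRx_def eRy_def bilin_diff_left by simp
  show ?thesis
    using G D[of eLx eLy] D[of eRx eRy] F[of eLx eLy] F'[of eRx eRy]
      grad_div_cancel[OF assms(1-3), of k eLx eLy dv] grad_div_cancel[OF assms(1-3), of k eRx eRy dv]
    unfolding coupling_def by linarith
qed

section \<open>Energy inequality for one mesh\<close>

lemma L2_time_vec_diff:
  assumes "q \<in> L2_time_vec T (broken_poly k M g)" "q' \<in> L2_time_vec T (broken_poly k M g)"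
  shows "(\<lambda>t p. q t p - q' t p) \<in> L2_time_vec T (broken_poly k M g)"
  using assms unfolding L2_time_vec_def by (auto intro: L2_time_diff broken_poly_diff)

lemma H1_time_diff:
  assumes "u \<in> H1_time T (broken_poly k M g)" "u' \<in> H1_time T (broken_poly k M g)"
  shows "(\<lambda>t p. u t p - u' t p) \<in> H1_time T (broken_poly k M g)"
proof -
  obtain d d' where d: "d \<in> L2_time T (broken_poly k M g)" "has_time_deriv T u d"
    "d' \<in> L2_time T (broken_poly k M g)" "has_time_deriv T u' d'"
    using assms unfolding H1_time_def by blast
  have "(\<lambda>t p. d t p - d' t p) \<in> L2_time T (broken_poly k M g)"
    using d by (intro L2_time_diff broken_poly_diff)
  moreover have "has_time_deriv T (\<lambda>t p. u t p - u' t p) (\<lambda>t p. d t p - d' t p)"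
    using d by (intro has_time_deriv_diff)
  moreover have "(\<lambda>t p. u t p - u' t p) \<in> L2_time T (broken_poly k M g)"
    using assms by (intro L2_time_diff broken_poly_diff) (auto simp: H1_time_def)
  moreover have "\<forall>t\<in>{0..T}. (\<lambda>p. u t p - u' t p) \<in> broken_poly k M g"
    using assms by (auto simp: H1_time_def intro: broken_poly_diff)
  ultimately show ?thesis unfolding H1_time_def by blast
qed

lemma local_tests_restrict:
  assumes g: "grid M g" and q: "q \<in> L2_time_vec T (broken_poly k M g)"
  shows "(\<lambda>i j t p. if p \<in> cell g i j then q t p else 0) \<in> local_tests T (broken_poly k M g) M g"
proof -
  have "(\<lambda>t p. if p \<in> cell g i j then q t p else 0) \<in> L2_time_vec T (broken_poly k M g)" if ij: "i < M" "j < M" for i j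
  proof -
    have r: "(\<lambda>t p. if p \<in> cell g i j then f t p else 0) \<in> L2_time T (broken_poly k M g)"
      if "f \<in> L2_time T (broken_poly k M g)" for f
      using that by (rule L2_time_restrict) (auto intro: borel_open cell_open broken_poly_restrict[OF g _ ij])
    have "(\<lambda>t p. fst (if p \<in> cell g i j then q t p else 0)) = (\<lambda>t p. if p \<in> cell g i j then fst (q t p) else 0)"
      "(\<lambda>t p. snd (if p \<in> cell g i j then q t p else 0)) = (\<lambda>t p. if p \<in> cell g i j then snd (q t p) else 0)" by (simp_all add: fun_eq_iff)
    then show ?thesis using q r[of "\<lambda>t p. fst (q t p)"] r[of "\<lambda>t p. snd (q t p)"] by (simp add: L2_time_vec_def)
  qed
  moreover have "p \<notin> cell g i j" if "p \<in> Omega - closure (cell g i j)" for p i j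
    using that closure_subset by blast
  ultimately show ?thesis unfolding local_tests_def by simp
qed

text \<open>Stated for any pair of staggered grids, so that it serves both equations with the meshes
  exchanged. Hypothesis \<open>eq\<close> has already eliminated the source. The relaxation term
  stays in the conclusion, since it acquires a sign only after both inequalities are added.\<close>

lemma mesh_energy:
  fixes u u' w w' :: "real \<Rightarrow> scalar_field" and qL qR qL' qR' :: "real \<Rightarrow> vector_field"
  assumes T: "0 < T" and g: "grid M g" and h: "grid M' h" and dis: "disjoint_grids M g M' h"
    and \<alpha>: "1 < \<alpha>" "\<alpha> < 2" and \<beta>: "1 < \<beta>" "\<beta> < 2"
    and u: "u \<in> H1_time T (broken_poly k M g)" "u' \<in> H1_time T (broken_poly k M g)"
    and w: "w \<in> L2_time T Y" "w' \<in> L2_time T Y"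
    and u0: "\<And>t p. t \<in> {0..T} \<Longrightarrow> p \<notin> Omega \<Longrightarrow> u t p = 0" "\<And>t p. t \<in> {0..T} \<Longrightarrow> p \<notin> Omega \<Longrightarrow> u' t p = 0"
    and q: "qL \<in> L2_time_vec T (broken_poly k M' h)" "qR \<in> L2_time_vec T (broken_poly k M' h)"
      "qL' \<in> L2_time_vec T (broken_poly k M' h)" "qR' \<in> L2_time_vec T (broken_poly k M' h)"
    and eq: "\<And>v \<phi>L \<phi>R. v \<in> H1_time T (broken_poly k M g) \<Longrightarrow> \<phi>L \<in> local_tests T (broken_poly k M' h) M' h \<Longrightarrow>
        \<phi>R \<in> local_tests T (broken_poly k M' h) M' h \<Longrightarrow>
        LDG_form \<alpha> \<beta> \<tau> T M g M' h u w qL qR v \<phi>L \<phi>R = LDG_form \<alpha> \<beta> \<tau> T M g M' h u' w' qL' qR' v \<phi>L \<phi>R"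
  defines "e \<equiv> \<lambda>t p. u t p - u' t p" and "d \<equiv> \<lambda>t p. w t p - w' t p"
  shows "((LINT p:Omega|lebesgue. (e T p)\<^sup>2) - (LINT p:Omega|lebesgue. (e 0 p)\<^sup>2)) / 2
      + 1 / \<tau> * (LINT t:{0..T}|lebesgue. ip Omega (\<lambda>p. e t p - d t p) (e t)) \<le> 0"
proof -
  have OmB: "Omega \<in> sets borel" unfolding Omega_def by (intro borel_Times) auto
  have td: "has_time_deriv T u (time_deriv T u)" "has_time_deriv T u' (time_deriv T u')"
  proof -
    have ex: "\<exists>f. has_time_deriv T u f" "\<exists>f. has_time_deriv T u' f" using u by (auto simp: H1_time_def)
    show "has_time_deriv T u (time_deriv T u)" "has_time_deriv T u' (time_deriv T u')"
      unfolding time_deriv_def by (rule someI_ex[OF ex(1)], rule someI_ex[OF ex(2)])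
  qed
  have D: "time_deriv T u \<in> L2_time T UNIV" "time_deriv T u' \<in> L2_time T UNIV"
    using td by (auto simp: has_time_deriv_def)
  have uL: "u \<in> L2_time T (broken_poly k M g)" "u' \<in> L2_time T (broken_poly k M g)" using u by (auto simp: H1_time_def)
  have eH: "e \<in> H1_time T (broken_poly k M g)" unfolding e_def using u by (rule H1_time_diff)
  have eL: "e \<in> L2_time T (broken_poly k M g)" using eH by (simp add: H1_time_def)
  have d2: "d \<in> L2_time T UNIV" unfolding d_def using L2_time_diff[OF L2_time_mono[OF w(1)] L2_time_mono[OF w(2)]] by simp
  have ed: "(\<lambda>t p. e t p - d t p) \<in> L2_time T UNIV" using L2_time_diff[OF L2_time_mono[OF eL] d2] by simp
  define q1 where "q1 t p = qL t p - qL' t p" for t p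
  define q2 where "q2 t p = qR t p - qR' t p" for t p
  let ?\<phi>L = "\<lambda>i j t p. if p \<in> cell h i j then q1 t p else 0"
  let ?\<phi>R = "\<lambda>i j t p. if p \<in> cell h i j then q2 t p else 0"
  have tests: "?\<phi>L \<in> local_tests T (broken_poly k M' h) M' h" "?\<phi>R \<in> local_tests T (broken_poly k M' h) M' h"
    using L2_time_vec_diff[OF q(1,3)] L2_time_vec_diff[OF q(2,4)] unfolding q1_def q2_def
    by (auto intro!: local_tests_restrict[OF h])
  have qc: "(\<lambda>t p. fst (qL t p)) \<in> L2_time T (broken_poly k M' h)" "(\<lambda>t p. snd (qL t p)) \<in> L2_time T (broken_poly k M' h)"
    "(\<lambda>t p. fst (qR t p)) \<in> L2_time T (broken_poly k M' h)" "(\<lambda>t p. snd (qR t p)) \<in> L2_time T (broken_poly k M' h)"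
    "(\<lambda>t p. fst (qL' t p)) \<in> L2_time T (broken_poly k M' h)" "(\<lambda>t p. snd (qL' t p)) \<in> L2_time T (broken_poly k M' h)"
    "(\<lambda>t p. fst (qR' t p)) \<in> L2_time T (broken_poly k M' h)" "(\<lambda>t p. snd (qR' t p)) \<in> L2_time T (broken_poly k M' h)"
    using q by (auto simp: L2_time_vec_def)
  obtain du where du: "coeff_rep T k M g du u" using L2_time_coefficients[OF g uL(1)] by blast
  obtain du' where du': "coeff_rep T k M g du' u'" using L2_time_coefficients[OF g uL(2)] by blast
  obtain cLx where cLx: "coeff_rep T k M' h cLx (\<lambda>t p. fst (qL t p))" using L2_time_coefficients[OF h qc(1)] by blast
  obtain cLy where cLy: "coeff_rep T k M' h cLy (\<lambda>t p. snd (qL t p))" using L2_time_coefficients[OF h qc(2)] by blast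
  obtain cRx where cRx: "coeff_rep T k M' h cRx (\<lambda>t p. fst (qR t p))" using L2_time_coefficients[OF h qc(3)] by blast
  obtain cRy where cRy: "coeff_rep T k M' h cRy (\<lambda>t p. snd (qR t p))" using L2_time_coefficients[OF h qc(4)] by blast
  obtain cLx' where cLx': "coeff_rep T k M' h cLx' (\<lambda>t p. fst (qL' t p))" using L2_time_coefficients[OF h qc(5)] by blast
  obtain cLy' where cLy': "coeff_rep T k M' h cLy' (\<lambda>t p. snd (qL' t p))" using L2_time_coefficients[OF h qc(6)] by blast
  obtain cRx' where cRx': "coeff_rep T k M' h cRx' (\<lambda>t p. fst (qR' t p))" using L2_time_coefficients[OF h qc(7)] by blast
  obtain cRy' where cRy': "coeff_rep T k M' h cRy' (\<lambda>t p. snd (qR' t p))" using L2_time_coefficients[OF h qc(8)] by blast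
  have dv: "coeff_rep T k M g (\<lambda>a t. du a t - du' a t) e"
    "coeff_rep T k M' h (\<lambda>a t. cLx a t - cLx' a t) (\<lambda>t p. fst (q1 t p))"
    "coeff_rep T k M' h (\<lambda>a t. cLy a t - cLy' a t) (\<lambda>t p. snd (q1 t p))"
    "coeff_rep T k M' h (\<lambda>a t. cRx a t - cRx' a t) (\<lambda>t p. fst (q2 t p))"
    "coeff_rep T k M' h (\<lambda>a t. cRy a t - cRy' a t) (\<lambda>t p. snd (q2 t p))"
    unfolding e_def q1_def q2_def fst_diff snd_diff
    by (rule coeff_rep_diff du du' cLx cLx' cLy cLy' cRx cRx' cRy cRy')+
  note args1 = g h dis \<alpha> \<beta> D(1) uL(1) w(1) eL u0(1) du dv(1) cLx cLy cRx cRy dv(2-5)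
  note E1 = LDG_form_eval(1)[OF args1] LDG_form_eval(2,3)[where \<tau> = \<tau>, OF args1]
  note args2 = g h dis \<alpha> \<beta> D(2) uL(2) w(2) eL u0(2) du' dv(1) cLx' cLy' cRx' cRy' dv(2-5)
  note E2 = LDG_form_eval(1)[OF args2] LDG_form_eval(2,3)[where \<tau> = \<tau>, OF args2]
  let ?s = "(2 - \<alpha>) / 2" and ?r = "(2 - \<beta>) / 2"
  define Z1 where "Z1 t = coupling ?s ?r k M g M' h (\<lambda>a. du a t) (\<lambda>a. cLx a t) (\<lambda>a. cLy a t)
      (\<lambda>a. cRx a t) (\<lambda>a. cRy a t) (\<lambda>a. du a t - du' a t) (\<lambda>a. cLx a t - cLx' a t) (\<lambda>a. cLy a t - cLy' a t)
      (\<lambda>a. cRx a t - cRx' a t) (\<lambda>a. cRy a t - cRy' a t)" for t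
  define Z2 where "Z2 t = coupling ?s ?r k M g M' h (\<lambda>a. du' a t) (\<lambda>a. cLx' a t) (\<lambda>a. cLy' a t)
      (\<lambda>a. cRx' a t) (\<lambda>a. cRy' a t) (\<lambda>a. du a t - du' a t) (\<lambda>a. cLx a t - cLx' a t) (\<lambda>a. cLy a t - cLy' a t)
      (\<lambda>a. cRx a t - cRx' a t) (\<lambda>a. cRy a t - cRy' a t)" for t
  define \<Psi>1 where "\<Psi>1 t = ip Omega (time_deriv T u t) (e t) + 1 / \<tau> * ip Omega (\<lambda>p. u t p - w t p) (e t) + Z1 t" for t
  define \<Psi>2 where "\<Psi>2 t = ip Omega (time_deriv T u' t) (e t) + 1 / \<tau> * ip Omega (\<lambda>p. u' t p - w' t p) (e t) + Z2 t" for t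
  have I: "set_integrable lebesgue {0..T} Z1" "set_integrable lebesgue {0..T} \<Psi>1"
     "LDG_form \<alpha> \<beta> \<tau> T M g M' h u w qL qR e ?\<phi>L ?\<phi>R = (LINT t:{0..T}|lebesgue. \<Psi>1 t)"
    "set_integrable lebesgue {0..T} Z2" "set_integrable lebesgue {0..T} \<Psi>2"
     "LDG_form \<alpha> \<beta> \<tau> T M g M' h u' w' qL' qR' e ?\<phi>L ?\<phi>R = (LINT t:{0..T}|lebesgue. \<Psi>2 t)"
    using E1 E2 unfolding Z1_def[abs_def] Z2_def[abs_def] \<Psi>1_def[abs_def] \<Psi>2_def[abs_def] by simp_all
  have Znn: "0 \<le> Z1 t - Z2 t" for t
    unfolding Z1_def Z2_def coupling_diff[OF g h dis]
    using \<alpha> \<beta> by (intro add_nonneg_nonneg frac_forms_nonneg h) auto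
  let ?g = "\<lambda>t p. time_deriv T u t p - time_deriv T u' t p"
  \<comment> \<open>\<open>?g\<close> is a time derivative of \<open>e\<close>, possibly not the one
    selected by \<open>time_deriv T e\<close>. The energy identity accepts any of them.\<close>
  have gd: "has_time_deriv T e ?g" unfolding e_def using td by (rule has_time_deriv_diff)
  have g2: "?g \<in> L2_time T UNIV" using gd by (simp add: has_time_deriv_def)
  have uw: "(\<lambda>t p. u t p - w t p) \<in> L2_time T UNIV" "(\<lambda>t p. u' t p - w' t p) \<in> L2_time T UNIV"
    using L2_time_diff[OF L2_time_mono[OF uL(1)] L2_time_mono[OF w(1)]] L2_time_diff[OF L2_time_mono[OF uL(2)] L2_time_mono[OF w(2)]] by simp_all
  have "0 = (LINT t:{0..T}|lebesgue. \<Psi>1 t) - (LINT t:{0..T}|lebesgue. \<Psi>2 t)"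
    using eq[OF eH tests] I by simp
  also have "\<dots> = (LINT t:{0..T}|lebesgue. \<Psi>1 t - \<Psi>2 t)"
    using I by (simp add: set_integral_diff)
  also have "\<dots> = (LINT t:{0..T}|lebesgue. ip Omega (?g t) (e t) + 1 / \<tau> * ip Omega (\<lambda>p. e t p - d t p) (e t) + (Z1 t - Z2 t))"
  proof (rule set_integral_lebesgue_cong_AE)
    show "AE t in lebesgue. t \<in> {0..T} \<longrightarrow> \<Psi>1 t - \<Psi>2 t = ip Omega (?g t) (e t) + 1 / \<tau> * ip Omega (\<lambda>p. e t p - d t p) (e t) + (Z1 t - Z2 t)"
      using ip_time_integrable(2)[OF D(1) eL OmB order_refl] ip_time_integrable(2)[OF D(2) eL OmB order_refl]
        ip_time_integrable(2)[OF uw(1) eL OmB order_refl] ip_time_integrable(2)[OF uw(2) eL OmB order_refl]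
    proof eventually_elim
      case (elim t)
      show ?case
      proof
        assume t: "t \<in> {0..T}"
        have 1: "ip Omega (?g t) (e t) = ip Omega (time_deriv T u t) (e t) - ip Omega (time_deriv T u' t) (e t)"
          unfolding ip_def inner_real_def left_diff_distrib using elim t by (intro set_integral_diff) simp_all
        have "ip Omega (\<lambda>p. (u t p - w t p) - (u' t p - w' t p)) (e t) = ip Omega (\<lambda>p. u t p - w t p) (e t) - ip Omega (\<lambda>p. u' t p - w' t p) (e t)"
          unfolding ip_def inner_real_def left_diff_distrib[of "u t _ - w t _" "u' t _ - w' t _"]
          using elim t by (intro set_integral_diff) blast+
        moreover have "(\<lambda>p. e t p - d t p) = (\<lambda>p. (u t p - w t p) - (u' t p - w' t p))" by (auto simp: e_def d_def)
        ultimately have 2: "ip Omega (\<lambda>p. e t p - d t p) (e t) = ip Omega (\<lambda>p. u t p - w t p) (e t) - ip Omega (\<lambda>p. u' t p - w' t p) (e t)"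
          by (simp only:)
        show "\<Psi>1 t - \<Psi>2 t = ip Omega (?g t) (e t) + 1 / \<tau> * ip Omega (\<lambda>p. e t p - d t p) (e t) + (Z1 t - Z2 t)"
          unfolding \<Psi>1_def \<Psi>2_def 1 2 right_diff_distrib by linarith
      qed
    qed
  qed
  also have "\<dots> = (LINT t:{0..T}|lebesgue. ip Omega (?g t) (e t)) + 1 / \<tau> * (LINT t:{0..T}|lebesgue. ip Omega (\<lambda>p. e t p - d t p) (e t))
      + (LINT t:{0..T}|lebesgue. Z1 t - Z2 t)"
    using ip_time_integrable(1)[OF g2 eL OmB order_refl] ip_time_integrable(1)[OF ed eL OmB order_refl] set_integral_diff(1)[OF I(1) I(4)]
    by (simp add: set_integral_add)
  finally have "(LINT t:{0..T}|lebesgue. ip Omega (?g t) (e t)) + 1 / \<tau> * (LINT t:{0..T}|lebesgue. ip Omega (\<lambda>p. e t p - d t p) (e t))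
      + (LINT t:{0..T}|lebesgue. Z1 t - Z2 t) = 0" by simp
  moreover have "0 \<le> (LINT t:{0..T}|lebesgue. Z1 t - Z2 t)"
    unfolding set_lebesgue_integral_def using Znn by (intro integral_nonneg_AE AE_I2) simp
  moreover have "(LINT t:{0..T}|lebesgue. ip Omega (?g t) (e t)) = ((LINT p:Omega|lebesgue. (e T p)\<^sup>2) - (LINT p:Omega|lebesgue. (e 0 p)\<^sup>2)) / 2"
  proof -
    have "e 0 \<in> broken_poly k M g" "e T \<in> broken_poly k M g" using eH T by (auto simp: H1_time_def)
    then obtain c c' where "rep k M g c (e 0)" "rep k M g c' (e T)" using rep_exists[OF g] by blast
    then show ?thesis
      using rep_square_integrable[OF g] by (intro energy_identity[OF T eL gd]) blast+
  qed
  ultimately show ?thesis by linarith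
qed

section \<open>The primal and the dual grid\<close>

lemma grid_node: "N \<ge> 1 \<Longrightarrow> grid N (node N)"
  by (auto simp: grid_def node_def divide_strict_right_mono)

lemma grid_dual_node:
  assumes N: "N \<ge> 1" shows "grid (N + 1) (dual_node N)"
  unfolding grid_def
proof (intro conjI allI impI)
  show "dual_node N 0 = 0" "dual_node N (N + 1) = 1" using N by (auto simp: dual_node_def node_def)
  fix i assume i: "i < N + 1"
  have p: "0 < real N" using N by simp
  \<comment> \<open>The first and the last dual intervals are half intervals, from a boundary point
    to the nearest midpoint.\<close>
  consider "i = 0" | "0 < i" "i < N" | "0 < i" "i = N" using i by linarith
  then show "dual_node N i < dual_node N (i + 1)"
  proof cases
    case 1
    then show ?thesis using N by (simp add: dual_node_def node_def)
  next
    case 2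
    then have "node N (i - 1) < node N i" "node N i < node N (i + 1)"
      using p by (auto simp: node_def divide_strict_right_mono)
    then show ?thesis using 2 by (simp add: dual_node_def)
  next
    case 3
    then have "node N (i - 1) < node N N" using p by (auto simp: node_def divide_strict_right_mono)
    then show ?thesis using 3 by (simp add: dual_node_def)
  qed
qed

lemma disjoint_grids_node:
  assumes N: "N \<ge> 1" shows "disjoint_grids N (node N) (N + 1) (dual_node N)"
  unfolding disjoint_grids_def
proof (intro allI impI)
  fix i j assume "i \<le> N" "j \<le> N + 1" and eq: "node N i = dual_node N j"
  show "node N i = 0 \<or> node N i = 1"
  proof (cases "j = 0 \<or> j = N + 1")
    case True
    then show ?thesis using eq N by (auto simp: dual_node_def node_def)
  next
    case False
    then have "real i / real N = (real (j - 1) / real N + real j / real N) / 2"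
      using eq by (simp add: dual_node_def node_def)
    then have "2 * real i = real (j - 1) + real j" using N by (simp add: field_simps)
    \<comment> \<open>Interior dual nodes are odd multiples of half the mesh width and primal nodes
      even ones, so parity excludes a coincidence.\<close>
    then have "2 * i = (j - 1) + j" by linarith
    then show ?thesis using False by presburger
  qed
qed

lemma L2_norm_square: "(L2_norm w)\<^sup>2 = (LINT p:Omega|lebesgue. (w p)\<^sup>2)"
proof -
  have "0 \<le> (LINT p:Omega|lebesgue. (w p)\<^sup>2)"
    unfolding set_lebesgue_integral_def by (intro integral_nonneg_AE AE_I2) simp
  then show ?thesis by (simp add: L2_norm_def)
qed

theorem theorem4p1:
  fixes \<alpha> \<beta> \<tau>max T :: real and k N :: nat
    and f :: "real \<Rightarrow> real \<times> real \<Rightarrow> real"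
    and u1 u2 u1' u2' :: "real \<Rightarrow> real \<times> real \<Rightarrow> real"
    and qL1 qR1 qL2 qR2 qL1' qR1' qL2' qR2' :: "real \<Rightarrow> real \<times> real \<Rightarrow> real \<times> real"
  assumes "T > 0" and "1 < \<alpha>" "\<alpha> < 2" and "1 < \<beta>" "\<beta> < 2" and "\<tau>max > 0" and "N \<ge> 1"
    and "LDG_solution \<alpha> \<beta> \<tau>max T k N f u1 u2 qL1 qR1 qL2 qR2"
    and "LDG_solution \<alpha> \<beta> \<tau>max T k N f u1' u2' qL1' qR1' qL2' qR2'"
  shows "(L2_norm (\<lambda>p. u1 T p - u1' T p))\<^sup>2 + (L2_norm (\<lambda>p. u2 T p - u2' T p))\<^sup>2
    \<le> (L2_norm (\<lambda>p. u1 0 p - u1' 0 p))\<^sup>2 + (L2_norm (\<lambda>p. u2 0 p - u2' 0 p))\<^sup>2"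
proof -
  define V where "V = broken_poly k N (node N)"
  define W where "W = broken_poly k (N + 1) (dual_node N)"
  note S = assms(8)[unfolded LDG_solution_def V_h_def W_h_def B1_def B2_def, folded V_def W_def]
  note S' = assms(9)[unfolded LDG_solution_def V_h_def W_h_def B1_def B2_def, folded V_def W_def]
  have gr: "grid N (node N)" "grid (N + 1) (dual_node N)" using grid_node grid_dual_node assms(7) by auto
  have dis: "disjoint_grids N (node N) (N + 1) (dual_node N)" "disjoint_grids (N + 1) (dual_node N) N (node N)"
    using disjoint_grids_node[OF assms(7)] by (auto simp: disjoint_grids_commute)
  have H: "u1 \<in> H1_time T V" "u1' \<in> H1_time T V" "u2 \<in> H1_time T W" "u2' \<in> H1_time T W" using S S' by blast+
  then have L: "u1 \<in> L2_time T V" "u1' \<in> L2_time T V" "u2 \<in> L2_time T W" "u2' \<in> L2_time T W"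
    by (simp_all add: H1_time_def)
  have z: "\<And>t p. t \<in> {0..T} \<Longrightarrow> p \<notin> Omega \<Longrightarrow> u1 t p = 0" "\<And>t p. t \<in> {0..T} \<Longrightarrow> p \<notin> Omega \<Longrightarrow> u1' t p = 0"
    "\<And>t p. t \<in> {0..T} \<Longrightarrow> p \<notin> Omega \<Longrightarrow> u2 t p = 0" "\<And>t p. t \<in> {0..T} \<Longrightarrow> p \<notin> Omega \<Longrightarrow> u2' t p = 0"
    using S S' by blast+
  have q: "qL1 \<in> L2_time_vec T V" "qR1 \<in> L2_time_vec T V" "qL1' \<in> L2_time_vec T V" "qR1' \<in> L2_time_vec T V"
    "qL2 \<in> L2_time_vec T W" "qR2 \<in> L2_time_vec T W" "qL2' \<in> L2_time_vec T W" "qR2' \<in> L2_time_vec T W"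
    using S S' by blast+
  let ?e1 = "\<lambda>t p. u1 t p - u1' t p" and ?e2 = "\<lambda>t p. u2 t p - u2' t p"
  \<comment> \<open>Both forms equal one and the same number, the time integral of the pairing of
    \<open>f\<close> with \<open>v\<close>, whatever the regularity of \<open>f\<close>.\<close>
  have eq1: "LDG_form \<alpha> \<beta> \<tau>max T N (node N) (N + 1) (dual_node N) u1 u2 qL2 qR2 v \<phi>L \<phi>R
      = LDG_form \<alpha> \<beta> \<tau>max T N (node N) (N + 1) (dual_node N) u1' u2' qL2' qR2' v \<phi>L \<phi>R"
    if "v \<in> H1_time T V" "\<phi>L \<in> local_tests T W (N + 1) (dual_node N)" "\<phi>R \<in> local_tests T W (N + 1) (dual_node N)" for v \<phi>L \<phi>R
    using S S' that by (metis (no_types, lifting))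
  have eq2: "LDG_form \<alpha> \<beta> \<tau>max T (N + 1) (dual_node N) N (node N) u2 u1 qL1 qR1 v \<phi>L \<phi>R
      = LDG_form \<alpha> \<beta> \<tau>max T (N + 1) (dual_node N) N (node N) u2' u1' qL1' qR1' v \<phi>L \<phi>R"
    if "v \<in> H1_time T W" "\<phi>L \<in> local_tests T V N (node N)" "\<phi>R \<in> local_tests T V N (node N)" for v \<phi>L \<phi>R
    using S S' that by (metis (no_types, lifting))
  have E1: "((LINT p:Omega|lebesgue. (?e1 T p)\<^sup>2) - (LINT p:Omega|lebesgue. (?e1 0 p)\<^sup>2)) / 2
      + 1 / \<tau>max * (LINT t:{0..T}|lebesgue. ip Omega (\<lambda>p. ?e1 t p - ?e2 t p) (?e1 t)) \<le> 0"
    by (rule mesh_energy[OF assms(1) gr dis(1) assms(2-5) H(1,2)[unfolded V_def] L(3,4) z(1,2) q(5-8)[unfolded W_def] eq1[unfolded V_def W_def]])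
  have E2: "((LINT p:Omega|lebesgue. (?e2 T p)\<^sup>2) - (LINT p:Omega|lebesgue. (?e2 0 p)\<^sup>2)) / 2
      + 1 / \<tau>max * (LINT t:{0..T}|lebesgue. ip Omega (\<lambda>p. ?e2 t p - ?e1 t p) (?e2 t)) \<le> 0"
    by (rule mesh_energy[OF assms(1) gr(2,1) dis(2) assms(2-5) H(3,4)[unfolded W_def] L(1,2) z(3,4) q(1-4)[unfolded V_def] eq2[unfolded V_def W_def]])
  have OmB: "Omega \<in> sets borel" unfolding Omega_def by (intro borel_Times) auto
  have e: "?e1 \<in> L2_time T UNIV" "?e2 \<in> L2_time T UNIV"
    using L2_time_diff[OF L2_time_mono[OF L(1)] L2_time_mono[OF L(2)]] L2_time_diff[OF L2_time_mono[OF L(3)] L2_time_mono[OF L(4)]] by simp_all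
  have ee: "(\<lambda>t p. ?e1 t p - ?e2 t p) \<in> L2_time T UNIV" "(\<lambda>t p. ?e2 t p - ?e1 t p) \<in> L2_time T UNIV"
    using L2_time_diff[OF e] L2_time_diff[OF e(2,1)] by simp_all
  note J1 = ip_time_integrable[OF ee(1) e(1) OmB order_refl] and J2 = ip_time_integrable[OF ee(2) e(2) OmB order_refl]
  have "(LINT t:{0..T}|lebesgue. ip Omega (\<lambda>p. ?e1 t p - ?e2 t p) (?e1 t)) + (LINT t:{0..T}|lebesgue. ip Omega (\<lambda>p. ?e2 t p - ?e1 t p) (?e2 t))
     = (LINT t:{0..T}|lebesgue. ip Omega (\<lambda>p. ?e1 t p - ?e2 t p) (?e1 t) + ip Omega (\<lambda>p. ?e2 t p - ?e1 t p) (?e2 t))"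
    by (rule set_integral_add(2)[OF J1(1) J2(1), symmetric])
  also have "\<dots> = (LINT t:{0..T}|lebesgue. ip Omega (\<lambda>p. ?e1 t p - ?e2 t p) (\<lambda>p. ?e1 t p - ?e2 t p))"
  proof (rule set_integral_lebesgue_cong_AE)
    show "AE t in lebesgue. t \<in> {0..T} \<longrightarrow> ip Omega (\<lambda>p. ?e1 t p - ?e2 t p) (?e1 t) + ip Omega (\<lambda>p. ?e2 t p - ?e1 t p) (?e2 t)
        = ip Omega (\<lambda>p. ?e1 t p - ?e2 t p) (\<lambda>p. ?e1 t p - ?e2 t p)"
      using J1(2) J2(2)
    proof eventually_elim
      case (elim t)
      show ?case
      proof
        assume t: "t \<in> {0..T}"
        have "ip Omega (\<lambda>p. ?e1 t p - ?e2 t p) (?e1 t) + ip Omega (\<lambda>p. ?e2 t p - ?e1 t p) (?e2 t) =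
           (LINT p:Omega|lebesgue. (?e1 t p - ?e2 t p) * ?e1 t p + (?e2 t p - ?e1 t p) * ?e2 t p)"
          unfolding ip_def inner_real_def using elim t by (intro set_integral_add(2)[symmetric]) blast+
        also have "\<dots> = ip Omega (\<lambda>p. ?e1 t p - ?e2 t p) (\<lambda>p. ?e1 t p - ?e2 t p)"
          unfolding ip_def inner_real_def by (simp add: algebra_simps)
        finally show "ip Omega (\<lambda>p. ?e1 t p - ?e2 t p) (?e1 t) + ip Omega (\<lambda>p. ?e2 t p - ?e1 t p) (?e2 t)
          = ip Omega (\<lambda>p. ?e1 t p - ?e2 t p) (\<lambda>p. ?e1 t p - ?e2 t p)" .
      qed
    qed
  qed
  also have "\<dots> \<ge> 0"
    unfolding ip_def set_lebesgue_integral_def by (intro integral_nonneg_AE AE_I2 scaleR_nonneg_nonneg) auto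
  finally have "0 \<le> 1 / \<tau>max * ((LINT t:{0..T}|lebesgue. ip Omega (\<lambda>p. ?e1 t p - ?e2 t p) (?e1 t)) + (LINT t:{0..T}|lebesgue. ip Omega (\<lambda>p. ?e2 t p - ?e1 t p) (?e2 t)))"
    using assms(6) by (intro mult_nonneg_nonneg) auto
  \<comment> \<open>Here \<open>r\<close> is \<open>1 / \<tau>max\<close>, and \<open>x\<close> and
    \<open>y\<close> are the relaxation terms. Only their sum is known to be nonnegative, so the two
    energy inequalities are added before these terms are dropped.\<close>
  moreover have "a + c \<le> b + d" if "0 \<le> r * (x + y)" "(a - b) / 2 + r * x \<le> 0" "(c - d) / 2 + r * y \<le> 0"
    for a b c d r x y :: real
    using that unfolding distrib_left by argo
  ultimately show ?thesis unfolding L2_norm_square using E1 E2 by blast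
qed

end
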